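(* Let $(G,\Pi)$ be a connected Poisson-Lie group with Lie algebra $\mathfrak{g}$ and let $H:G\to\mathbb{R}$ be a smooth Hamiltonian function. If $g\in G$ is a singular point of the Hamiltonian vector field $X_H^\Pi$ (that is, $X_H^\Pi(g)=0$) and $X_H^\Pi$ preserves a volume form on $G$, then $$\mathcal{M}^l_{\mathfrak{g}^*}(g)(H)+\mathcal{M}^r_{\mathfrak{g}^*}(g)(H)=0,$$ where $\mathcal{M}^l_{\mathfrak{g}^*}$ and $\mathcal{M}^r_{\mathfrak{g}^*}$ are the left-invariant and right-invariant vector fields on $G$ whose value at the identity is the modular character $\mathcal{M}_{\mathfrak{g}^*}\in\mathfrak{g}$ of the dual Lie algebra $\mathfrak{g}^*$.
   Context: A Poisson structure on a manifold $M$ is a bivector field $\Pi$ with $[\Pi,\Pi]=0$ (Schouten-Nijenhuis bracket). The map $\Pi^\sharp:T^*M\to TM$ is defined by $\langle\Pi^\sharp(\alpha),\beta\rangle=\Pi(\alpha,\beta)$, and the Hamiltonian vector field of $H\in C^\infty(M)$ is $X_H^\Pi=\Pi^\sharp(\mathrm{d}H)$. A Poisson-Lie group $(G,\Pi)$ is a Lie group $G$ with a Poisson structure $\Pi$ that is multiplicative: $\Pi(gh)=(L_g)_*(\Pi(h))+(R_h)_*(\Pi(g))$ for all $g,h\in G$. Then $\Pi(e)=0$ at the identity element $e$. The differential of $\Pi$ at $e$ (intrinsic derivative) defines a linear map $\delta=\mathrm{d}_e\Pi:\mathfrak{g}\to\wedge^2\mathfrak{g}$, where $\mathfrak{g}=T_eG$,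 and its dual map $\delta^*=[\cdot,\cdot]_{\mathfrak{g}^*}:\wedge^2\mathfrak{g}^*\to\mathfrak{g}^*$ is a Lie bracket on $\mathfrak{g}^*$; $(\mathfrak{g}^*,[\cdot,\cdot]_{\mathfrak{g}^*})$ is called the dual Lie algebra. The modular character of a finite-dimensional Lie algebra $\mathfrak{h}$ is $\mathcal{M}_{\mathfrak{h}}\in\mathfrak{h}^*$, $\mathcal{M}_{\mathfrak{h}}(\xi)=\mathrm{Tr}(\mathrm{ad}_\xi)$; thus $\mathcal{M}_{\mathfrak{g}^*}\in(\mathfrak{g}^* )^*=\mathfrak{g}$. A volume form is a nowhere vanishing form of top degree. A vector field $X$ preserves a volume form $\Phi$ if $\mathcal{L}_X\Phi=0$. For a vector field $Y$, $Y(g)(H)$ denotes the derivative of $H$ at $g$ in the direction $Y(g)$. *)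

theory Defs
  imports "HOL-Analysis.Analysis" "HOL-Library.Function_Algebras"
begin

section \<open>Smooth maps between normed spaces\<close>

text \<open>Meant for open \<open>S\<close> in a finite-dimensional space, where \<open>C\<^sup>k\<close> may be tested
  on directional derivatives.\<close>

primrec Ck_on :: "nat \<Rightarrow> ('a::real_normed_vector \<Rightarrow> 'b::real_normed_vector) \<Rightarrow> 'a set \<Rightarrow> bool" where
  "Ck_on 0 f S \<longleftrightarrow> continuous_on S f"
| "Ck_on (Suc k) f S \<longleftrightarrow>
     (\<forall>x\<in>S. f differentiable (at x)) \<and> (\<forall>v. Ck_on k (\<lambda>x. frechet_derivative f (at x) v) S)"

definition smooth_on :: "'a::real_normed_vector set \<Rightarrow> ('a \<Rightarrow> 'b::real_normed_vector) \<Rightarrow> bool" where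
  "smooth_on S f \<longleftrightarrow> (\<forall>k. Ck_on k f S)"


section \<open>Smooth manifolds\<close>

text \<open>The manifold is the whole type \<open>'g\<close>, with its type-class topology; a chart is a pair
  \<open>(U, \<phi>)\<close>, and only the values of \<open>\<phi>\<close> on \<open>U\<close> matter. The model space \<open>'e\<close> is a
  finite-dimensional inner product space rather than a member of class \<open>euclidean_space\<close>,
  because that class excludes dimension zero.\<close>

type_synonym ('g, 'e) chart = "'g set \<times> ('g \<Rightarrow> 'e)"

definition is_chart :: "('g::topological_space, 'e::real_normed_vector) chart \<Rightarrow> bool" where
  "is_chart c \<longleftrightarrow> (case c of (U, \<phi>) \<Rightarrow>
     open U \<and> open (\<phi> ` U) \<and> homeomorphism U (\<phi> ` U) \<phi> (inv_into U \<phi>))"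

definition smooth_atlas ::
  "('g::{t2_space,second_countable_topology}, 'e::{real_inner,banach}) chart set \<Rightarrow> bool" where
  "smooth_atlas A \<longleftrightarrow>
     (\<exists>B::'e set. finite B \<and> span B = UNIV) \<and>
     (\<forall>c\<in>A. is_chart c) \<and>
     \<Union> (fst ` A) = UNIV \<and>
     (\<forall>(U, \<phi>)\<in>A. \<forall>(V, \<psi>)\<in>A. smooth_on (\<phi> ` (U \<inter> V)) (\<psi> \<circ> inv_into U \<phi>))"

definition smooth_fun :: "('g::topological_space, 'e::real_normed_vector) chart set
    \<Rightarrow> 'g set \<Rightarrow> ('g \<Rightarrow> real) \<Rightarrow> bool" where
  "smooth_fun A W f \<longleftrightarrow> (\<forall>(U, \<phi>)\<in>A. smooth_on (\<phi> ` (U \<inter> W)) (f \<circ> inv_into U \<phi>))"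

definition smooth_at :: "('g::topological_space, 'e::real_normed_vector) chart set
    \<Rightarrow> 'g \<Rightarrow> ('g \<Rightarrow> real) \<Rightarrow> bool" where
  "smooth_at A p f \<longleftrightarrow> (\<exists>W. open W \<and> p \<in> W \<and> smooth_fun A W f)"

definition smooth_map :: "('g::topological_space, 'e::real_normed_vector) chart set
    \<Rightarrow> ('h::topological_space, 'f::real_normed_vector) chart set \<Rightarrow> ('g \<Rightarrow> 'h) \<Rightarrow> bool" where
  "smooth_map A B F \<longleftrightarrow> continuous_on UNIV F \<and>
     (\<forall>(U, \<phi>)\<in>A. \<forall>(V, \<psi>)\<in>B. smooth_on (\<phi> ` (U \<inter> F -` V)) (\<psi> \<circ> F \<circ> inv_into U \<phi>))"

definition prod_atlas :: "('g, 'e) chart set \<Rightarrow> ('h, 'f) chart set \<Rightarrow> ('g \<times> 'h, 'e \<times> 'f) chart set" where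
  "prod_atlas A B = {(U \<times> V, map_prod \<phi> \<psi>) | U \<phi> V \<psi>. (U, \<phi>) \<in> A \<and> (V, \<psi>) \<in> B}"

definition lie_group :: "('g::{t2_space,second_countable_topology}, 'e::{real_inner,banach}) chart set
    \<Rightarrow> ('g \<Rightarrow> 'g \<Rightarrow> 'g) \<Rightarrow> 'g \<Rightarrow> ('g \<Rightarrow> 'g) \<Rightarrow> bool" where
  "lie_group A m e i \<longleftrightarrow> smooth_atlas A \<and> group m e i \<and>
     smooth_map (prod_atlas A A) A (\<lambda>(x, y). m x y) \<and> smooth_map A A i"


section \<open>Linear algebra in spaces of real functions\<close>

text \<open>Tangent and cotangent spaces below are linear subspaces of function types
  \<open>'x \<Rightarrow> real\<close>.\<close>

definition fscale :: "real \<Rightarrow> ('x \<Rightarrow> real) \<Rightarrow> 'x \<Rightarrow> real" where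
  "fscale c f = (\<lambda>x. c * f x)"

interpretation fun_vs: vector_space fscale
  by standard (auto simp: fscale_def fun_eq_iff algebra_simps)

definition trace_on :: "('x \<Rightarrow> real) set \<Rightarrow> (('x \<Rightarrow> real) \<Rightarrow> ('x \<Rightarrow> real)) \<Rightarrow> real" where
  "trace_on V L = (let B = (SOME B. fun_vs.independent B \<and> fun_vs.span B = V)
     in \<Sum>b\<in>B. fun_vs.representation B (L b) b)"


section \<open>Tangent and cotangent vectors\<close>

text \<open>A tangent vector at \<open>p\<close> is a derivation on functions that are smooth near \<open>p\<close>. Such a
  derivation depends only on the germ at \<open>p\<close>, by the Leibniz rule applied to a product with an
  indicator function. Vectors vanish on functions not smooth near \<open>p\<close>, and covectors vanish
  off the tangent space, so that equality is equality of functions.\<close>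

type_synonym 'g vec = "('g \<Rightarrow> real) \<Rightarrow> real"
type_synonym 'g covec = "'g vec \<Rightarrow> real"

definition tangent_space :: "('g::topological_space, 'e::real_normed_vector) chart set
    \<Rightarrow> 'g \<Rightarrow> 'g vec set" where
  "tangent_space A p = {v.
     (\<forall>f. \<not> smooth_at A p f \<longrightarrow> v f = 0) \<and>
     (\<forall>f h a b. smooth_at A p f \<and> smooth_at A p h \<longrightarrow>
        v (\<lambda>x. a * f x + b * h x) = a * v f + b * v h) \<and>
     (\<forall>f h. smooth_at A p f \<and> smooth_at A p h \<longrightarrow>
        v (\<lambda>x. f x * h x) = v f * h p + f p * v h)}"

definition cotangent_space :: "('g::topological_space, 'e::real_normed_vector) chart set
    \<Rightarrow> 'g \<Rightarrow> 'g covec set" where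
  "cotangent_space A p = {\<alpha>.
     (\<forall>v. v \<notin> tangent_space A p \<longrightarrow> \<alpha> v = 0) \<and>
     (\<forall>v\<in>tangent_space A p. \<forall>w\<in>tangent_space A p. \<forall>a b.
        \<alpha> (fscale a v + fscale b w) = a * \<alpha> v + b * \<alpha> w)}"

definition differential :: "('g::topological_space, 'e::real_normed_vector) chart set
    \<Rightarrow> 'g \<Rightarrow> ('g \<Rightarrow> real) \<Rightarrow> 'g covec" where
  "differential A p f = (\<lambda>v. if v \<in> tangent_space A p then v f else 0)"

definition push_vec :: "('g::topological_space, 'e::real_normed_vector) chart set
    \<Rightarrow> ('g \<Rightarrow> 'g) \<Rightarrow> 'g \<Rightarrow> 'g vec \<Rightarrow> 'g vec" where
  "push_vec A F p v = (\<lambda>f. if smooth_at A (F p) f then v (f \<circ> F) else 0)"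

definition pull_covec :: "('g::topological_space, 'e::real_normed_vector) chart set
    \<Rightarrow> ('g \<Rightarrow> 'g) \<Rightarrow> 'g \<Rightarrow> 'g covec \<Rightarrow> 'g covec" where
  "pull_covec A F p \<alpha> = (\<lambda>v. if v \<in> tangent_space A p then \<alpha> (push_vec A F p v) else 0)"


section \<open>Vector fields and volume forms\<close>

definition smooth_vector_field :: "('g::topological_space, 'e::real_normed_vector) chart set
    \<Rightarrow> 'g set \<Rightarrow> ('g \<Rightarrow> 'g vec) \<Rightarrow> bool" where
  "smooth_vector_field A U Y \<longleftrightarrow> (\<forall>x\<in>U. Y x \<in> tangent_space A x) \<and>
     (\<forall>V f. open V \<and> V \<subseteq> U \<and> smooth_fun A V f \<longrightarrow> smooth_fun A V (\<lambda>x. Y x f))"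

definition lie_bracket :: "('g::topological_space, 'e::real_normed_vector) chart set
    \<Rightarrow> ('g \<Rightarrow> 'g vec) \<Rightarrow> ('g \<Rightarrow> 'g vec) \<Rightarrow> 'g \<Rightarrow> 'g vec" where
  "lie_bracket A X Y p = (\<lambda>f. if smooth_at A p f
     then X p (\<lambda>x. Y x f) - Y p (\<lambda>x. X x f) else 0)"

text \<open>A form of top degree \<open>n\<close> takes a list of \<open>n\<close> tangent vectors as its arguments.\<close>

definition alternating_form :: "'g vec set \<Rightarrow> nat \<Rightarrow> ('g vec list \<Rightarrow> real) \<Rightarrow> bool" where
  "alternating_form T n \<omega> \<longleftrightarrow>
     (\<forall>vs i a b v w. length vs = n \<and> set vs \<subseteq> T \<and> i < n \<and> v \<in> T \<and> w \<in> T \<longrightarrow>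
        \<omega> (vs[i := fscale a v + fscale b w]) = a * \<omega> (vs[i := v]) + b * \<omega> (vs[i := w])) \<and>
     (\<forall>vs i j. length vs = n \<and> set vs \<subseteq> T \<and> i < j \<and> j < n \<and> vs ! i = vs ! j \<longrightarrow> \<omega> vs = 0)"

definition volume_form :: "('g::topological_space, 'e::real_normed_vector) chart set
    \<Rightarrow> ('g \<Rightarrow> 'g vec list \<Rightarrow> real) \<Rightarrow> bool" where
  "volume_form A \<Phi> \<longleftrightarrow> (let n = dim (UNIV :: 'e set) in
     (\<forall>p. alternating_form (tangent_space A p) n (\<Phi> p)) \<and>
     (\<forall>U Ys. open U \<and> length Ys = n \<and> (\<forall>Y\<in>set Ys. smooth_vector_field A U Y) \<longrightarrow>
        smooth_fun A U (\<lambda>x. \<Phi> x (map (\<lambda>Y. Y x) Ys))) \<and>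
     (\<forall>p. \<exists>vs. length vs = n \<and> set vs \<subseteq> tangent_space A p \<and> \<Phi> p vs \<noteq> 0))"

text \<open>The Lie derivative \<open>(L\<^sub>X \<Phi>)(Y\<^sub>1, \<dots>, Y\<^sub>n) =
  X (\<Phi>(Y\<^sub>1, \<dots>, Y\<^sub>n)) - \<Sum>\<^sub>i \<Phi>(Y\<^sub>1, \<dots>, [X, Y\<^sub>i], \<dots>, Y\<^sub>n)\<close>, on vector fields
  defined near the point.\<close>

definition lie_derivative :: "('g::topological_space, 'e::real_normed_vector) chart set
    \<Rightarrow> ('g \<Rightarrow> 'g vec) \<Rightarrow> ('g \<Rightarrow> 'g vec list \<Rightarrow> real) \<Rightarrow> ('g \<Rightarrow> 'g vec) list \<Rightarrow> 'g \<Rightarrow> real" where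
  "lie_derivative A X \<Phi> Ys p =
     X p (\<lambda>x. \<Phi> x (map (\<lambda>Y. Y x) Ys)) -
     (\<Sum>i<length Ys. \<Phi> p ((map (\<lambda>Y. Y p) Ys)[i := lie_bracket A X (Ys ! i) p]))"

definition preserves_form :: "('g::topological_space, 'e::real_normed_vector) chart set
    \<Rightarrow> ('g \<Rightarrow> 'g vec) \<Rightarrow> ('g \<Rightarrow> 'g vec list \<Rightarrow> real) \<Rightarrow> bool" where
  "preserves_form A X \<Phi> \<longleftrightarrow>
     (\<forall>U Ys. open U \<and> length Ys = dim (UNIV :: 'e set) \<and>
        (\<forall>Y\<in>set Ys. smooth_vector_field A U Y) \<longrightarrow>
        (\<forall>p\<in>U. lie_derivative A X \<Phi> Ys p = 0))"


section \<open>Poisson structures\<close>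

text \<open>A bivector at \<open>p\<close> is an alternating bilinear form on the cotangent space at \<open>p\<close>; its
  values on other arguments are irrelevant.\<close>

type_synonym 'g bivec = "'g covec \<Rightarrow> 'g covec \<Rightarrow> real"

definition bivector :: "('g::topological_space, 'e::real_normed_vector) chart set
    \<Rightarrow> 'g \<Rightarrow> 'g bivec \<Rightarrow> bool" where
  "bivector A p P \<longleftrightarrow>
     (\<forall>\<alpha>\<in>cotangent_space A p. P \<alpha> \<alpha> = 0) \<and>
     (\<forall>\<alpha>\<in>cotangent_space A p. \<forall>\<beta>\<in>cotangent_space A p. \<forall>\<gamma>\<in>cotangent_space A p. \<forall>a b.
        P (fscale a \<alpha> + fscale b \<beta>) \<gamma> = a * P \<alpha> \<gamma> + b * P \<beta> \<gamma> \<and>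
        P \<gamma> (fscale a \<alpha> + fscale b \<beta>) = a * P \<gamma> \<alpha> + b * P \<gamma> \<beta>)"

definition bivector_apply :: "('g::topological_space, 'e::real_normed_vector) chart set
    \<Rightarrow> ('g \<Rightarrow> 'g bivec) \<Rightarrow> ('g \<Rightarrow> real) \<Rightarrow> ('g \<Rightarrow> real) \<Rightarrow> 'g \<Rightarrow> real" where
  "bivector_apply A P f h = (\<lambda>x. P x (differential A x f) (differential A x h))"

definition bivector_field :: "('g::topological_space, 'e::real_normed_vector) chart set
    \<Rightarrow> ('g \<Rightarrow> 'g bivec) \<Rightarrow> bool" where
  "bivector_field A P \<longleftrightarrow> (\<forall>p. bivector A p (P p)) \<and>
     (\<forall>U f h. open U \<and> smooth_fun A U f \<and> smooth_fun A U h \<longrightarrow>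
        smooth_fun A U (bivector_apply A P f h))"

text \<open>The Schouten-Nijenhuis bracket of two bivector fields, a trivector field, evaluated on
  the differentials of three functions. Viewing bivector fields as biderivations, it is
  the sum over (2,1)-shuffles, that is over cyclic permutations, of
  \<open>P(Q(f, h), k) + Q(P(f, h), k)\<close>.\<close>

definition schouten_bracket :: "('g::topological_space, 'e::real_normed_vector) chart set
    \<Rightarrow> ('g \<Rightarrow> 'g bivec) \<Rightarrow> ('g \<Rightarrow> 'g bivec)
    \<Rightarrow> ('g \<Rightarrow> real) \<Rightarrow> ('g \<Rightarrow> real) \<Rightarrow> ('g \<Rightarrow> real) \<Rightarrow> 'g \<Rightarrow> real" where
  "schouten_bracket A P Q f h k p =
     (let b = bivector_apply A in
       b P (b Q f h) k p + b P (b Q h k) f p + b P (b Q k f) h p +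
       b Q (b P f h) k p + b Q (b P h k) f p + b Q (b P k f) h p)"

definition poisson_structure :: "('g::topological_space, 'e::real_normed_vector) chart set
    \<Rightarrow> ('g \<Rightarrow> 'g bivec) \<Rightarrow> bool" where
  "poisson_structure A P \<longleftrightarrow> bivector_field A P \<and>
     (\<forall>p f h k. smooth_at A p f \<and> smooth_at A p h \<and> smooth_at A p k \<longrightarrow>
        schouten_bracket A P P f h k p = 0)"

text \<open>As \<open>\<langle>P\<^sup>\<sharp> \<alpha>, \<beta>\<rangle> = P(\<alpha>, \<beta>)\<close>, the derivation \<open>P\<^sup>\<sharp> \<alpha>\<close>
  maps \<open>f\<close> to \<open>P(\<alpha>, df)\<close>.\<close>

definition sharp :: "('g::topological_space, 'e::real_normed_vector) chart set
    \<Rightarrow> 'g \<Rightarrow> 'g bivec \<Rightarrow> 'g covec \<Rightarrow> 'g vec" where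
  "sharp A p P \<alpha> = (\<lambda>f. if smooth_at A p f then P \<alpha> (differential A p f) else 0)"

definition hamiltonian_vf :: "('g::topological_space, 'e::real_normed_vector) chart set
    \<Rightarrow> ('g \<Rightarrow> 'g bivec) \<Rightarrow> ('g \<Rightarrow> real) \<Rightarrow> 'g \<Rightarrow> 'g vec" where
  "hamiltonian_vf A P H p = sharp A p (P p) (differential A p H)"


section \<open>Poisson-Lie groups and the dual Lie algebra\<close>

definition push_bivec :: "('g::topological_space, 'e::real_normed_vector) chart set
    \<Rightarrow> ('g \<Rightarrow> 'g) \<Rightarrow> 'g \<Rightarrow> 'g bivec \<Rightarrow> 'g bivec" where
  "push_bivec A F p P = (\<lambda>\<alpha> \<beta>. P (pull_covec A F p \<alpha>) (pull_covec A F p \<beta>))"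

definition multiplicative :: "('g::topological_space, 'e::real_normed_vector) chart set
    \<Rightarrow> ('g \<Rightarrow> 'g \<Rightarrow> 'g) \<Rightarrow> ('g \<Rightarrow> 'g bivec) \<Rightarrow> bool" where
  "multiplicative A m P \<longleftrightarrow>
     (\<forall>g h. \<forall>\<alpha>\<in>cotangent_space A (m g h). \<forall>\<beta>\<in>cotangent_space A (m g h).
        P (m g h) \<alpha> \<beta> = push_bivec A (\<lambda>x. m g x) h (P h) \<alpha> \<beta>
                       + push_bivec A (\<lambda>x. m x h) g (P g) \<alpha> \<beta>)"

definition poisson_lie_group ::
  "('g::{t2_space,second_countable_topology}, 'e::{real_inner,banach}) chart set
    \<Rightarrow> ('g \<Rightarrow> 'g \<Rightarrow> 'g) \<Rightarrow> 'g \<Rightarrow> ('g \<Rightarrow> 'g) \<Rightarrow> ('g \<Rightarrow> 'g bivec) \<Rightarrow> bool" where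
  "poisson_lie_group A m e i P \<longleftrightarrow>
     lie_group A m e i \<and> poisson_structure A P \<and> multiplicative A m P"

text \<open>The intrinsic derivative at a zero \<open>e\<close> of \<open>P\<close> is \<open>\<xi> \<mapsto> (L\<^sub>X P)(e)\<close> for
  any vector field \<open>X\<close> with \<open>X(e) = \<xi>\<close>. As \<open>P(e) = 0\<close>, its value on
  \<open>(df, dh)\<close> is the derivative of \<open>P(df, dh)\<close> along \<open>\<xi>\<close>, which depends on \<open>f\<close> and \<open>h\<close>
  only through their differentials at \<open>e\<close>; every covector is such a differential.\<close>

definition intrinsic_derivative :: "('g::topological_space, 'e::real_normed_vector) chart set
    \<Rightarrow> 'g \<Rightarrow> ('g \<Rightarrow> 'g bivec) \<Rightarrow> 'g vec \<Rightarrow> 'g bivec" where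
  "intrinsic_derivative A e P \<xi> \<alpha> \<beta> = (THE r. \<forall>f h.
     smooth_at A e f \<and> smooth_at A e h \<and> differential A e f = \<alpha> \<and> differential A e h = \<beta> \<longrightarrow>
     r = \<xi> (bivector_apply A P f h))"

text \<open>The transpose of the intrinsic derivative, a bracket on the dual \<open>cotangent_space A e\<close>
  of the Lie algebra \<open>tangent_space A e\<close>.\<close>

definition dual_bracket :: "('g::topological_space, 'e::real_normed_vector) chart set
    \<Rightarrow> 'g \<Rightarrow> ('g \<Rightarrow> 'g bivec) \<Rightarrow> 'g covec \<Rightarrow> 'g covec \<Rightarrow> 'g covec" where
  "dual_bracket A e P \<alpha> \<beta> =
     (\<lambda>\<xi>. if \<xi> \<in> tangent_space A e then intrinsic_derivative A e P \<xi> \<alpha> \<beta> else 0)"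

definition dual_modular_character :: "('g::topological_space, 'e::real_normed_vector) chart set
    \<Rightarrow> 'g \<Rightarrow> ('g \<Rightarrow> 'g bivec) \<Rightarrow> 'g covec \<Rightarrow> real" where
  "dual_modular_character A e P \<alpha> = trace_on (cotangent_space A e) (dual_bracket A e P \<alpha>)"

text \<open>The modular character of the dual Lie algebra as an element of the Lie algebra itself,
  through the canonical isomorphism with the bidual.\<close>

definition dual_modular_vector :: "('g::topological_space, 'e::real_normed_vector) chart set
    \<Rightarrow> 'g \<Rightarrow> ('g \<Rightarrow> 'g bivec) \<Rightarrow> 'g vec" where
  "dual_modular_vector A e P = (THE v. v \<in> tangent_space A e \<and>
     (\<forall>\<alpha>\<in>cotangent_space A e. \<alpha> v = dual_modular_character A e P \<alpha>))"

definition left_invariant_vf :: "('g::topological_space, 'e::real_normed_vector) chart set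
    \<Rightarrow> ('g \<Rightarrow> 'g \<Rightarrow> 'g) \<Rightarrow> 'g \<Rightarrow> 'g vec \<Rightarrow> 'g \<Rightarrow> 'g vec" where
  "left_invariant_vf A m e v g = push_vec A (\<lambda>x. m g x) e v"

definition right_invariant_vf :: "('g::topological_space, 'e::real_normed_vector) chart set
    \<Rightarrow> ('g \<Rightarrow> 'g \<Rightarrow> 'g) \<Rightarrow> 'g \<Rightarrow> 'g vec \<Rightarrow> 'g \<Rightarrow> 'g vec" where
  "right_invariant_vf A m e v g = push_vec A (\<lambda>x. m x g) e v"

end

theory Submission
  imports Defs
begin

text \<open>Write \<open>{f, h}\<close> for the function \<open>P(df, dh)\<close> and \<open>X f = {H, f}\<close> for the Hamiltonian vector
field. At a zero \<open>g\<close> of \<open>X\<close> the Lie bracket with \<open>X\<close> depends only on the linearization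
\<open>D v = (f \<mapsto> v {H, f})\<close> of \<open>X\<close>, an endomorphism of \<open>T\<^sub>g G\<close>, and the Lie derivative of a volume
form \<open>\<Phi>\<close> at \<open>g\<close> is the trace of \<open>D\<close> times \<open>\<Phi>\<close>. So preservation of a volume form forces
\<open>tr D = 0\<close> (\<open>linearization_trace_zero\<close>).

This trace is then computed in two ways. Fix coordinates \<open>y\<^sub>b\<close> at \<open>e\<close> with partial derivatives \<open>\<xi>\<^sub>b\<close>, and
let \<open>l\<^sub>b\<close> and \<open>r\<^sub>b\<close> be their left and right translates to coordinates at \<open>g\<close>. Multiplicativity of \<open>P\<close> says
\<open>{H, f}(g h) = {H \<circ> L\<^sub>g, f \<circ> L\<^sub>g}(h) + {H \<circ> R\<^sub>h, f \<circ> R\<^sub>h}(g)\<close>. Differentiate this in \<open>h\<close> at \<open>e\<close>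
along \<open>\<xi>\<^sub>a\<close>, with \<open>f = l\<^sub>a\<close>, and sum over \<open>a\<close>. The first term gives
\<open>\<Sum>\<^sub>a \<xi>\<^sub>a {H \<circ> L\<^sub>g, y\<^sub>a}\<close>, which is the trace of \<open>ad\<close> of \<open>d\<^sub>e(H \<circ> L\<^sub>g)\<close> in the dual Lie algebra, that
is, the left-invariant modular field applied to \<open>H\<close> (\<open>modular_vector\<close>, \<open>modular_vector_left\<close>). In the
second term the derivative falling on \<open>f\<close> is killed by \<open>X(g) = 0\<close>, and what remains is
\<open>\<Sum>\<^sub>a \<Sum>\<^sub>b K\<^sub>a\<^sub>b {r\<^sub>b, l\<^sub>a}(g)\<close>, where \<open>K\<^sub>a\<^sub>b\<close> is the mixed derivative of \<open>H(k g h)\<close> along \<open>\<xi>\<^sub>b\<close> in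
\<open>k\<close> and \<open>\<xi>\<^sub>a\<close> in \<open>h\<close> (\<open>linearization_split\<close>).

Everything is symmetric under passing to the opposite group, which exchanges left and right. It turns the
formula into one for the right-invariant modular field, with remainder
\<open>\<Sum>\<^sub>a \<Sum>\<^sub>b K\<^sub>a\<^sub>b {l\<^sub>a, r\<^sub>b}(g)\<close>: it is the same matrix \<open>K\<close>, since left-invariant and right-invariant
derivatives commute (\<open>two_sided_derivatives\<close>). By antisymmetry of the bracket the two remainders cancel in
the sum, and both traces vanish, which is the claim.

Most of the text supplies the calculus behind this argument. The analytic core is Hadamard's lemma, which
identifies derivations with combinations of the \<open>\<xi>\<^sub>b\<close> and shows that the intrinsic derivative of \<open>P\<close> at
\<open>e\<close> is well defined, and the symmetry of mixed partial derivatives.\<close>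

section \<open>Calculus of smooth maps\<close>

lemma Ck_on_subset: "Ck_on k f S \<Longrightarrow> T \<subseteq> S \<Longrightarrow> Ck_on k f T"
  by (induction k arbitrary: f) (auto intro: continuous_on_subset)

lemma Ck_on_Suc_imp: "Ck_on (Suc k) f S \<Longrightarrow> Ck_on k f S"
proof (induction k arbitrary: f)
  case 0
  then show ?case
    by (auto intro!: differentiable_imp_continuous_on differentiable_at_imp_differentiable_on)
next
  case (Suc k)
  note p = Suc.prems[unfolded Ck_on.simps(2)[of "Suc k"]]
  show ?case
    unfolding Ck_on.simps(2) by (intro conjI allI Suc.IH conjunct1[OF p] spec[OF conjunct2[OF p]])
qed

text \<open>Locally equal functions have the same candidates for a derivative at \<open>x\<close>, hence the same \<open>SOME\<close> choice,
differentiable or not.\<close>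

lemma frechet_derivative_cong_open:
  assumes "open S" "x \<in> S" "\<And>y. y \<in> S \<Longrightarrow> f y = g y"
  shows "frechet_derivative f (at x) = frechet_derivative g (at x)"
proof -
  have "(f has_derivative D) (at x) \<longleftrightarrow> (g has_derivative D) (at x)" for D
    using assms has_derivative_transform_within_open[of f D x UNIV S g]
      has_derivative_transform_within_open[of g D x UNIV S f] by auto
  then show ?thesis unfolding frechet_derivative_def by simp
qed

lemma differentiable_cong_open:
  assumes "open S" "x \<in> S" "\<And>y. y \<in> S \<Longrightarrow> f y = g y"
  shows "f differentiable (at x) \<longleftrightarrow> g differentiable (at x)"
proof -
  have "(f has_derivative D) (at x) \<longleftrightarrow> (g has_derivative D) (at x)" for D
    using assms has_derivative_transform_within_open[of f D x UNIV S g]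
      has_derivative_transform_within_open[of g D x UNIV S f] by auto
  then show ?thesis unfolding differentiable_def by simp
qed

lemma Ck_on_cong:
  assumes "open S" "\<And>y. y \<in> S \<Longrightarrow> f y = g y"
  shows "Ck_on k f S \<longleftrightarrow> Ck_on k g S"
  using assms(2)
proof (induction k arbitrary: f g)
  case 0
  show ?case unfolding Ck_on.simps(1) by (rule continuous_on_cong[OF refl 0])
next
  case (Suc k)
  have "Ck_on k (\<lambda>x. frechet_derivative f (at x) v) S \<longleftrightarrow>
      Ck_on k (\<lambda>x. frechet_derivative g (at x) v) S" for v
    using frechet_derivative_cong_open[OF assms(1) _ Suc.prems] by (intro Suc.IH) simp
  moreover have "f differentiable (at x) \<longleftrightarrow> g differentiable (at x)" if "x \<in> S" for x
    using that Suc.prems by (rule differentiable_cong_open[OF assms(1)])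
  ultimately show ?case unfolding Ck_on.simps(2) by simp
qed

lemma Ck_on_local:
  assumes "\<And>x. x \<in> S \<Longrightarrow> \<exists>T. open T \<and> x \<in> T \<and> Ck_on k f (S \<inter> T)"
  shows "Ck_on k f S"
  using assms
proof (induction k arbitrary: f)
  case 0
  have *: "\<exists>T. open T \<and> x \<in> T \<and> continuous_on (S \<inter> T) f" if "x \<in> S" for x
    using 0[OF that] by simp
  have "continuous (at x within S) f" if "x \<in> S" for x
  proof -
    obtain T where T: "open T" "x \<in> T" "continuous_on (S \<inter> T) f" using *[OF \<open>x \<in> S\<close>] by auto
    have "at x within S \<inter> T = at x within S" by (rule at_within_nhd[of _ T]) (use T in auto)
    then show ?thesis using T that by (metis IntI continuous_on_eq_continuous_within)
  qed
  then show ?case by (simp add: continuous_on_eq_continuous_within)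
next
  case (Suc k)
  have 1: "f differentiable (at x)" if "x \<in> S" for x
    using Suc.prems[OF that] that unfolding Ck_on.simps(2) by blast
  have 2: "Ck_on k (\<lambda>x. frechet_derivative f (at x) v) S" for v
  proof (rule Suc.IH)
    show "\<exists>T. open T \<and> x \<in> T \<and> Ck_on k (\<lambda>x. frechet_derivative f (at x) v) (S \<inter> T)" if "x \<in> S" for x
      using Suc.prems[OF that] unfolding Ck_on.simps(2) by blast
  qed
  show ?case unfolding Ck_on.simps(2) by (intro conjI ballI allI 1 2)
qed

lemma Ck_on_SucI:
  assumes "open S" "\<And>x. x \<in> S \<Longrightarrow> (f has_derivative D x) (at x)" "\<And>v. Ck_on k (\<lambda>x. D x v) S"
  shows "Ck_on (Suc k) f S"
proof -
  have 1: "Ck_on k (\<lambda>x. frechet_derivative f (at x) v) S" for v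
  proof (subst Ck_on_cong[OF assms(1)])
    show "frechet_derivative f (at y) v = D y v" if "y \<in> S" for y
      using frechet_derivative_at[OF assms(2)[OF that]] by simp
  qed (rule assms(3))
  show ?thesis
    unfolding Ck_on.simps(2) by (intro conjI ballI allI 1) (rule differentiableI[OF assms(2)])
qed

lemma Ck_on_Suc_has_derivative:
  assumes "Ck_on (Suc k) f S" "x \<in> S"
  shows "(f has_derivative frechet_derivative f (at x)) (at x)"
  using assms(1)[unfolded Ck_on.simps(2)] assms(2)
  by (intro frechet_derivative_works[THEN iffD1]) blast

lemma Ck_on_Suc_deriv:
  assumes "Ck_on (Suc k) f S" shows "Ck_on k (\<lambda>x. frechet_derivative f (at x) v) S"
  using assms[unfolded Ck_on.simps(2)] by (elim conjE allE)

lemma Ck_on_const: "Ck_on k (\<lambda>x. c) S"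
proof (induction k arbitrary: c)
  case (Suc k)
  show ?case by (simp only: Ck_on.simps frechet_derivative_const) (simp add: Suc.IH)
qed simp

lemma Ck_on_linear_comp:
  assumes "bounded_linear L" "open S" "Ck_on k f S"
  shows "Ck_on k (\<lambda>x. L (f x)) S"
  using assms(3)
proof (induction k arbitrary: f)
  case 0
  then show ?case by (auto intro: bounded_linear.continuous_on[OF assms(1)])
next
  case (Suc k)
  show ?case
    by (rule Ck_on_SucI[OF assms(2) bounded_linear.has_derivative[OF assms(1)]])
       (rule Ck_on_Suc_has_derivative[OF Suc.prems] Suc.IH Ck_on_Suc_deriv[OF Suc.prems]; assumption?)+
qed

lemma Ck_on_add:
  assumes "open S" "Ck_on k f S" "Ck_on k g S"
  shows "Ck_on k (\<lambda>x. f x + g x) S"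
  using assms(2,3)
proof (induction k arbitrary: f g)
  case 0
  then show ?case by (auto intro: continuous_intros)
next
  case (Suc k)
  show ?case
    by (rule Ck_on_SucI[OF assms(1) has_derivative_add])
      (rule Suc.prems[THEN Ck_on_Suc_has_derivative] Suc.IH Suc.prems[THEN Ck_on_Suc_deriv]; assumption?)+
qed

lemma Ck_on_sum:
  assumes "open S" "\<And>b. b \<in> B \<Longrightarrow> Ck_on k (f b) S"
  shows "Ck_on k (\<lambda>x. \<Sum>b\<in>B. f b x) S"
proof (cases "finite B")
  case True
  then show ?thesis using assms(2)
    by (induction B rule: finite_induct) (auto simp: Ck_on_const intro!: Ck_on_add[OF assms(1)])
qed (simp add: Ck_on_const)

lemma Ck_on_mult:
  fixes f g :: "'a::real_normed_vector \<Rightarrow> real"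
  assumes "open S" "Ck_on k f S" "Ck_on k g S"
  shows "Ck_on k (\<lambda>x. f x * g x) S"
  using assms(2,3)
proof (induction k arbitrary: f g)
  case 0
  then show ?case by (auto intro: continuous_intros)
next
  case (Suc k)
  show ?case
    by (rule Ck_on_SucI[OF assms(1) has_derivative_mult])
      (rule Suc.prems[THEN Ck_on_Suc_has_derivative] Ck_on_add[OF assms(1)] Suc.IH
        Suc.prems[THEN Ck_on_Suc_deriv] Suc.prems[THEN Ck_on_Suc_imp]; assumption?)+
qed

text \<open>Separate from the chain rule \<open>Ck_on_comp\<close>: for affine inner maps the spaces may be arbitrary normed
spaces, so that it applies to the product model space.\<close>

lemma Ck_on_affine_comp:
  assumes "bounded_linear L" "open S" "open T" "\<And>x. x \<in> T \<Longrightarrow> c + L x \<in> S" "Ck_on k f S"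
  shows "Ck_on k (\<lambda>x. f (c + L x)) T"
  using assms(5)
proof (induction k arbitrary: f)
  case 0
  have "continuous_on T (\<lambda>x. c + L x)"
    by (intro continuous_intros linear_continuous_on assms)
  then show ?case using assms(4) 0 by (auto intro: continuous_on_compose2[of S f])
next
  case (Suc k)
  show ?case
  proof (rule Ck_on_SucI[OF assms(3)])
    show "((\<lambda>x. f (c + L x)) has_derivative (\<lambda>v. frechet_derivative f (at (c + L x)) (L v))) (at x)"
      if "x \<in> T" for x
    proof -
      have "((\<lambda>x. c + L x) has_derivative L) (at x)"
        using has_derivative_add[OF has_derivative_const bounded_linear_imp_has_derivative[OF assms(1)]]
        by simp
      from diff_chain_at[OF this Ck_on_Suc_has_derivative[OF Suc.prems assms(4)[OF that]]]
      show ?thesis by (simp add: o_def)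
    qed
    show "Ck_on k (\<lambda>x. frechet_derivative f (at (c + L x)) (L v)) T" for v
      by (rule Suc.IH[OF Ck_on_Suc_deriv[OF Suc.prems]])
  qed
qed

text \<open>An explicit set in place of \<open>Basis\<close>, because the class \<open>euclidean_space\<close> excludes dimension zero.\<close>

definition orthonormal_basis :: "'e::real_inner set \<Rightarrow> bool" where
  "orthonormal_basis E \<longleftrightarrow> finite E \<and> span E = UNIV \<and> (\<forall>b\<in>E. \<forall>c\<in>E. b \<bullet> c = (if b = c then 1 else 0))"

text \<open>Gram-Schmidt, followed by normalization of the nonzero vectors.\<close>

lemma orthonormal_basis_exists:
  assumes "finite B" "span B = (UNIV :: 'e::real_inner set)"
  shows "\<exists>E::'e set. orthonormal_basis E"
proof -
  obtain C :: "'e set" where C: "finite C" "span C = UNIV" "pairwise orthogonal C"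
    using basis_orthogonal[OF assms(1)] assms(2) by metis
  define E where "E = (\<lambda>c. (1 / norm c) *\<^sub>R c) ` (C - {0})"
  have "c \<in> span E" if "c \<in> C" for c
  proof (cases "c = 0")
    case False
    then have "(1 / norm c) *\<^sub>R c \<in> span E" using that by (auto simp: E_def intro!: span_base)
    from span_scale[OF this, of "norm c"] show ?thesis using False by simp
  qed (simp add: span_zero)
  then have "span C \<subseteq> span E" by (intro span_minimal) auto
  moreover have "b \<bullet> c = (if b = c then 1 else 0)" if bc: "b \<in> E" "c \<in> E" for b c
  proof -
    obtain x y where xy: "x \<in> C" "x \<noteq> 0" "b = (1 / norm x) *\<^sub>R x" "y \<in> C" "y \<noteq> 0" "c = (1 / norm y) *\<^sub>R y"
      using bc by (auto simp: E_def)
    have 1: "x = y \<Longrightarrow> b \<bullet> c = 1"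
      using xy by (simp add: power2_norm_eq_inner[symmetric] power2_eq_square)
    have 2: "x \<noteq> y \<Longrightarrow> b \<bullet> c = 0"
      using xy C(3) by (auto simp: pairwise_def orthogonal_def)
    show ?thesis
    proof (cases "x = y")
      case True then show ?thesis using 1 xy by simp
    next
      case False
      then have "b \<bullet> c = 0" using 2 by simp
      moreover have "b \<bullet> b \<noteq> 0" using xy by simp
      ultimately show ?thesis by auto
    qed
  qed
  ultimately show ?thesis unfolding orthonormal_basis_def using C
    by (intro exI[of _ E]) (auto simp: E_def)
qed

lemma orthonormal_basis_expand:
  assumes "orthonormal_basis E"
  shows "x = (\<Sum>b\<in>E. (x \<bullet> b) *\<^sub>R b)"
proof -
  have E: "finite E" "span E = UNIV" and on: "\<And>b c. b \<in> E \<Longrightarrow> c \<in> E \<Longrightarrow> b \<bullet> c = (if b = c then 1 else 0)"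
    using assms by (auto simp: orthonormal_basis_def)
  have "x \<in> span E" using E by simp
  then obtain u where u: "x = (\<Sum>b\<in>E. u b *\<^sub>R b)" using E(1) span_finite by force
  have "x \<bullet> c = u c" if "c \<in> E" for c
  proof -
    have "x \<bullet> c = (\<Sum>b\<in>E. u b * (b \<bullet> c))" unfolding u by (simp add: inner_sum_left)
    also have "\<dots> = (\<Sum>b\<in>E. if b = c then u b else 0)" using that by (intro sum.cong) (auto simp: on)
    also have "\<dots> = u c" using that E by simp
    finally show ?thesis .
  qed
  then have "(\<Sum>b\<in>E. (x \<bullet> b) *\<^sub>R b) = (\<Sum>b\<in>E. u b *\<^sub>R b)" by (intro sum.cong) auto
  with u show ?thesis by simp
qed

lemma linear_orthonormal_expand:
  assumes "orthonormal_basis E" "linear L"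
  shows "L v = (\<Sum>b\<in>E. (v \<bullet> b) *\<^sub>R L b)"
  by (subst orthonormal_basis_expand[OF assms(1), of v])
     (simp add: linear_sum[OF assms(2)] linear_cmul[OF assms(2)])

lemma card_orthonormal_basis:
  assumes "orthonormal_basis (E :: 'e::real_inner set)"
  shows "dim (UNIV :: 'e set) = card E"
proof -
  have E: "finite E" "span E = UNIV" and on: "\<And>b c. b \<in> E \<Longrightarrow> c \<in> E \<Longrightarrow> b \<bullet> c = (if b = c then 1 else 0)"
    using assms by (auto simp: orthonormal_basis_def)
  have "independent E"
    by (rule pairwise_orthogonal_independent) (use on in \<open>force simp: pairwise_def orthogonal_def\<close>)+
  then show ?thesis using E by (intro dim_eq_card) auto
qed

text \<open>The chain rule expands the derivative of \<open>f \<circ> G\<close> into a sum of products over an orthonormal basis of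
the middle space. The induction therefore needs only directional derivatives of \<open>f\<close> in fixed directions,
which is the form in which \<open>Ck_on\<close> provides them.\<close>

lemma Ck_on_comp:
  fixes f :: "'e::real_inner \<Rightarrow> real" and G :: "'a::real_normed_vector \<Rightarrow> 'e"
  assumes E: "orthonormal_basis (E :: 'e set)" and op: "open S" "open T"
    and G: "\<And>x. x \<in> S \<Longrightarrow> G x \<in> T"
    and k: "Ck_on k G S" "Ck_on k f T"
  shows "Ck_on k (\<lambda>x. f (G x)) S"
  using k
proof (induction k arbitrary: f)
  case 0
  then show ?case using G by (auto intro!: continuous_on_compose2[of T f])
next
  case (Suc k)
  let ?D = "\<lambda>x v. \<Sum>b\<in>E. (frechet_derivative G (at x) v \<bullet> b) * frechet_derivative f (at (G x)) b"
  show ?case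
  proof (rule Ck_on_SucI[OF op(1)])
    show "((\<lambda>x. f (G x)) has_derivative ?D x) (at x)" if "x \<in> S" for x
    proof -
      note 1 = Ck_on_Suc_has_derivative[OF Suc.prems(1) that]
      note 2 = Ck_on_Suc_has_derivative[OF Suc.prems(2) G[OF that]]
      have "(\<lambda>v. frechet_derivative f (at (G x)) (frechet_derivative G (at x) v)) = ?D x"
        by (rule ext) (rule linear_orthonormal_expand[OF E has_derivative_linear[OF 2], unfolded real_scaleR_def])
      with diff_chain_at[OF 1 2, unfolded comp_def] show ?thesis by (simp only:)
    qed
    show "Ck_on k (\<lambda>x. ?D x v) S" for v
      by (intro Ck_on_sum Ck_on_mult op Ck_on_linear_comp[OF bounded_linear_inner_left]
          Ck_on_Suc_deriv[OF Suc.prems(1)] Suc.IH Ck_on_Suc_imp[OF Suc.prems(1)]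
          Ck_on_Suc_deriv[OF Suc.prems(2)])
  qed
qed

lemma smooth_onI: "(\<And>k. Ck_on k f S) \<Longrightarrow> smooth_on S f"
  unfolding smooth_on_def by (rule allI)

lemma smooth_onD: "smooth_on S f \<Longrightarrow> Ck_on k f S"
  unfolding smooth_on_def by (rule spec)

lemma smooth_on_subset: "smooth_on S f \<Longrightarrow> T \<subseteq> S \<Longrightarrow> smooth_on T f"
  by (rule smooth_onI, rule Ck_on_subset, rule smooth_onD)

lemma smooth_on_cong: "open S \<Longrightarrow> (\<And>y. y \<in> S \<Longrightarrow> f y = g y) \<Longrightarrow> smooth_on S f \<longleftrightarrow> smooth_on S g"
  unfolding smooth_on_def by (intro iff_allI Ck_on_cong)

lemma smooth_on_local:
  assumes "\<And>x. x \<in> S \<Longrightarrow> \<exists>T. open T \<and> x \<in> T \<and> smooth_on (S \<inter> T) f"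
  shows "smooth_on S f"
proof (rule smooth_onI, rule Ck_on_local)
  fix k x assume "x \<in> S"
  then obtain T where "open T" "x \<in> T" "smooth_on (S \<inter> T) f" using assms by blast
  then show "\<exists>T. open T \<and> x \<in> T \<and> Ck_on k f (S \<inter> T)" using smooth_onD by (intro exI[of _ T]) simp
qed

lemma smooth_on_const: "smooth_on S (\<lambda>x. c)"
  by (rule smooth_onI, rule Ck_on_const)

lemma smooth_on_add: "open S \<Longrightarrow> smooth_on S f \<Longrightarrow> smooth_on S g \<Longrightarrow> smooth_on S (\<lambda>x. f x + g x)"
  by (rule smooth_onI, rule Ck_on_add) (assumption | rule smooth_onD)+

lemma smooth_on_mult:
  fixes f g :: "'a::real_normed_vector \<Rightarrow> real"
  shows "open S \<Longrightarrow> smooth_on S f \<Longrightarrow> smooth_on S g \<Longrightarrow> smooth_on S (\<lambda>x. f x * g x)"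
  by (rule smooth_onI, rule Ck_on_mult) (assumption | rule smooth_onD)+

lemma smooth_on_linear_comp:
  "bounded_linear L \<Longrightarrow> open S \<Longrightarrow> smooth_on S f \<Longrightarrow> smooth_on S (\<lambda>x. L (f x))"
  by (rule smooth_onI, rule Ck_on_linear_comp) (assumption | rule smooth_onD)+

lemma smooth_on_affine_comp:
  assumes "bounded_linear L" "open S" "open T" "\<And>x. x \<in> T \<Longrightarrow> c + L x \<in> S" "smooth_on S f"
  shows "smooth_on T (\<lambda>x. f (c + L x))"
  by (rule smooth_onI, rule Ck_on_affine_comp[OF assms(1-4) smooth_onD[OF assms(5)]])

lemma smooth_on_comp:
  fixes f :: "'e::real_inner \<Rightarrow> real"
  assumes "orthonormal_basis (E :: 'e set)" "open S" "open T" "\<And>x. x \<in> S \<Longrightarrow> G x \<in> T"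
    and "smooth_on S G" "smooth_on T f"
  shows "smooth_on S (\<lambda>x. f (G x))"
  by (rule smooth_onI, rule Ck_on_comp[OF assms(1-4) assms(5,6)[THEN smooth_onD]])

lemma smooth_on_deriv: "smooth_on S f \<Longrightarrow> smooth_on S (\<lambda>x. frechet_derivative f (at x) v)"
  by (rule smooth_onI, rule Ck_on_Suc_deriv, rule smooth_onD)

lemma smooth_on_has_derivative:
  "smooth_on S f \<Longrightarrow> x \<in> S \<Longrightarrow> (f has_derivative frechet_derivative f (at x)) (at x)"
  by (rule Ck_on_Suc_has_derivative[of 0, OF smooth_onD])

lemma smooth_on_continuous: "smooth_on S f \<Longrightarrow> continuous_on S f"
  using smooth_onD[of S f 0] by simp

section \<open>Symmetry of mixed partial derivatives\<close>

lemma mvt_direction: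
  fixes f :: "'a::real_normed_vector \<Rightarrow> real"
  assumes "h > 0" "\<And>t. 0 \<le> t \<Longrightarrow> t \<le> h \<Longrightarrow> f differentiable (at (x + t *\<^sub>R u))"
  shows "\<exists>t. 0 < t \<and> t < h \<and> f (x + h *\<^sub>R u) - f x = h * frechet_derivative f (at (x + t *\<^sub>R u)) u"
proof -
  have hd: "((\<lambda>t. f (x + t *\<^sub>R u)) has_derivative (\<lambda>s. s * frechet_derivative f (at (x + t *\<^sub>R u)) u)) (at t)"
    if "0 \<le> t" "t \<le> h" for t
  proof -
    have d: "(f has_derivative frechet_derivative f (at (x + t *\<^sub>R u))) (at (x + t *\<^sub>R u))"
      using assms(2)[OF that] frechet_derivative_works by blast
    have "((\<lambda>t. x + t *\<^sub>R u) has_derivative (\<lambda>s. s *\<^sub>R u)) (at t)"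
      by (auto intro!: derivative_eq_intros)
    from diff_chain_at[OF this d] show ?thesis
      using linear_cmul[OF has_derivative_linear[OF d]] by (simp add: o_def)
  qed
  have "continuous_on {0..h} (\<lambda>t. f (x + t *\<^sub>R u))"
    by (rule has_derivative_continuous_on[OF has_derivative_at_withinI[OF hd]]) auto
  then obtain t where "t \<in> {0<..<h}"
    "f (x + h *\<^sub>R u) - f (x + 0 *\<^sub>R u) = (h - 0) * frechet_derivative f (at (x + t *\<^sub>R u)) u"
    using mvt[OF assms(1), of "\<lambda>t. f (x + t *\<^sub>R u)"
        "\<lambda>t s. s * frechet_derivative f (at (x + t *\<^sub>R u)) u"] hd
    by (metis less_eq_real_def greaterThanLessThan_iff)
  then show ?thesis by (intro exI[of _ t]) simp
qed

text \<open>The second difference of \<open>f\<close> over a small parallelogram spanned by \<open>h u\<close> and \<open>h v\<close> is, by two applications of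
the mean value theorem, \<open>h\<^sup>2\<close> times the mixed derivative at some point of it. This holds for both
orders of differentiation, so the two continuous mixed derivatives have nearby equal values at all
scales, and agree at \<open>x\<close>.\<close>

lemma mixed_partials:
  fixes f :: "'a::real_normed_vector \<Rightarrow> real"
  assumes S: "open S" "x \<in> S" and f: "smooth_on S f"
  shows "frechet_derivative (\<lambda>y. frechet_derivative f (at y) u) (at x) v =
         frechet_derivative (\<lambda>y. frechet_derivative f (at y) v) (at x) u"
proof -
  define D where "D = (\<lambda>w y. frechet_derivative f (at y) w)"
  define DD where "DD = (\<lambda>w w' y. frechet_derivative (D w) (at y) w')"
  have sD: "smooth_on S (D w)" for w unfolding D_def by (rule smooth_on_deriv[OF f])
  have sDD: "smooth_on S (DD w w')" for w w' unfolding DD_def by (rule smooth_on_deriv[OF sD])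
  have diff: "F differentiable (at y)" if "y \<in> S" "smooth_on S F" for F :: "'a \<Rightarrow> real" and y
    using smooth_on_has_derivative[OF that(2,1)] by (rule differentiableI)
  obtain r where r: "r > 0" "ball x r \<subseteq> S" using S open_contains_ball by blast
  have key: "\<exists>s t. 0 < s \<and> s < h \<and> 0 < t \<and> t < h \<and>
      (f (x + h *\<^sub>R w + h *\<^sub>R w') - f (x + h *\<^sub>R w)) - (f (x + h *\<^sub>R w') - f x) =
      h * h * DD w w' (x + s *\<^sub>R w + t *\<^sub>R w')"
    if h: "h > 0" "h * (norm w + norm w') < r" for h w w'
  proof -
    have inS: "x + s *\<^sub>R w + t *\<^sub>R w' \<in> S" if "0 \<le> s" "s \<le> h" "0 \<le> t" "t \<le> h" for s t
    proof -
      have "norm (s *\<^sub>R w + t *\<^sub>R w') \<le> s * norm w + t * norm w'"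
        using norm_triangle_ineq[of "s *\<^sub>R w" "t *\<^sub>R w'"] that by simp
      also have "\<dots> \<le> h * norm w + h * norm w'"
        using that by (intro add_mono mult_right_mono) auto
      finally have "norm (s *\<^sub>R w + t *\<^sub>R w') < r" using h by (simp add: algebra_simps)
      moreover have "dist x (x + s *\<^sub>R w + t *\<^sub>R w') = norm (s *\<^sub>R w + t *\<^sub>R w')"
        unfolding dist_norm by (subst norm_minus_commute) (simp add: algebra_simps)
      ultimately show ?thesis using r(2) by (auto simp: mem_ball)
    qed
    let ?F = "\<lambda>y. f (y + h *\<^sub>R w') - f y"
    have hF: "(?F has_derivative (\<lambda>k. frechet_derivative f (at (y + h *\<^sub>R w')) k - frechet_derivative f (at y) k)) (at y)"
      if "y = x + s *\<^sub>R w" "0 \<le> s" "s \<le> h" for y s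
    proof -
      have 1: "y + h *\<^sub>R w' \<in> S" "y \<in> S" using inS[of s h] inS[of s 0] that h by auto
      have "((\<lambda>y. y + h *\<^sub>R w') has_derivative (\<lambda>k. k)) (at y)" by (auto intro!: derivative_eq_intros)
      from diff_chain_at[OF this smooth_on_has_derivative[OF f 1(1)]]
      have "((\<lambda>y. f (y + h *\<^sub>R w')) has_derivative frechet_derivative f (at (y + h *\<^sub>R w'))) (at y)"
        by (simp add: o_def)
      then show ?thesis by (rule has_derivative_diff[OF _ smooth_on_has_derivative[OF f 1(2)]])
    qed
    obtain s where s: "0 < s" "s < h" "?F (x + h *\<^sub>R w) - ?F x = h * frechet_derivative ?F (at (x + s *\<^sub>R w)) w"
      using mvt_direction[OF h(1), of ?F x w] differentiableI[OF hF] by blast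
    have e: "frechet_derivative ?F (at (x + s *\<^sub>R w)) w = D w (x + s *\<^sub>R w + h *\<^sub>R w') - D w (x + s *\<^sub>R w)"
      using frechet_derivative_at[OF hF[OF refl, of s]] s by (simp add: D_def fun_eq_iff)
    obtain t where t: "0 < t" "t < h" "D w (x + s *\<^sub>R w + h *\<^sub>R w') - D w (x + s *\<^sub>R w) = h * DD w w' (x + s *\<^sub>R w + t *\<^sub>R w')"
      using mvt_direction[OF h(1), of "D w" "x + s *\<^sub>R w" w'] diff[OF inS sD, of s] s unfolding DD_def by auto
    show ?thesis using s t e by (intro exI[of _ s] exI[of _ t]) simp
  qed
  have cont: "isCont (DD w w') x" for w w'
    using smooth_on_continuous[OF sDD] S continuous_on_eq_continuous_at by blast
  have "DD u v x = DD v u x"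
  proof (rule ccontr)
    assume ne: "DD u v x \<noteq> DD v u x"
    define \<epsilon> where "\<epsilon> = \<bar>DD u v x - DD v u x\<bar> / 2"
    have "\<epsilon> > 0" using ne by (simp add: \<epsilon>_def)
    obtain d1 where d1: "d1 > 0" "\<And>y. dist y x < d1 \<Longrightarrow> \<bar>DD u v y - DD u v x\<bar> < \<epsilon>"
      using cont[of u v] \<open>\<epsilon> > 0\<close> unfolding continuous_at_eps_delta dist_real_def by blast
    obtain d2 where d2: "d2 > 0" "\<And>y. dist y x < d2 \<Longrightarrow> \<bar>DD v u y - DD v u x\<bar> < \<epsilon>"
      using cont[of v u] \<open>\<epsilon> > 0\<close> unfolding continuous_at_eps_delta dist_real_def by blast
    define d where "d = min r (min d1 d2)"
    \<comment> \<open>a side length for which the whole parallelogram lies within \<open>d\<close> of \<open>x\<close>\<close>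
    define h where "h = d / (norm u + norm v + 1)"
    have "d > 0" using r d1 d2 by (simp add: d_def)
    have n: "norm u + norm v + 1 > 0" by (simp add: add_nonneg_pos)
    have h: "h > 0" using \<open>d > 0\<close> n by (simp add: h_def)
    have hn: "h * (norm u + norm v + 1) = d" using n by (simp add: h_def)
    then have hd: "h * (norm u + norm v) < d" using h by (simp add: algebra_simps)
    have near: "dist (x + s *\<^sub>R w + t *\<^sub>R w') x < d"
      if "0 < s" "s < h" "0 < t" "t < h" "norm w + norm w' = norm u + norm v" for s t w w'
    proof -
      have "dist (x + s *\<^sub>R w + t *\<^sub>R w') x = norm (s *\<^sub>R w + t *\<^sub>R w')"
        by (simp add: dist_norm algebra_simps)
      also have "\<dots> \<le> s * norm w + t * norm w'"
        using norm_triangle_ineq[of "s *\<^sub>R w" "t *\<^sub>R w'"] that by simp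
      also have "\<dots> \<le> h * norm w + h * norm w'"
        using that by (intro add_mono mult_right_mono) auto
      also have "\<dots> < d" using hd that(5) by (simp add: distrib_left[symmetric])
      finally show ?thesis .
    qed
    obtain s t where st: "0 < s" "s < h" "0 < t" "t < h"
      "(f (x + h *\<^sub>R u + h *\<^sub>R v) - f (x + h *\<^sub>R u)) - (f (x + h *\<^sub>R v) - f x) = h * h * DD u v (x + s *\<^sub>R u + t *\<^sub>R v)"
      using key[OF h, of u v] hd d_def by auto
    obtain s' t' where st': "0 < s'" "s' < h" "0 < t'" "t' < h"
      "(f (x + h *\<^sub>R v + h *\<^sub>R u) - f (x + h *\<^sub>R v)) - (f (x + h *\<^sub>R u) - f x) = h * h * DD v u (x + s' *\<^sub>R v + t' *\<^sub>R u)"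
      using key[OF h, of v u] hd d_def by (auto simp: add.commute)
    have eq: "x + h *\<^sub>R u + h *\<^sub>R v = x + h *\<^sub>R v + h *\<^sub>R u" by (simp add: algebra_simps)
    have "h * h * DD u v (x + s *\<^sub>R u + t *\<^sub>R v) = h * h * DD v u (x + s' *\<^sub>R v + t' *\<^sub>R u)"
      using st(5) st'(5) unfolding eq by linarith
    then have "DD u v (x + s *\<^sub>R u + t *\<^sub>R v) = DD v u (x + s' *\<^sub>R v + t' *\<^sub>R u)" using h by simp
    moreover have "\<bar>DD u v (x + s *\<^sub>R u + t *\<^sub>R v) - DD u v x\<bar> < \<epsilon>"
      using near[of s t u v] st d1(2) by (simp add: d_def)
    moreover have "\<bar>DD v u (x + s' *\<^sub>R v + t' *\<^sub>R u) - DD v u x\<bar> < \<epsilon>"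
      using near[of s' t' v u] st' d2(2) by (simp add: d_def)
    ultimately have "\<bar>DD u v x - DD v u x\<bar> < 2 * \<epsilon>" unfolding abs_less_iff by linarith
    then show False by (simp add: \<epsilon>_def)
  qed
  then show ?thesis by (simp add: DD_def D_def)
qed

section \<open>The lemma of Hadamard\<close>

lemma Ck_on_continuous: "Ck_on k f S \<Longrightarrow> continuous_on S f"
  by (induction k) (auto dest: Ck_on_Suc_imp simp del: Ck_on.simps(2))

lemma segment_in_ball:
  fixes p :: "'a::real_normed_vector"
  assumes "x \<in> ball p r" "t \<in> {0..1}"
  shows "p + t *\<^sub>R (x - p) \<in> ball p r"
proof -
  have "dist p (p + t *\<^sub>R (x - p)) = t * dist p x"
    using assms by (simp add: dist_norm norm_minus_commute)
  also have "\<dots> \<le> dist p x" using assms by (simp add: mult_left_le_one_le)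
  finally show ?thesis using assms by simp
qed

text \<open>Differentiating under the integral sign reproduces an integral of the same shape with one more
power of \<open>t\<close>; carrying the exponent \<open>j\<close> makes the induction on \<open>k\<close> go through.\<close>

lemma Ck_on_segment_integral:
  fixes f :: "'e::{real_inner,banach} \<Rightarrow> real"
  assumes E: "orthonormal_basis (E :: 'e set)" and f: "Ck_on k f (ball p r)"
  shows "Ck_on k (\<lambda>x. integral {0..1} (\<lambda>t. t ^ j * f (p + t *\<^sub>R (x - p)))) (ball p r)"
  using f
proof (induction k arbitrary: f j)
  case 0
  have in_ball: "p + t *\<^sub>R (x - p) \<in> ball p r" if "x \<in> ball p r" "t \<in> {0..1}" for x t
    using that by (rule segment_in_ball)
  have "continuous_on (ball p r \<times> {0..1}) (\<lambda>(x, t). t ^ j * f (p + t *\<^sub>R (x - p)))"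
    using 0 in_ball unfolding split_beta
    by (auto intro!: continuous_intros continuous_on_compose2[of "ball p r" f])
  then show ?case
    using integral_continuous_on_param[of "ball p r" 0 1 "\<lambda>x t. t ^ j * f (p + t *\<^sub>R (x - p))"]
    by simp
next
  case (Suc k)
  have in_ball: "p + t *\<^sub>R (x - p) \<in> ball p r" if "x \<in> ball p r" "t \<in> {0..1}" for x t
    using that by (rule segment_in_ball)
  have cont: "continuous_on (ball p r \<times> {0..1}) (\<lambda>z. h (p + snd z *\<^sub>R (fst z - p)))"
    if "continuous_on (ball p r) h" for h :: "'e \<Rightarrow> real"
    by (rule continuous_on_compose2[OF that]) (auto intro!: continuous_intros segment_in_ball simp del: mem_ball)
  have cont1: "continuous_on {0..1} (\<lambda>t. h (p + t *\<^sub>R (x - p)))"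
    if "continuous_on (ball p r) h" "x \<in> ball p r" for h :: "'e \<Rightarrow> real" and x
    by (rule continuous_on_compose2[OF that(1)]) (use that in \<open>auto intro!: continuous_intros segment_in_ball simp del: mem_ball\<close>)
  have cf: "continuous_on (ball p r) f"
    by (rule Ck_on_continuous[OF Suc.prems])
  have cD: "continuous_on (ball p r) (\<lambda>x. frechet_derivative f (at x) v)" for v
    by (rule Ck_on_continuous[OF Ck_on_Suc_deriv[OF Suc.prems]])
  \<comment> \<open>the derivative of the integrand as a bounded linear map, with continuity in \<open>x\<close> and \<open>t\<close> evident from the sum\<close>
  define B where "B = (\<lambda>x t. \<Sum>b\<in>E. (t ^ Suc j * frechet_derivative f (at (p + t *\<^sub>R (x - p))) b) *\<^sub>R blinfun_inner_left b)"
  have B: "blinfun_apply (B x t) v = t ^ Suc j * frechet_derivative f (at (p + t *\<^sub>R (x - p))) v"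
    if "x \<in> ball p r" "t \<in> {0..1}" for x t v
  proof -
    note d = Ck_on_Suc_has_derivative[OF Suc.prems in_ball[OF that]]
    have "frechet_derivative f (at (p + t *\<^sub>R (x - p))) v =
        (\<Sum>b\<in>E. (v \<bullet> b) * frechet_derivative f (at (p + t *\<^sub>R (x - p))) b)"
      by (rule linear_orthonormal_expand[OF E has_derivative_linear[OF d], unfolded real_scaleR_def])
    moreover have "blinfun_apply (B x t) v =
        t ^ Suc j * (\<Sum>b\<in>E. (v \<bullet> b) * frechet_derivative f (at (p + t *\<^sub>R (x - p))) b)"
      by (simp add: B_def blinfun.sum_left blinfun.scaleR_left sum_distrib_left mult_ac)
    ultimately show ?thesis by simp
  qed
  show ?case
  proof (rule Ck_on_SucI[OF open_ball])
    fix x assume x: "x \<in> ball p r"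
    have "((\<lambda>x. integral (cbox 0 1) (\<lambda>t. t ^ j * f (p + t *\<^sub>R (x - p)))) has_derivative
        blinfun_apply (integral (cbox 0 1) (B x))) (at x within ball p r)"
    proof (rule leibniz_rule[OF _ _ _ x convex_ball])
      fix y and t :: real assume y: "y \<in> ball p r" and t: "t \<in> cbox 0 1"
      then have t': "t \<in> {0..1}" by simp
      note d = Ck_on_Suc_has_derivative[OF Suc.prems in_ball[OF y t']]
      have "((\<lambda>y. p + t *\<^sub>R (y - p)) has_derivative (\<lambda>v. t *\<^sub>R v)) (at y)"
        by (auto intro!: derivative_eq_intros)
      from diff_chain_at[OF this d]
      have "((\<lambda>y. f (p + t *\<^sub>R (y - p))) has_derivative
          (\<lambda>v. t * frechet_derivative f (at (p + t *\<^sub>R (y - p))) v)) (at y)"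
        using linear_cmul[OF has_derivative_linear[OF d]] by (simp add: o_def)
      from has_derivative_mult_right[OF this, of "t ^ j"]
      have "((\<lambda>y. t ^ j * f (p + t *\<^sub>R (y - p))) has_derivative blinfun_apply (B y t)) (at y)"
        by (rule has_derivative_eq_rhs) (use B[OF y t'] in \<open>simp add: fun_eq_iff\<close>)
      then show "((\<lambda>y. t ^ j * f (p + t *\<^sub>R (y - p))) has_derivative blinfun_apply (B y t)) (at y within ball p r)"
        by (rule has_derivative_at_withinI)
    next
      fix y assume "y \<in> ball p r"
      then show "(\<lambda>t. t ^ j * f (p + t *\<^sub>R (y - p))) integrable_on cbox 0 1"
        using cont1[OF cf] unfolding cbox_interval
        by (intro integrable_continuous_real continuous_on_mult continuous_on_power continuous_on_id) auto
    next
      show "continuous_on (ball p r \<times> cbox 0 1) (\<lambda>(x, t). B x t)"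
        unfolding B_def split_beta cbox_interval by (intro continuous_intros cont[OF cD])
    qed
    then show "((\<lambda>x. integral {0..1} (\<lambda>t. t ^ j * f (p + t *\<^sub>R (x - p)))) has_derivative
        blinfun_apply (integral (cbox 0 1) (B x))) (at x)"
      using x at_within_open[OF x open_ball] by simp
  next
    fix v
    have e: "blinfun_apply (integral (cbox 0 1) (B x)) v =
        integral {0..1} (\<lambda>t. t ^ Suc j * frechet_derivative f (at (p + t *\<^sub>R (x - p))) v)"
      if x: "x \<in> ball p r" for x
    proof -
      have "B x integrable_on cbox 0 1"
        unfolding B_def cbox_interval
        by (intro integrable_continuous_real continuous_intros cont1[OF cD x])
      then have "blinfun_apply (integral (cbox 0 1) (B x)) v = integral (cbox 0 1) (\<lambda>t. blinfun_apply (B x t) v)"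
        by (rule blinfun_apply_integral)
      also have "\<dots> = integral {0..1} (\<lambda>t. t ^ Suc j * frechet_derivative f (at (p + t *\<^sub>R (x - p))) v)"
        unfolding cbox_interval by (rule integral_cong) (rule B[OF x])
      finally show ?thesis .
    qed
    show "Ck_on k (\<lambda>x. blinfun_apply (integral (cbox 0 1) (B x)) v) (ball p r)"
      by (rule Ck_on_cong[OF open_ball e, THEN iffD2], assumption)
        (rule Suc.IH[OF Ck_on_Suc_deriv[OF Suc.prems]])
  qed
qed

text \<open>The coefficient \<open>G b\<close> is the mean of the partial derivative along the segment from \<open>p\<close> to \<open>x\<close>, by
the fundamental theorem of calculus.\<close>

lemma hadamard_ball:
  fixes f :: "'e::{real_inner,banach} \<Rightarrow> real"
  assumes E: "orthonormal_basis (E :: 'e set)" and f: "smooth_on (ball p r) f"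
  shows "\<exists>G. (\<forall>b. smooth_on (ball p r) (G b)) \<and>
    (\<forall>b. G b p = frechet_derivative f (at p) b) \<and>
    (\<forall>x\<in>ball p r. f x = f p + (\<Sum>b\<in>E. ((x - p) \<bullet> b) * G b x))"
proof -
  define G where "G = (\<lambda>b x. integral {0..1} (\<lambda>t. t ^ 0 * frechet_derivative f (at (p + t *\<^sub>R (x - p))) b))"
  have "smooth_on (ball p r) (G b)" for b
    unfolding G_def
    by (rule smooth_onI, rule Ck_on_segment_integral[OF E], rule smooth_onD[OF smooth_on_deriv[OF f]])
  moreover have "G b p = frechet_derivative f (at p) b" for b by (simp add: G_def)
  moreover have "f x = f p + (\<Sum>b\<in>E. ((x - p) \<bullet> b) * G b x)" if x: "x \<in> ball p r" for x
  proof -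
    have in_ball: "p + t *\<^sub>R (x - p) \<in> ball p r" if "t \<in> {0..1}" for t
      using x that by (rule segment_in_ball)
    let ?g = "\<lambda>t. f (p + t *\<^sub>R (x - p))"
    let ?D = "\<lambda>b t. frechet_derivative f (at (p + t *\<^sub>R (x - p))) b"
    have cD: "continuous_on {0..1} (?D b)" for b
      by (rule continuous_on_compose2[OF smooth_on_continuous[OF smooth_on_deriv[OF f]]])
        (use x in \<open>auto intro!: continuous_intros segment_in_ball simp del: mem_ball\<close>)
    have "(?g has_vector_derivative (\<Sum>b\<in>E. ((x - p) \<bullet> b) * ?D b t)) (at t within {0..1})"
      if t: "t \<in> {0..1}" for t
    proof -
      note d = smooth_on_has_derivative[OF f in_ball[OF t]]
      have e: "frechet_derivative f (at (p + t *\<^sub>R (x - p))) (x - p) = (\<Sum>b\<in>E. ((x - p) \<bullet> b) * ?D b t)"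
        by (rule linear_orthonormal_expand[OF E has_derivative_linear[OF d], unfolded real_scaleR_def])
      have "((\<lambda>t. p + t *\<^sub>R (x - p)) has_derivative (\<lambda>s. s *\<^sub>R (x - p))) (at t)"
        by (auto intro!: derivative_eq_intros)
      from diff_chain_at[OF this d]
      have "(?g has_derivative (\<lambda>s. s * frechet_derivative f (at (p + t *\<^sub>R (x - p))) (x - p))) (at t)"
        using linear_cmul[OF has_derivative_linear[OF d]] by (simp add: o_def)
      then show ?thesis
        unfolding e has_vector_derivative_def real_scaleR_def by (rule has_derivative_at_withinI)
    qed
    then have "((\<lambda>t. \<Sum>b\<in>E. ((x - p) \<bullet> b) * ?D b t) has_integral (?g 1 - ?g 0)) {0..1}"
      by (intro fundamental_theorem_of_calculus) auto
    then have "?g 1 - ?g 0 = integral {0..1} (\<lambda>t. \<Sum>b\<in>E. ((x - p) \<bullet> b) * ?D b t)"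
      by (simp add: integral_unique)
    also have "\<dots> = (\<Sum>b\<in>E. integral {0..1} (\<lambda>t. ((x - p) \<bullet> b) * ?D b t))"
      using E cD unfolding orthonormal_basis_def
      by (intro integral_sum) (auto intro!: integrable_continuous_real continuous_intros)
    also have "\<dots> = (\<Sum>b\<in>E. ((x - p) \<bullet> b) * G b x)"
      by (simp add: G_def)
    finally show ?thesis by simp
  qed
  ultimately show ?thesis by blast
qed

section \<open>Frames, traces and alternating forms\<close>

definition linear_functional_on :: "('x \<Rightarrow> real) set \<Rightarrow> (('x \<Rightarrow> real) \<Rightarrow> real) \<Rightarrow> bool" where
  "linear_functional_on V c \<longleftrightarrow>
    (\<forall>v\<in>V. \<forall>w\<in>V. \<forall>a b. c (fscale a v + fscale b w) = a * c v + b * c w)"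

definition linear_endo_on :: "('x \<Rightarrow> real) set \<Rightarrow> (('x \<Rightarrow> real) \<Rightarrow> ('x \<Rightarrow> real)) \<Rightarrow> bool" where
  "linear_endo_on V L \<longleftrightarrow> L ` V \<subseteq> V \<and>
    (\<forall>v\<in>V. \<forall>w\<in>V. \<forall>a b. L (fscale a v + fscale b w) = fscale a (L v) + fscale b (L w))"

text \<open>A resolution of the identity, from which traces are read off as \<open>tr L = \<Sum>\<^sub>i c\<^sub>i(L u\<^sub>i)\<close>, whether or not
the \<open>u\<^sub>i\<close> are independent.\<close>

definition frame_on :: "('x \<Rightarrow> real) set \<Rightarrow> 'i set \<Rightarrow> ('i \<Rightarrow> 'x \<Rightarrow> real) \<Rightarrow> ('i \<Rightarrow> ('x \<Rightarrow> real) \<Rightarrow> real) \<Rightarrow> bool" where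
  "frame_on V I u c \<longleftrightarrow> finite I \<and> u ` I \<subseteq> V \<and> (\<forall>i\<in>I. linear_functional_on V (c i)) \<and>
    (\<forall>v\<in>V. v = (\<Sum>i\<in>I. fscale (c i v) (u i)))"

lemma frame_onD:
  assumes "frame_on V I u c"
  shows "finite I" "\<And>i. i \<in> I \<Longrightarrow> u i \<in> V" "\<And>i. i \<in> I \<Longrightarrow> linear_functional_on V (c i)"
    "\<And>v. v \<in> V \<Longrightarrow> (\<Sum>i\<in>I. fscale (c i v) (u i)) = v"
  using assms unfolding frame_on_def by auto

lemma fscale_simps[simp]: "fscale 0 v = 0" "fscale 1 v = v" "fscale c v x = c * v x"
  by (auto simp: fscale_def fun_eq_iff)

lemma sum_fun_apply: "(\<Sum>i\<in>I. f i) x = (\<Sum>i\<in>I. f i x)" for f :: "'i \<Rightarrow> 'x \<Rightarrow> real"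
  by (induction I rule: infinite_finite_induct) auto

lemma linear_functional_on_sum:
  assumes V: "fun_vs.subspace V" and c: "linear_functional_on V c" and w: "\<And>j. j \<in> J \<Longrightarrow> w j \<in> V"
  shows "c (\<Sum>j\<in>J. fscale (k j) (w j)) = (\<Sum>j\<in>J. k j * c (w j))"
proof -
  have z: "0 \<in> V" using V fun_vs.subspace_0 by auto
  have c2: "c (fscale a v + fscale b w) = a * c v + b * c w" if "v \<in> V" "w \<in> V" for a b v w
    using c that unfolding linear_functional_on_def by blast
  have c0: "c 0 = 0" using c2[OF z z, of 0 0] by simp
  show ?thesis using w
  proof (induction J rule: infinite_finite_induct)
    case (insert j J)
    have "(\<Sum>j\<in>J. fscale (k j) (w j)) \<in> V"
      using insert.prems V by (intro fun_vs.subspace_sum fun_vs.subspace_scale) auto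
    then have "c (fscale (k j) (w j) + fscale 1 (\<Sum>j\<in>J. fscale (k j) (w j))) =
        k j * c (w j) + 1 * c (\<Sum>j\<in>J. fscale (k j) (w j))"
      using insert.prems by (intro c2) auto
    moreover have "c (\<Sum>j\<in>J. fscale (k j) (w j)) = (\<Sum>j\<in>J. k j * c (w j))"
      using insert.IH insert.prems by blast
    ultimately show ?case by (simp only: sum.insert[OF insert.hyps(1,2)] fscale_simps(2) mult_1)
  qed (auto simp: c0)
qed

lemma linear_endo_on_sum:
  assumes V: "fun_vs.subspace V" and L: "linear_endo_on V L" and w: "\<And>j. j \<in> J \<Longrightarrow> w j \<in> V"
  shows "L (\<Sum>j\<in>J. fscale (k j) (w j)) = (\<Sum>j\<in>J. fscale (k j) (L (w j)))"
proof (rule ext)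
  fix x
  have "linear_functional_on V (\<lambda>v. L v x)"
    using L unfolding linear_functional_on_def linear_endo_on_def by simp
  from linear_functional_on_sum[OF V this w]
  show "L (\<Sum>j\<in>J. fscale (k j) (w j)) x = (\<Sum>j\<in>J. fscale (k j) (L (w j))) x"
    by (simp add: sum_fun_apply)
qed

lemma frame_on_span:
  assumes V: "fun_vs.subspace V" and F: "frame_on V I u c"
  shows "V = fun_vs.span (u ` I)"
proof
  show "fun_vs.span (u ` I) \<subseteq> V"
    using frame_onD(2)[OF F] V by (intro fun_vs.span_minimal) auto
  show "V \<subseteq> fun_vs.span (u ` I)"
  proof
    fix v assume "v \<in> V"
    have "(\<Sum>i\<in>I. fscale (c i v) (u i)) \<in> fun_vs.span (u ` I)"
      by (intro fun_vs.span_sum fun_vs.span_scale fun_vs.span_base) auto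
    then show "v \<in> fun_vs.span (u ` I)" using frame_onD(4)[OF F \<open>v \<in> V\<close>] by simp
  qed
qed

lemma basis_frame:
  assumes B: "fun_vs.independent B" "fun_vs.span B = V" "finite B"
  shows "frame_on V B (\<lambda>b. b) (\<lambda>b v. fun_vs.representation B v b)"
  unfolding frame_on_def linear_functional_on_def
  using B fun_vs.sum_representation_eq[OF B(1) _ B(3) order_refl]
  by (auto intro: fun_vs.span_base simp: fun_vs.representation_add fun_vs.representation_scale
      fun_vs.span_scale)

text \<open>Expand \<open>u\<^sub>i\<close> in the second frame, exchange the sums, and recognize the expansion of
\<open>L u'\<^sub>j\<close> in the first: this is \<open>tr(S T) = tr(T S)\<close>.\<close>

lemma frame_trace_unique:
  assumes V: "fun_vs.subspace V" and F: "frame_on V I u c" and F': "frame_on V J u' c'"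
    and L: "linear_endo_on V L"
  shows "(\<Sum>i\<in>I. c i (L (u i))) = (\<Sum>j\<in>J. c' j (L (u' j)))"
proof -
  note f = frame_onD[OF F] and f' = frame_onD[OF F']
  have LV: "L v \<in> V" if "v \<in> V" for v using L that by (auto simp: linear_endo_on_def)
  have "c i (L (u i)) = (\<Sum>j\<in>J. c' j (u i) * c i (L (u' j)))" if i: "i \<in> I" for i
  proof -
    have "L (u i) = L (\<Sum>j\<in>J. fscale (c' j (u i)) (u' j))" using f'(4)[OF f(2)[OF i]] by simp
    also have "\<dots> = (\<Sum>j\<in>J. fscale (c' j (u i)) (L (u' j)))"
      by (rule linear_endo_on_sum[OF V L f'(2)])
    finally show ?thesis
      using linear_functional_on_sum[OF V f(3)[OF i], of J "\<lambda>j. L (u' j)" "\<lambda>j. c' j (u i)"] LV f'(2)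
      by simp
  qed
  then have "(\<Sum>i\<in>I. c i (L (u i))) = (\<Sum>i\<in>I. \<Sum>j\<in>J. c i (L (u' j)) * c' j (u i))"
    by (simp add: mult.commute)
  also have "\<dots> = (\<Sum>j\<in>J. \<Sum>i\<in>I. c i (L (u' j)) * c' j (u i))" by (rule sum.swap)
  also have "\<dots> = (\<Sum>j\<in>J. c' j (L (u' j)))"
  proof (rule sum.cong[OF refl])
    fix j assume j: "j \<in> J"
    have "c' j (L (u' j)) = c' j (\<Sum>i\<in>I. fscale (c i (L (u' j))) (u i))"
      using f(4)[OF LV[OF f'(2)[OF j]]] by simp
    also have "\<dots> = (\<Sum>i\<in>I. c i (L (u' j)) * c' j (u i))"
      by (rule linear_functional_on_sum[OF V f'(3)[OF j] f(2)])
    finally show "(\<Sum>i\<in>I. c i (L (u' j)) * c' j (u i)) = c' j (L (u' j))" by simp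
  qed
  finally show ?thesis .
qed

lemma trace_on_frame:
  assumes V: "fun_vs.subspace V" and F: "frame_on V I u c" and L: "linear_endo_on V L"
  shows "trace_on V L = (\<Sum>i\<in>I. c i (L (u i)))"
proof -
  define B where "B = (SOME B. fun_vs.independent B \<and> fun_vs.span B = V)"
  obtain B0 where "B0 \<subseteq> V" "fun_vs.independent B0" "V \<subseteq> fun_vs.span B0"
    by (rule fun_vs.maximal_independent_subset)
  then have "fun_vs.independent B0 \<and> fun_vs.span B0 = V"
    using fun_vs.span_subspace[OF _ _ V] by blast
  then have B: "fun_vs.independent B \<and> fun_vs.span B = V"
    unfolding B_def by (rule someI)
  have "B \<subseteq> fun_vs.span (u ` I)"
    using B frame_on_span[OF V F] fun_vs.span_superset by blast
  then have "finite B"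
    using fun_vs.independent_span_bound[of "u ` I" B] B frame_onD(1)[OF F] by blast
  then have "frame_on V B (\<lambda>b. b) (\<lambda>b v. fun_vs.representation B v b)"
    using B basis_frame by blast
  from frame_trace_unique[OF V this F L]
  show ?thesis by (simp add: trace_on_def B_def Let_def)
qed

lemma alternating_form_linear:
  assumes \<omega>: "alternating_form V n \<omega>" and vs: "length vs = n" "set vs \<subseteq> V" "i < n"
  shows "linear_functional_on V (\<lambda>v. \<omega> (vs[i := v]))"
  using assms unfolding alternating_form_def linear_functional_on_def by blast

text \<open>The infinitesimal form of \<open>\<omega>(L v\<^sub>1, \<dots>, L v\<^sub>n) = det L \<omega>(v\<^sub>1, \<dots>, v\<^sub>n)\<close>. A list on which a form of
top degree does not vanish is a basis, and in \<open>\<omega>(v\<^sub>1, \<dots>, L v\<^sub>i, \<dots>, v\<^sub>n)\<close> only the \<open>v\<^sub>i\<close>-component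
of \<open>L v\<^sub>i\<close> survives.\<close>

lemma alternating_form_trace:
  assumes V: "fun_vs.subspace V" and F: "frame_on V I u c" and card: "card I = n"
    and \<omega>: "alternating_form V n \<omega>" and vs: "length vs = n" "set vs \<subseteq> V" "\<omega> vs \<noteq> 0"
    and L: "linear_endo_on V L"
  shows "(\<Sum>i<n. \<omega> (vs[i := L (vs ! i)])) = trace_on V L * \<omega> vs"
proof -
  have alt: "\<omega> ws = 0" if "length ws = n" "set ws \<subseteq> V" "i < n" "j < n" "i \<noteq> j" "ws ! i = ws ! j" for ws i j
    using \<omega> that unfolding alternating_form_def by (metis nat_neq_iff)
  have rep: "\<omega> (vs[i := vs ! j]) = (if i = j then \<omega> vs else 0)" if "i < n" "j < n" for i j
  proof (cases "i = j")
    case False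
    have "set (vs[i := vs ! j]) \<subseteq> V"
      using set_update_subset_insert[of vs i "vs ! j"] nth_mem[of j vs] vs(1,2) that by blast
    then show ?thesis using alt[of "vs[i := vs ! j]" i j] that False vs by simp
  qed simp
  have dist: "distinct vs"
    using alt[OF vs(1,2)] vs(1,3) unfolding distinct_conv_nth by blast
  have expand: "\<omega> (vs[i := (\<Sum>w\<in>W. fscale (r w) w)]) = (\<Sum>w\<in>W. r w * \<omega> (vs[i := w]))"
    if "W \<subseteq> V" "i < n" for W r i
    by (rule linear_functional_on_sum[OF V alternating_form_linear[OF \<omega> vs(1,2) that(2)]]) (use that in auto)
  have ind: "fun_vs.independent (set vs)"
  proof
    assume "fun_vs.dependent (set vs)"
    then obtain v where v: "v \<in> set vs" "v \<in> fun_vs.span (set vs - {v})"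
      unfolding fun_vs.dependent_def by blast
    from v(2) obtain r where r: "v = (\<Sum>w\<in>set vs - {v}. fscale (r w) w)"
      using fun_vs.span_finite[of "set vs - {v}"] by force
    obtain i where i: "i < n" "vs ! i = v" using v vs(1) by (metis in_set_conv_nth)
    have "\<omega> vs = \<omega> (vs[i := v])" using i by auto
    also have "\<dots> = (\<Sum>w\<in>set vs - {v}. r w * \<omega> (vs[i := w]))"
      using expand[of "set vs - {v}" i r] vs(2) i(1) r by auto
    also have "\<dots> = 0"
    proof (intro sum.neutral ballI)
      fix w assume w: "w \<in> set vs - {v}"
      then obtain j where "j < n" "vs ! j = w" using vs(1) by (metis DiffD1 in_set_conv_nth)
      then show "r w * \<omega> (vs[i := w]) = 0" using rep[of i j] i w by auto
    qed
    finally show False using vs(3) by simp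
  qed
  have span: "fun_vs.span (set vs) = V"
  proof (rule antisym)
    show "fun_vs.span (set vs) \<subseteq> V" by (rule fun_vs.span_minimal[OF vs(2) V])
    show "V \<subseteq> fun_vs.span (set vs)"
    proof (rule ccontr)
      assume "\<not> V \<subseteq> fun_vs.span (set vs)"
      then obtain v where v: "v \<in> V" "v \<notin> fun_vs.span (set vs)" by blast
      then have "fun_vs.independent (insert v (set vs))" using ind by (rule_tac fun_vs.independent_insertI)
      moreover have "insert v (set vs) \<subseteq> fun_vs.span (u ` I)"
        using v vs(2) frame_on_span[OF V F] by blast
      ultimately have "card (insert v (set vs)) \<le> card (u ` I)"
        using fun_vs.independent_span_bound[of "u ` I"] frame_onD(1)[OF F] by blast
      also have "\<dots> \<le> n" using card_image_le[OF frame_onD(1)[OF F], of u] card by simp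
      moreover have "v \<notin> set vs" using v(2) fun_vs.span_base by blast
      ultimately show False using distinct_card[OF dist] vs(1) by simp
    qed
  qed
  let ?r = "fun_vs.representation (set vs)"
  have LV: "L v \<in> V" if "v \<in> V" for v using L that by (auto simp: linear_endo_on_def)
  have "\<omega> (vs[i := L (vs ! i)]) = ?r (L (vs ! i)) (vs ! i) * \<omega> vs" if i: "i < n" for i
  proof -
    have "L (vs ! i) \<in> V" using LV vs i by (meson nth_mem subsetD)
    then have "L (vs ! i) = (\<Sum>w\<in>set vs. fscale (?r (L (vs ! i)) w) w)"
      using fun_vs.sum_representation_eq[OF ind _ _ order_refl, of "L (vs ! i)"] span by simp
    then have "\<omega> (vs[i := L (vs ! i)]) = (\<Sum>w\<in>set vs. ?r (L (vs ! i)) w * \<omega> (vs[i := w]))"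
      using expand[OF vs(2) i, of "?r (L (vs ! i))"] by simp
    also have "\<dots> = (\<Sum>w\<in>set vs. if w = vs ! i then ?r (L (vs ! i)) (vs ! i) * \<omega> vs else 0)"
    proof (rule sum.cong[OF refl])
      fix w assume "w \<in> set vs"
      then obtain j where j: "j < n" "vs ! j = w" using vs(1) by (metis in_set_conv_nth)
      have "w = vs ! i \<longleftrightarrow> i = j" using j i dist vs(1) by (auto simp: nth_eq_iff_index_eq)
      then show "?r (L (vs ! i)) w * \<omega> (vs[i := w]) = (if w = vs ! i then ?r (L (vs ! i)) (vs ! i) * \<omega> vs else 0)"
        using rep[OF i j(1)] j by auto
    qed
    also have "\<dots> = ?r (L (vs ! i)) (vs ! i) * \<omega> vs" using i vs(1) by simp
    finally show ?thesis .
  qed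
  then have "(\<Sum>i<n. \<omega> (vs[i := L (vs ! i)])) = (\<Sum>i<n. ?r (L (vs ! i)) (vs ! i)) * \<omega> vs"
    by (simp add: sum_distrib_right)
  also have "(\<Sum>i<n. ?r (L (vs ! i)) (vs ! i)) = (\<Sum>w\<in>set vs. ?r (L w) w)"
    by (rule sum.reindex_bij_betw) (use bij_betw_nth[OF dist] vs(1) in auto)
  also have "\<dots> = trace_on V L"
    using trace_on_frame[OF V basis_frame[OF ind span] L] by simp
  finally show ?thesis .
qed

section \<open>Smooth functions on manifolds\<close>

lemma is_chartD:
  assumes "is_chart (U, \<phi>)"
  shows "open U" "open (\<phi> ` U)" "continuous_on (\<phi> ` U) (inv_into U \<phi>)" "continuous_on U \<phi>"
    "\<And>x. x \<in> U \<Longrightarrow> inv_into U \<phi> (\<phi> x) = x" "inj_on \<phi> U"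
proof -
  have h: "open U" "open (\<phi> ` U)" "homeomorphism U (\<phi> ` U) \<phi> (inv_into U \<phi>)"
    using assms by (auto simp: is_chart_def)
  then show "open U" "open (\<phi> ` U)" "continuous_on (\<phi> ` U) (inv_into U \<phi>)" "continuous_on U \<phi>"
    and inv: "\<And>x. x \<in> U \<Longrightarrow> inv_into U \<phi> (\<phi> x) = x"
    by (auto simp: homeomorphism_def)
  show "inj_on \<phi> U" by (rule inj_on_inverseI[of U "inv_into U \<phi>"], rule inv)
qed

lemma chart_image_open:
  assumes "is_chart (U, \<phi>)" "open W"
  shows "open (\<phi> ` (U \<inter> W))"
proof -
  note c = is_chartD[OF assms(1)]
  have "\<phi> ` (U \<inter> W) = \<phi> ` U \<inter> inv_into U \<phi> -` W" using c(5) by force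
  then show ?thesis using continuous_open_preimage[OF c(3,2) assms(2)] by simp
qed

lemma inv_into_map_prod:
  assumes "inj_on \<phi> U" "inj_on \<psi> V" "x \<in> U" "y \<in> V"
  shows "inv_into (U \<times> V) (map_prod \<phi> \<psi>) (\<phi> x, \<psi> y) = (x, y)"
  using inv_into_f_f[OF map_prod_inj_on[OF assms(1,2)], of "(x, y)"] assms by simp

lemma is_chart_prod:
  assumes "is_chart (U, \<phi>)" "is_chart (V, \<psi>)"
  shows "is_chart (U \<times> V, map_prod \<phi> \<psi>)"
proof -
  note c = is_chartD[OF assms(1)] and d = is_chartD[OF assms(2)]
  have im: "map_prod \<phi> \<psi> ` (U \<times> V) = \<phi> ` U \<times> \<psi> ` V" by (rule map_prod_surj_on[OF refl refl])
  have inv: "inv_into (U \<times> V) (map_prod \<phi> \<psi>) z = (inv_into U \<phi> (fst z), inv_into V \<psi> (snd z))"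
    if "z \<in> \<phi> ` U \<times> \<psi> ` V" for z
  proof -
    obtain x y where "x \<in> U" "y \<in> V" "z = (\<phi> x, \<psi> y)" using \<open>z \<in> _\<close> by blast
    then show ?thesis using inv_into_map_prod[OF c(6) d(6)] c(5) d(5) by simp
  qed
  have "continuous_on (\<phi> ` U \<times> \<psi> ` V) (\<lambda>z. (inv_into U \<phi> (fst z), inv_into V \<psi> (snd z)))"
    by (intro continuous_on_Pair continuous_on_compose2[OF c(3)] continuous_on_compose2[OF d(3)]
        continuous_intros) auto
  then have ci: "continuous_on (\<phi> ` U \<times> \<psi> ` V) (inv_into (U \<times> V) (map_prod \<phi> \<psi>))"
    by (rule continuous_on_eq) (rule inv[symmetric])
  have "continuous_on (U \<times> V) (\<lambda>z. (\<phi> (fst z), \<psi> (snd z)))"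
    by (intro continuous_on_Pair continuous_on_compose2[OF c(4)] continuous_on_compose2[OF d(4)]
        continuous_intros) auto
  then have cf: "continuous_on (U \<times> V) (map_prod \<phi> \<psi>)"
    by (simp add: map_prod_def case_prod_unfold)
  have hom: "homeomorphism (U \<times> V) (\<phi> ` U \<times> \<psi> ` V) (map_prod \<phi> \<psi>) (inv_into (U \<times> V) (map_prod \<phi> \<psi>))"
  proof (rule homeomorphismI[OF cf ci])
    show "inv_into (U \<times> V) (map_prod \<phi> \<psi>) (map_prod \<phi> \<psi> z) = z" if "z \<in> U \<times> V" for z
      using that inv_into_map_prod[OF c(6) d(6)] by (cases z) simp
    then show "inv_into (U \<times> V) (map_prod \<phi> \<psi>) ` (\<phi> ` U \<times> \<psi> ` V) \<subseteq> U \<times> V"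
      unfolding im[symmetric] by (simp add: image_image)
    show "map_prod \<phi> \<psi> (inv_into (U \<times> V) (map_prod \<phi> \<psi>) z) = z" if "z \<in> \<phi> ` U \<times> \<psi> ` V" for z
      using that unfolding im[symmetric] by (rule f_inv_into_f)
  qed (simp add: im)
  show ?thesis
    unfolding is_chart_def prod.case im
    by (intro conjI open_Times c(1,2) d(1,2) hom)
qed

lemma prod_atlas_charts: "\<forall>c\<in>A. is_chart c \<Longrightarrow> \<forall>c\<in>B. is_chart c \<Longrightarrow> c \<in> prod_atlas A B \<Longrightarrow> is_chart c"
  unfolding prod_atlas_def using is_chart_prod by blast

lemma smooth_funI:
  "(\<And>U \<phi>. (U, \<phi>) \<in> A \<Longrightarrow> smooth_on (\<phi> ` (U \<inter> W)) (f \<circ> inv_into U \<phi>)) \<Longrightarrow> smooth_fun A W f"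
  unfolding smooth_fun_def by (rule ballI) (simp add: split_beta)

lemma smooth_funD: "smooth_fun A W f \<Longrightarrow> (U, \<phi>) \<in> A \<Longrightarrow> smooth_on (\<phi> ` (U \<inter> W)) (f \<circ> inv_into U \<phi>)"
  unfolding smooth_fun_def by (drule (1) bspec) simp

lemma smooth_fun_subset: "smooth_fun A W f \<Longrightarrow> W' \<subseteq> W \<Longrightarrow> smooth_fun A W' f"
  by (rule smooth_funI, rule smooth_on_subset, erule (1) smooth_funD) blast

lemma smooth_fun_cong_imp:
  assumes A: "\<forall>c\<in>A. is_chart c" and W: "open W" and eq: "\<And>x. x \<in> W \<Longrightarrow> f x = h x" and f: "smooth_fun A W f"
  shows "smooth_fun A W h"
proof (rule smooth_funI)
  fix U \<phi> assume c: "(U, \<phi>) \<in> A"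
  then have "is_chart (U, \<phi>)" using A by blast
  note d = is_chartD[OF this] and op = chart_image_open[OF this W]
  have "(f \<circ> inv_into U \<phi>) y = (h \<circ> inv_into U \<phi>) y" if "y \<in> \<phi> ` (U \<inter> W)" for y
    using that d(5) eq by auto
  from smooth_on_cong[OF op, of "f \<circ> inv_into U \<phi>" "h \<circ> inv_into U \<phi>", OF this] smooth_funD[OF f c]
  show "smooth_on (\<phi> ` (U \<inter> W)) (h \<circ> inv_into U \<phi>)" by simp
qed

lemma smooth_fun_const: "smooth_fun A W (\<lambda>x. c)"
  by (rule smooth_funI) (simp add: o_def smooth_on_const)

lemma smooth_fun_add:
  assumes A: "\<forall>c\<in>A. is_chart c" and W: "open W" and f: "smooth_fun A W f" "smooth_fun A W h"
  shows "smooth_fun A W (\<lambda>x. f x + h x)"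
proof (rule smooth_funI)
  fix U \<phi> assume c: "(U, \<phi>) \<in> A"
  then have "is_chart (U, \<phi>)" using A by blast
  from smooth_on_add[OF chart_image_open[OF this W] f[THEN smooth_funD[OF _ c]]]
  show "smooth_on (\<phi> ` (U \<inter> W)) ((\<lambda>x. f x + h x) \<circ> inv_into U \<phi>)" by (simp add: o_def)
qed

lemma smooth_fun_mult:
  assumes A: "\<forall>c\<in>A. is_chart c" and W: "open W" and f: "smooth_fun A W f" "smooth_fun A W h"
  shows "smooth_fun A W (\<lambda>x. f x * h x)"
proof (rule smooth_funI)
  fix U \<phi> assume c: "(U, \<phi>) \<in> A"
  then have "is_chart (U, \<phi>)" using A by blast
  from smooth_on_mult[OF chart_image_open[OF this W] f[THEN smooth_funD[OF _ c]]]
  show "smooth_on (\<phi> ` (U \<inter> W)) ((\<lambda>x. f x * h x) \<circ> inv_into U \<phi>)" by (simp add: o_def)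
qed

lemma smooth_fun_sum:
  assumes A: "\<forall>c\<in>A. is_chart c" and W: "open W" and f: "\<And>i. i \<in> I \<Longrightarrow> smooth_fun A W (f i)"
  shows "smooth_fun A W (\<lambda>x. \<Sum>i\<in>I. f i x)"
  using f by (induction I rule: infinite_finite_induct) (auto intro!: smooth_fun_add[OF A W] smooth_fun_const)

lemma smooth_fun_comp_map:
  fixes A :: "('g::topological_space, 'd::real_normed_vector) chart set"
    and B :: "('h::topological_space, 'e::{real_inner,banach}) chart set"
  assumes A: "\<forall>c\<in>A. is_chart c" and B: "\<forall>c\<in>B. is_chart c" "\<Union> (fst ` B) = UNIV"
    and E: "orthonormal_basis (E :: 'e set)"
    and F: "smooth_map A B F" and W: "open W" and f: "smooth_fun B W f"
  shows "smooth_fun A (F -` W) (f \<circ> F)"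
proof (rule smooth_funI, rule smooth_on_local)
  fix U \<phi> y assume c: "(U, \<phi>) \<in> A" and "y \<in> \<phi> ` (U \<inter> F -` W)"
  then obtain x where x: "x \<in> U" "F x \<in> W" "y = \<phi> x" by blast
  have cU: "is_chart (U, \<phi>)" using A c by blast
  obtain V \<psi> where V: "(V, \<psi>) \<in> B" "F x \<in> V" using B(2) by (metis UNIV_I UN_E prod.collapse)
  have cV: "is_chart (V, \<psi>)" using B V by blast
  have contF: "continuous_on UNIV F" using F by (simp add: smooth_map_def)
  define O' where "O' = F -` (V \<inter> W)"
  have O': "open O'" unfolding O'_def
    using open_vimage[OF open_Int[OF is_chartD(1)[OF cV] W] contF] .
  let ?S = "\<phi> ` (U \<inter> O')"
  have S: "open ?S" by (rule chart_image_open[OF cU O'])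
  have "\<forall>(V, \<psi>)\<in>B. smooth_on (\<phi> ` (U \<inter> F -` V)) (\<psi> \<circ> F \<circ> inv_into U \<phi>)"
    using F c unfolding smooth_map_def by (elim conjE) (drule (1) bspec, simp)
  then have G: "smooth_on (\<phi> ` (U \<inter> F -` V)) (\<psi> \<circ> F \<circ> inv_into U \<phi>)"
    using V(1) by fastforce
  have GS: "smooth_on ?S (\<psi> \<circ> F \<circ> inv_into U \<phi>)"
    by (rule smooth_on_subset[OF G]) (auto simp: O'_def)
  have maps: "(\<psi> \<circ> F \<circ> inv_into U \<phi>) z \<in> \<psi> ` (V \<inter> W)" if "z \<in> ?S" for z
    using that is_chartD(5)[OF cU] by (auto simp: O'_def)
  have "smooth_on ?S (\<lambda>z. (f \<circ> inv_into V \<psi>) ((\<psi> \<circ> F \<circ> inv_into U \<phi>) z))"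
    by (rule smooth_on_comp[OF E S chart_image_open[OF cV W] maps GS smooth_funD[OF f V(1)]])
  moreover have "(f \<circ> inv_into V \<psi>) ((\<psi> \<circ> F \<circ> inv_into U \<phi>) z) = (f \<circ> F \<circ> inv_into U \<phi>) z" if "z \<in> ?S" for z
    using that is_chartD(5)[OF cU] is_chartD(5)[OF cV] by (auto simp: O'_def)
  ultimately have "smooth_on ?S (f \<circ> F \<circ> inv_into U \<phi>)"
    using smooth_on_cong[OF S, of "\<lambda>z. (f \<circ> inv_into V \<psi>) ((\<psi> \<circ> F \<circ> inv_into U \<phi>) z)" "f \<circ> F \<circ> inv_into U \<phi>"]
    by blast
  moreover have "\<phi> ` (U \<inter> F -` W) \<inter> ?S \<subseteq> ?S" by blast
  ultimately have "smooth_on (\<phi> ` (U \<inter> F -` W) \<inter> ?S) (f \<circ> F \<circ> inv_into U \<phi>)"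
    by (rule smooth_on_subset)
  then show "\<exists>T. open T \<and> y \<in> T \<and> smooth_on (\<phi> ` (U \<inter> F -` W) \<inter> T) (f \<circ> F \<circ> inv_into U \<phi>)"
    using S x V(2) by (intro exI[of _ ?S]) (auto simp: O'_def)
qed

section \<open>Derivations at a point\<close>

lemma smooth_at_cong:
  assumes A: "\<forall>c\<in>A. is_chart c" and W: "open W" "p \<in> W" and eq: "\<And>x. x \<in> W \<Longrightarrow> f x = h x"
  shows "smooth_at A p f \<longleftrightarrow> smooth_at A p h"
proof -
  have imp: "smooth_at A p h" if f: "smooth_at A p f" and eq: "\<And>x. x \<in> W \<Longrightarrow> f x = h x" for f h
  proof -
    obtain V where V: "open V" "p \<in> V" "smooth_fun A V f" using f unfolding smooth_at_def by blast
    have "smooth_fun A (V \<inter> W) h"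
      by (rule smooth_fun_cong_imp[OF A open_Int[OF V(1) W(1)] _ smooth_fun_subset[OF V(3) Int_lower1]])
        (simp add: eq)
    then show ?thesis unfolding smooth_at_def using V W by (intro exI[of _ "V \<inter> W"]) (simp add: open_Int)
  qed
  show ?thesis using imp[of f h] imp[of h f] eq by (intro iffI) simp_all
qed

lemma smooth_fun_imp_at: "smooth_fun A W f \<Longrightarrow> open W \<Longrightarrow> p \<in> W \<Longrightarrow> smooth_at A p f"
  unfolding smooth_at_def by blast

lemma smooth_at_const: "smooth_at A p (\<lambda>x. c)"
  unfolding smooth_at_def using smooth_fun_const by (intro exI[of _ UNIV]) simp

lemma smooth_at_common:
  assumes "smooth_at A p f" "smooth_at A p h"
  obtains W where "open W" "p \<in> W" "smooth_fun A W f" "smooth_fun A W h"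
proof -
  obtain W1 W2 where W: "open W1" "p \<in> W1" "smooth_fun A W1 f" "open W2" "p \<in> W2" "smooth_fun A W2 h"
    using assms unfolding smooth_at_def by blast
  show thesis
    by (rule that[of "W1 \<inter> W2"])
      (use W smooth_fun_subset[OF _ Int_lower1] smooth_fun_subset[OF _ Int_lower2] in \<open>simp_all add: open_Int\<close>)
qed

lemma smooth_at_add:
  assumes "\<forall>c\<in>A. is_chart c" "smooth_at A p f" "smooth_at A p h"
  shows "smooth_at A p (\<lambda>x. f x + h x)"
proof -
  obtain W where "open W" "p \<in> W" "smooth_fun A W f" "smooth_fun A W h"
    by (rule smooth_at_common[OF assms(2,3)])
  then show ?thesis
    unfolding smooth_at_def using smooth_fun_add[OF assms(1)] by (intro exI[of _ W]) simp
qed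

lemma smooth_at_mult:
  assumes "\<forall>c\<in>A. is_chart c" "smooth_at A p f" "smooth_at A p h"
  shows "smooth_at A p (\<lambda>x. f x * h x)"
proof -
  obtain W where "open W" "p \<in> W" "smooth_fun A W f" "smooth_fun A W h"
    by (rule smooth_at_common[OF assms(2,3)])
  then show ?thesis
    unfolding smooth_at_def using smooth_fun_mult[OF assms(1)] by (intro exI[of _ W]) simp
qed

lemma smooth_at_sum:
  assumes "\<forall>c\<in>A. is_chart c" "\<And>i. i \<in> I \<Longrightarrow> smooth_at A p (f i)"
  shows "smooth_at A p (\<lambda>x. \<Sum>i\<in>I. f i x)"
  using assms(2) by (induction I rule: infinite_finite_induct) (auto intro!: smooth_at_add[OF assms(1)] smooth_at_const)

context
  fixes A :: "('g::topological_space, 'e::real_normed_vector) chart set" and p v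
  assumes A: "\<forall>c\<in>A. is_chart c" and v: "v \<in> tangent_space A p"
begin

lemma tangent_nonsmooth: "\<not> smooth_at A p f \<Longrightarrow> v f = 0"
  using v unfolding tangent_space_def by blast

lemma tangent_linear:
  "smooth_at A p f \<Longrightarrow> smooth_at A p h \<Longrightarrow> v (\<lambda>x. a * f x + b * h x) = a * v f + b * v h"
  using v unfolding tangent_space_def by blast

lemma tangent_mult:
  "smooth_at A p f \<Longrightarrow> smooth_at A p h \<Longrightarrow> v (\<lambda>x. f x * h x) = v f * h p + f p * v h"
  using v unfolding tangent_space_def by blast

lemma tangent_add: "smooth_at A p f \<Longrightarrow> smooth_at A p h \<Longrightarrow> v (\<lambda>x. f x + h x) = v f + v h"
  using tangent_linear[of f h 1 1] by simp

lemma tangent_cmult: "smooth_at A p f \<Longrightarrow> v (\<lambda>x. a * f x) = a * v f"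
  using tangent_linear[of f f a 0] by simp

lemma tangent_const: "v (\<lambda>x. c) = 0"
proof -
  have "v (\<lambda>x. 1 * 1) = v (\<lambda>x. 1) * 1 + 1 * v (\<lambda>x. 1)"
    by (rule tangent_mult) (rule smooth_at_const)+
  then have "v (\<lambda>x. 1) = 0" by simp
  then show ?thesis using tangent_cmult[OF smooth_at_const, of c 1] by simp
qed

lemma tangent_sum:
  "(\<And>i. i \<in> I \<Longrightarrow> smooth_at A p (f i)) \<Longrightarrow> v (\<lambda>x. \<Sum>i\<in>I. f i x) = (\<Sum>i\<in>I. v (f i))"
  by (induction I rule: infinite_finite_induct)
    (auto simp: tangent_const tangent_add smooth_at_sum[OF A])

text \<open>Apply the Leibniz rule to the product with the indicator function of \<open>W\<close>, which is smooth at \<open>p\<close> and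
on which every derivation vanishes, being idempotent.\<close>

lemma tangent_local:
  assumes W: "open W" "p \<in> W" and eq: "\<And>x. x \<in> W \<Longrightarrow> f x = h x"
  shows "v f = v h"
proof (cases "smooth_at A p f")
  case True
  then have h: "smooth_at A p h" using smooth_at_cong[OF A W, of f h] eq by simp
  \<comment> \<open>idempotent, and equal to the constant 1 near \<open>p\<close>\<close>
  define k where "k = (\<lambda>x. if x \<in> W then 1 else 0 :: real)"
  have k: "smooth_at A p k"
    using smooth_at_cong[OF A W, of k "\<lambda>x. 1"] smooth_at_const[of A p 1] by (auto simp: k_def)
  have "(\<lambda>x. k x * k x) = k" by (auto simp: k_def)
  with tangent_mult[OF k k] have "v k = v k * k p + k p * v k" by simp
  then have vk: "v k = 0" using W by (simp add: k_def)
  have "v f' = v (\<lambda>x. k x * f' x)" if "smooth_at A p f'" for f'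
    using tangent_mult[OF k that] vk W by (simp add: k_def)
  moreover have "(\<lambda>x. k x * f x) = (\<lambda>x. k x * h x)" using eq by (auto simp: k_def)
  ultimately show ?thesis using True h by metis
next
  case False
  then have "\<not> smooth_at A p h" using smooth_at_cong[OF A W, of f h] eq by simp
  then show ?thesis using False tangent_nonsmooth by simp
qed

lemma push_vec_tangent:
  assumes F: "\<And>f. smooth_at A (F p) f \<Longrightarrow> smooth_at A p (f \<circ> F)"
  shows "push_vec A F p v \<in> tangent_space A (F p)"
  unfolding tangent_space_def mem_Collect_eq
proof (intro conjI allI impI)
  fix f h a b assume f: "smooth_at A (F p) f \<and> smooth_at A (F p) h"
  have *: "smooth_at A (F p) (\<lambda>x. a * f x + b * h x)"
    using f by (intro smooth_at_add[OF A] smooth_at_mult[OF A] smooth_at_const) auto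
  show "push_vec A F p v (\<lambda>x. a * f x + b * h x) = a * push_vec A F p v f + b * push_vec A F p v h"
    using * f tangent_linear[OF F F, of f h a b] by (simp add: push_vec_def o_def)
next
  fix f h assume f: "smooth_at A (F p) f \<and> smooth_at A (F p) h"
  have *: "smooth_at A (F p) (\<lambda>x. f x * h x)"
    using f by (intro smooth_at_mult[OF A]) auto
  show "push_vec A F p v (\<lambda>x. f x * h x) = push_vec A F p v f * h (F p) + f (F p) * push_vec A F p v h"
    using * f tangent_mult[OF F F, of f h] by (simp add: push_vec_def o_def)
qed (simp add: push_vec_def)

end

lemma subspace_tangent_space: "fun_vs.subspace (tangent_space A p)"
  unfolding fun_vs.subspace_def
proof (intro conjI ballI allI)
  show "0 \<in> tangent_space A p" by (simp add: tangent_space_def)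
  fix v w c assume "v \<in> tangent_space A p"
  then show "fscale c v \<in> tangent_space A p"
    by (simp add: tangent_space_def fscale_def algebra_simps)
  assume "w \<in> tangent_space A p"
  with \<open>v \<in> tangent_space A p\<close> show "v + w \<in> tangent_space A p"
    by (simp add: tangent_space_def algebra_simps)
qed

lemma subspace_cotangent_space: "fun_vs.subspace (cotangent_space A p)"
  unfolding fun_vs.subspace_def
proof (intro conjI ballI allI)
  show "0 \<in> cotangent_space A p" by (simp add: cotangent_space_def)
  fix v w c assume "v \<in> cotangent_space A p"
  then show "fscale c v \<in> cotangent_space A p"
    by (simp add: cotangent_space_def fscale_def algebra_simps)
  assume "w \<in> cotangent_space A p"
  with \<open>v \<in> cotangent_space A p\<close> show "v + w \<in> cotangent_space A p"
    by (simp add: cotangent_space_def algebra_simps)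
qed

lemma differential_cotangent: "differential A p f \<in> cotangent_space A p"
proof -
  have "fscale a v + fscale b w \<in> tangent_space A p"
    if "v \<in> tangent_space A p" "w \<in> tangent_space A p" for a b v w
    using subspace_tangent_space[of A p] that by (auto simp: fun_vs.subspace_def)
  then show ?thesis
    unfolding cotangent_space_def differential_def mem_Collect_eq by (auto simp: fscale_def)
qed

section \<open>The coordinate frame at a point\<close>

lemma frechet_derivative_affine:
  assumes "bounded_linear L" "(f has_derivative f') (at (c + L x))"
  shows "frechet_derivative (\<lambda>y. f (c + L y)) (at x) v = f' (L v)"
proof -
  have "((\<lambda>x. c + L x) has_derivative L) (at x)"
    using has_derivative_add[OF has_derivative_const bounded_linear_imp_has_derivative[OF assms(1)]]
    by simp
  from diff_chain_at[OF this assms(2)]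
  have "((\<lambda>y. f (c + L y)) has_derivative (\<lambda>v. f' (L v))) (at x)" by (simp add: o_def)
  from frechet_derivative_at[OF this] show ?thesis by metis
qed

definition chart_coord :: "('g \<Rightarrow> 'e::real_inner) \<Rightarrow> 'g \<Rightarrow> 'e \<Rightarrow> 'g \<Rightarrow> real" where
  "chart_coord \<phi> e b = (\<lambda>x. (\<phi> x - \<phi> e) \<bullet> b)"

definition chart_partial :: "('g::topological_space, 'e::real_normed_vector) chart set \<Rightarrow> 'g set
    \<Rightarrow> ('g \<Rightarrow> 'e) \<Rightarrow> 'g \<Rightarrow> 'e \<Rightarrow> 'g vec" where
  "chart_partial A U \<phi> e b =
    (\<lambda>f. if smooth_at A e f then frechet_derivative (f \<circ> inv_into U \<phi>) (at (\<phi> e)) b else 0)"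

locale chart_frame =
  fixes A :: "('g::{t2_space,second_countable_topology}, 'e::{real_inner,banach}) chart set"
    and E :: "'e set" and U :: "'g set" and \<phi> :: "'g \<Rightarrow> 'e" and e :: 'g
  assumes atlas: "smooth_atlas A" and E: "orthonormal_basis E"
    and chart: "(U, \<phi>) \<in> A" and e_in: "e \<in> U"
begin

abbreviation "y \<equiv> chart_coord \<phi> e"
abbreviation "\<xi> \<equiv> chart_partial A U \<phi> e"

lemma charts: "\<forall>c\<in>A. is_chart c"
  using atlas unfolding smooth_atlas_def by blast

lemma cover: "\<Union> (fst ` A) = UNIV"
  using atlas unfolding smooth_atlas_def by blast

lemma chart_at:
  obtains V \<psi> where "(V, \<psi>) \<in> A" "p \<in> V"
  using cover by (metis UNIV_I UN_E prod.collapse)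

lemma transition: "(V, \<psi>) \<in> A \<Longrightarrow> (V', \<psi>') \<in> A \<Longrightarrow> smooth_on (\<psi> ` (V \<inter> V')) (\<psi>' \<circ> inv_into V \<psi>)"
  using atlas unfolding smooth_atlas_def by fastforce

lemma is_chart_U: "is_chart (U, \<phi>)"
  using charts chart by blast

lemmas chartU = is_chartD[OF is_chart_U]

lemma finite_E: "finite E"
  using E by (simp add: orthonormal_basis_def)

text \<open>Smoothness read in one chart that contains the domain passes to all others through the transition maps.\<close>

lemma smooth_fun_in_chart:
  assumes W: "open W" "W \<subseteq> U" and f: "smooth_on (\<phi> ` W) (f \<circ> inv_into U \<phi>)"
  shows "smooth_fun A W f"
proof (rule smooth_funI)
  fix V \<psi> assume V: "(V, \<psi>) \<in> A"
  then have cV: "is_chart (V, \<psi>)" using charts by blast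
  note op = chart_image_open[OF cV W(1)]
  have "open (\<phi> ` W)" using chart_image_open[OF is_chart_U W(1)] W(2) by (simp add: Int_absorb1)
  moreover have "smooth_on (\<psi> ` (V \<inter> W)) (\<phi> \<circ> inv_into V \<psi>)"
    by (rule smooth_on_subset[OF transition[OF V chart]]) (use W in blast)
  ultimately have "smooth_on (\<psi> ` (V \<inter> W)) (\<lambda>z. (f \<circ> inv_into U \<phi>) ((\<phi> \<circ> inv_into V \<psi>) z))"
    using is_chartD(5)[OF cV] by (intro smooth_on_comp[OF E op _ _ _ f]) (auto simp: o_def)
  moreover have "(f \<circ> inv_into U \<phi>) ((\<phi> \<circ> inv_into V \<psi>) z) = (f \<circ> inv_into V \<psi>) z" if "z \<in> \<psi> ` (V \<inter> W)" for z
    using that is_chartD(5)[OF cV] chartU(5) W(2) by auto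
  ultimately show "smooth_on (\<psi> ` (V \<inter> W)) (f \<circ> inv_into V \<psi>)"
    using smooth_on_cong[OF op, of "\<lambda>z. (f \<circ> inv_into U \<phi>) ((\<phi> \<circ> inv_into V \<psi>) z)" "f \<circ> inv_into V \<psi>"]
    by blast
qed

lemma smooth_coord: "smooth_at A e (y b)"
proof -
  have op: "open (\<phi> ` U)" by (rule chartU(2))
  have "smooth_on (\<phi> ` U) (\<phi> \<circ> inv_into U \<phi>)" using transition[OF chart chart] by simp
  from smooth_on_linear_comp[OF bounded_linear_inner_left[of b] op this]
  have "smooth_on (\<phi> ` U) (\<lambda>x. (\<phi> \<circ> inv_into U \<phi>) x \<bullet> b + (- (\<phi> e \<bullet> b)))"
    by (rule smooth_on_add[OF op _ smooth_on_const])
  then have "smooth_on (\<phi> ` U) (y b \<circ> inv_into U \<phi>)"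
    by (simp add: chart_coord_def o_def inner_diff_left)
  then have "smooth_fun A U (y b)" by (rule smooth_fun_in_chart[OF chartU(1) order_refl])
  then show ?thesis by (rule smooth_fun_imp_at[OF _ chartU(1) e_in])
qed

lemma coord_e: "y b e = 0"
  by (simp add: chart_coord_def)

lemma smooth_at_in_chart:
  assumes "smooth_at A e f"
  obtains W where "open W" "e \<in> W" "W \<subseteq> U" "smooth_fun A W f" "open (\<phi> ` W)" "smooth_on (\<phi> ` W) (f \<circ> inv_into U \<phi>)"
proof -
  obtain W where W: "open W" "e \<in> W" "smooth_fun A W f" using assms unfolding smooth_at_def by blast
  have "smooth_fun A (U \<inter> W) f" by (rule smooth_fun_subset[OF W(3) Int_lower2])
  then show thesis
    using W that[of "U \<inter> W"] e_in open_Int[OF chartU(1) W(1)] chart_image_open[OF is_chart_U W(1)]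
      smooth_funD[OF W(3) chart] by simp
qed

lemma \<xi>_has_derivative:
  assumes "smooth_at A e f"
  shows "((f \<circ> inv_into U \<phi>) has_derivative (\<lambda>b. \<xi> b f)) (at (\<phi> e))"
proof -
  obtain W where "e \<in> W" "smooth_on (\<phi> ` W) (f \<circ> inv_into U \<phi>)"
    by (rule smooth_at_in_chart[OF assms])
  from smooth_on_has_derivative[OF this(2)] this(1) show ?thesis
    using assms by (simp add: chart_partial_def)
qed

lemma \<xi>_eqI:
  assumes "smooth_at A e f" "((f \<circ> inv_into U \<phi>) has_derivative f') (at (\<phi> e))"
  shows "\<xi> b f = f' b"
  using has_derivative_unique[OF \<xi>_has_derivative[OF assms(1)] assms(2)] by metis

lemma \<xi>_tangent: "\<xi> b \<in> tangent_space A e"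
  unfolding tangent_space_def mem_Collect_eq
proof (intro conjI allI impI)
  fix f h a c assume f: "smooth_at A e f \<and> smooth_at A e h"
  have *: "smooth_at A e (\<lambda>x. a * f x + c * h x)"
    using f by (intro smooth_at_add[OF charts] smooth_at_mult[OF charts] smooth_at_const) auto
  have "(((\<lambda>x. a * f x + c * h x) \<circ> inv_into U \<phi>) has_derivative (\<lambda>b. a * \<xi> b f + c * \<xi> b h)) (at (\<phi> e))"
    using has_derivative_add[OF has_derivative_mult_right[OF \<xi>_has_derivative, of f a]
        has_derivative_mult_right[OF \<xi>_has_derivative, of h c]] f by (simp add: o_def)
  from \<xi>_eqI[OF * this] show "\<xi> b (\<lambda>x. a * f x + c * h x) = a * \<xi> b f + c * \<xi> b h" .
next
  fix f h assume f: "smooth_at A e f \<and> smooth_at A e h"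
  have *: "smooth_at A e (\<lambda>x. f x * h x)"
    using f by (intro smooth_at_mult[OF charts]) auto
  have "(((\<lambda>x. f x * h x) \<circ> inv_into U \<phi>) has_derivative (\<lambda>b. f e * \<xi> b h + \<xi> b f * h e)) (at (\<phi> e))"
    using has_derivative_mult[OF \<xi>_has_derivative \<xi>_has_derivative, of f h] f chartU(5)[OF e_in] by (simp add: o_def)
  from \<xi>_eqI[OF * this] show "\<xi> b (\<lambda>x. f x * h x) = \<xi> b f * h e + f e * \<xi> b h" by simp
qed (simp add: chart_partial_def)

text \<open>Near \<open>e\<close>, a function minus its value is a combination of the coordinates with smooth coefficients;
derivations see only the values of these coefficients at \<open>e\<close>, which are the partial derivatives.\<close>

lemma hadamard_at:
  assumes f: "smooth_at A e f"
  obtains G W where "\<forall>b. smooth_at A e (G b)" "\<forall>b. G b e = \<xi> b f" "open W" "e \<in> W"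
    "\<forall>x\<in>W. f x = f e + (\<Sum>b\<in>E. y b x * G b x)"
proof -
  obtain W where W: "open W" "e \<in> W" "W \<subseteq> U" "smooth_fun A W f" "open (\<phi> ` W)"
    "smooth_on (\<phi> ` W) (f \<circ> inv_into U \<phi>)"
    by (rule smooth_at_in_chart[OF f])
  obtain r where r: "r > 0" "ball (\<phi> e) r \<subseteq> \<phi> ` W"
    using W(2,5) open_contains_ball by blast
  obtain g where g: "\<And>b. smooth_on (ball (\<phi> e) r) (g b)"
      "\<And>b. g b (\<phi> e) = frechet_derivative (f \<circ> inv_into U \<phi>) (at (\<phi> e)) b"
      "\<And>x. x \<in> ball (\<phi> e) r \<Longrightarrow> (f \<circ> inv_into U \<phi>) x = (f \<circ> inv_into U \<phi>) (\<phi> e) + (\<Sum>b\<in>E. ((x - \<phi> e) \<bullet> b) * g b x)"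
    using hadamard_ball[OF E smooth_on_subset[OF W(6) r(2)]] by blast
  define W' where "W' = U \<inter> \<phi> -` ball (\<phi> e) r"
  have W': "open W'" "e \<in> W'" "W' \<subseteq> U"
    using continuous_open_preimage[OF chartU(4) chartU(1), of "ball (\<phi> e) r"] e_in r(1) by (auto simp: W'_def)
  show thesis
  proof (rule that[of "\<lambda>b. g b \<circ> \<phi>" W']; (intro allI ballI)?)
    fix b
    have op: "open (\<phi> ` W')" using chart_image_open[OF is_chart_U W'(1)] W'(3) by (simp add: Int_absorb1)
    have "smooth_on (\<phi> ` W') (g b)" by (rule smooth_on_subset[OF g(1)]) (auto simp: W'_def)
    moreover have "g b z = (g b \<circ> \<phi> \<circ> inv_into U \<phi>) z" if "z \<in> \<phi> ` W'" for z
      using that W'(3) chartU(5) by auto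
    ultimately have "smooth_on (\<phi> ` W') (g b \<circ> \<phi> \<circ> inv_into U \<phi>)"
      using smooth_on_cong[OF op, of "g b" "g b \<circ> \<phi> \<circ> inv_into U \<phi>"] by blast
    then have "smooth_fun A W' (g b \<circ> \<phi>)" by (rule smooth_fun_in_chart[OF W'(1,3)])
    then show "smooth_at A e (g b \<circ> \<phi>)" by (rule smooth_fun_imp_at[OF _ W'(1,2)])
    show "(g b \<circ> \<phi>) e = \<xi> b f" using g(2)[of b] f by (simp add: chart_partial_def)
  next
    fix x assume "x \<in> W'"
    then have x: "x \<in> U" "\<phi> x \<in> ball (\<phi> e) r" by (auto simp: W'_def)
    from g(3)[OF x(2)] show "f x = f e + (\<Sum>b\<in>E. y b x * (g b \<circ> \<phi>) x)"
      unfolding chart_coord_def comp_def chartU(5)[OF x(1)] chartU(5)[OF e_in] .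
  qed (rule W')+
qed

lemma tangent_expand:
  assumes v: "v \<in> tangent_space A e" and f: "smooth_at A e f"
  shows "v f = (\<Sum>b\<in>E. v (y b) * \<xi> b f)"
proof -
  obtain G W where G: "\<And>b. smooth_at A e (G b)" "\<And>b. G b e = \<xi> b f" "open W" "e \<in> W"
    "\<And>x. x \<in> W \<Longrightarrow> f x = f e + (\<Sum>b\<in>E. y b x * G b x)"
    using hadamard_at[OF f] by metis
  note s = smooth_at_mult[OF charts smooth_coord G(1)]
  have "v f = v (\<lambda>x. f e + (\<Sum>b\<in>E. y b x * G b x))"
    by (rule tangent_local[OF charts v G(3,4,5)])
  also have "\<dots> = v (\<lambda>x. f e) + v (\<lambda>x. \<Sum>b\<in>E. y b x * G b x)"
    by (rule tangent_add[OF charts v smooth_at_const smooth_at_sum[OF charts s]])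
  also have "\<dots> = (\<Sum>b\<in>E. v (\<lambda>x. y b x * G b x))"
    using tangent_sum[OF charts v s] tangent_const[OF charts v] by simp
  also have "\<dots> = (\<Sum>b\<in>E. v (y b) * \<xi> b f)"
    using tangent_mult[OF charts v smooth_coord G(1)] by (simp add: coord_e G(2))
  finally show ?thesis .
qed

lemma tangent_frame: "frame_on (tangent_space A e) E \<xi> (\<lambda>b v. v (y b))"
  unfolding frame_on_def linear_functional_on_def
proof (intro conjI ballI)
  fix v assume v: "v \<in> tangent_space A e"
  show "v = (\<Sum>b\<in>E. fscale (v (y b)) (\<xi> b))"
  proof
    fix f
    show "v f = (\<Sum>b\<in>E. fscale (v (y b)) (\<xi> b)) f"
    proof (cases "smooth_at A e f")
      case True
      then show ?thesis using tangent_expand[OF v True] by (simp add: sum_fun_apply)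
    next
      case False
      then show ?thesis
        using tangent_nonsmooth[OF charts v False] by (simp add: sum_fun_apply chart_partial_def)
    qed
  qed
qed (auto simp: finite_E \<xi>_tangent)

section \<open>Functions of two points\<close>

abbreviation "AA \<equiv> prod_atlas A A"

lemma AA_charts: "\<forall>c\<in>AA. is_chart c"
  using prod_atlas_charts[OF charts charts] by blast

lemma AA_I: "(V, \<psi>) \<in> A \<Longrightarrow> (V', \<psi>') \<in> A \<Longrightarrow> (V \<times> V', map_prod \<psi> \<psi>') \<in> AA"
  unfolding prod_atlas_def by blast

lemma prod_repr:
  assumes "(V, \<psi>) \<in> A" "(V', \<psi>') \<in> A" "x \<in> V" "x' \<in> V'"
  shows "(F \<circ> inv_into (V \<times> V') (map_prod \<psi> \<psi>')) (\<psi> x, \<psi>' x') = F (x, x')"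
proof -
  have c: "is_chart (V, \<psi>)" "is_chart (V', \<psi>')" using charts assms by blast+
  show ?thesis
    unfolding comp_def inv_into_map_prod[OF is_chartD(6)[OF c(1)] is_chartD(6)[OF c(2)] assms(3,4)] ..
qed

lemma open_slices:
  assumes "open W"
  shows "open {k. (k, h) \<in> W}" "open {k. (h, k) \<in> W}"
  using open_vimage[OF assms, of "\<lambda>k. (k, h)"] open_vimage[OF assms, of "\<lambda>k. (h, k)"]
  by (auto simp: vimage_def continuous_on_Pair)

text \<open>In product charts, fixing one argument is composition with an affine map.\<close>

lemma smooth_slice:
  assumes W: "open W" and F: "smooth_fun AA W F"
  shows "smooth_fun A {h. (k, h) \<in> W} (\<lambda>h. F (k, h))"
    and "smooth_fun A {h. (h, k) \<in> W} (\<lambda>h. F (h, k))"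
proof -
  obtain V0 \<psi>0 where V0: "(V0, \<psi>0) \<in> A" "k \<in> V0" by (rule chart_at)
  note op = chart_image_open[OF _ W, of "V \<times> V'" "map_prod \<psi> \<psi>'" for V V' \<psi> \<psi>']
  show "smooth_fun A {h. (k, h) \<in> W} (\<lambda>h. F (k, h))"
  proof (rule smooth_funI)
    fix V \<psi> assume V: "(V, \<psi>) \<in> A"
    then have cV: "is_chart (V, \<psi>)" using charts by blast
    let ?H = "F \<circ> inv_into (V0 \<times> V) (map_prod \<psi>0 \<psi>)"
    let ?S = "map_prod \<psi>0 \<psi> ` ((V0 \<times> V) \<inter> W)"
    let ?T = "\<psi> ` (V \<inter> {h. (k, h) \<in> W})"
    have S: "open ?S" using op AA_charts AA_I[OF V0(1) V] by blast
    have T: "open ?T" by (rule chart_image_open[OF cV open_slices(2)[OF W]])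
    have "smooth_on ?T (\<lambda>z. ?H ((\<psi>0 k, 0) + (0, z)))"
    proof (rule smooth_on_affine_comp[OF _ S T])
      show "bounded_linear (Pair 0 :: 'e \<Rightarrow> 'e \<times> 'e)"
        by (rule bounded_linear_Pair[OF bounded_linear_zero bounded_linear_ident])
      show "(\<psi>0 k, 0) + (0, z) \<in> ?S" if "z \<in> ?T" for z using that V0(2) by force
      show "smooth_on ?S ?H" by (rule smooth_funD[OF F AA_I[OF V0(1) V]])
    qed
    moreover have "?H ((\<psi>0 k, 0) + (0, z)) = ((\<lambda>h. F (k, h)) \<circ> inv_into V \<psi>) z" if "z \<in> ?T" for z
      using that prod_repr[OF V0(1) V V0(2), of _ F] is_chartD(5)[OF cV] by auto
    ultimately show "smooth_on ?T ((\<lambda>h. F (k, h)) \<circ> inv_into V \<psi>)"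
      using smooth_on_cong[OF T, of "\<lambda>z. ?H ((\<psi>0 k, 0) + (0, z))" "(\<lambda>h. F (k, h)) \<circ> inv_into V \<psi>"] by blast
  qed
  show "smooth_fun A {h. (h, k) \<in> W} (\<lambda>h. F (h, k))"
  proof (rule smooth_funI)
    fix V \<psi> assume V: "(V, \<psi>) \<in> A"
    then have cV: "is_chart (V, \<psi>)" using charts by blast
    let ?H = "F \<circ> inv_into (V \<times> V0) (map_prod \<psi> \<psi>0)"
    let ?S = "map_prod \<psi> \<psi>0 ` ((V \<times> V0) \<inter> W)"
    let ?T = "\<psi> ` (V \<inter> {h. (h, k) \<in> W})"
    have S: "open ?S" using op AA_charts AA_I[OF V V0(1)] by blast
    have T: "open ?T" by (rule chart_image_open[OF cV open_slices(1)[OF W]])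
    have "smooth_on ?T (\<lambda>z. ?H ((0, \<psi>0 k) + (z, 0)))"
    proof (rule smooth_on_affine_comp[OF _ S T])
      show "bounded_linear (\<lambda>z. (z, 0) :: 'e \<times> 'e)"
        by (rule bounded_linear_Pair[OF bounded_linear_ident bounded_linear_zero])
      show "(0, \<psi>0 k) + (z, 0) \<in> ?S" if "z \<in> ?T" for z using that V0(2) by force
      show "smooth_on ?S ?H" by (rule smooth_funD[OF F AA_I[OF V V0(1)]])
    qed
    moreover have "?H ((0, \<psi>0 k) + (z, 0)) = ((\<lambda>h. F (h, k)) \<circ> inv_into V \<psi>) z" if "z \<in> ?T" for z
      using that prod_repr[OF V V0(1) _ V0(2), of _ F] is_chartD(5)[OF cV] by auto
    ultimately show "smooth_on ?T ((\<lambda>h. F (h, k)) \<circ> inv_into V \<psi>)"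
      using smooth_on_cong[OF T, of "\<lambda>z. ?H ((0, \<psi>0 k) + (z, 0))" "(\<lambda>h. F (h, k)) \<circ> inv_into V \<psi>"] by blast
  qed
qed

lemma smooth_at_slice:
  assumes W: "open W" and F: "smooth_fun AA W F" and x: "(k, h) \<in> W"
  shows "smooth_at A h (\<lambda>h. F (k, h))" and "smooth_at A k (\<lambda>k. F (k, h))"
  using smooth_fun_imp_at[OF smooth_slice(1)[OF W F] open_slices(2)[OF W]]
    smooth_fun_imp_at[OF smooth_slice(2)[OF W F] open_slices(1)[OF W]] x by auto

text \<open>Differentiating in one argument at \<open>e\<close> is a directional derivative of the representation of \<open>F\<close> in a
product chart. This makes smooth dependence on the other argument and commutation available.\<close>

lemma \<xi>_slice:
  assumes W: "open W" and F: "smooth_fun AA W F" and V: "(V, \<psi>) \<in> A" and x: "x \<in> V"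
  shows "(x, e) \<in> W \<Longrightarrow> \<xi> b (\<lambda>h. F (x, h)) =
      frechet_derivative (F \<circ> inv_into (V \<times> U) (map_prod \<psi> \<phi>)) (at (\<psi> x, \<phi> e)) (0, b)"
    and "(e, x) \<in> W \<Longrightarrow> \<xi> b (\<lambda>h. F (h, x)) =
      frechet_derivative (F \<circ> inv_into (U \<times> V) (map_prod \<phi> \<psi>)) (at (\<phi> e, \<psi> x)) (b, 0)"
proof -
  assume xW: "(x, e) \<in> W"
  let ?H = "F \<circ> inv_into (V \<times> U) (map_prod \<psi> \<phi>)"
  have "(?H has_derivative frechet_derivative ?H (at (\<psi> x, \<phi> e))) (at ((\<psi> x, 0) + (0, \<phi> e)))"
    using smooth_on_has_derivative[OF smooth_funD[OF F AA_I[OF V chart]], of "(\<psi> x, \<phi> e)"] x xW e_in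
    by force
  from frechet_derivative_affine[OF bounded_linear_Pair[OF bounded_linear_zero bounded_linear_ident] this]
  have 1: "frechet_derivative (\<lambda>z. ?H ((\<psi> x, 0) + (0, z))) (at (\<phi> e)) b = frechet_derivative ?H (at (\<psi> x, \<phi> e)) (0, b)" .
  have "frechet_derivative ((\<lambda>h. F (x, h)) \<circ> inv_into U \<phi>) (at (\<phi> e)) =
      frechet_derivative (\<lambda>z. ?H ((\<psi> x, 0) + (0, z))) (at (\<phi> e))"
    by (rule frechet_derivative_cong_open[OF chartU(2)])
      (use e_in chartU(5) prod_repr[OF V chart x, of _ F] in auto)
  with 1 show "\<xi> b (\<lambda>h. F (x, h)) = frechet_derivative ?H (at (\<psi> x, \<phi> e)) (0, b)"
    using smooth_at_slice(1)[OF W F xW] by (simp add: chart_partial_def)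
next
  assume xW: "(e, x) \<in> W"
  let ?H = "F \<circ> inv_into (U \<times> V) (map_prod \<phi> \<psi>)"
  have "(?H has_derivative frechet_derivative ?H (at (\<phi> e, \<psi> x))) (at ((0, \<psi> x) + (\<phi> e, 0)))"
    using smooth_on_has_derivative[OF smooth_funD[OF F AA_I[OF chart V]], of "(\<phi> e, \<psi> x)"] x xW e_in
    by force
  from frechet_derivative_affine[OF bounded_linear_Pair[OF bounded_linear_ident bounded_linear_zero] this]
  have 1: "frechet_derivative (\<lambda>z. ?H ((0, \<psi> x) + (z, 0))) (at (\<phi> e)) b = frechet_derivative ?H (at (\<phi> e, \<psi> x)) (b, 0)" .
  have "frechet_derivative ((\<lambda>h. F (h, x)) \<circ> inv_into U \<phi>) (at (\<phi> e)) =
      frechet_derivative (\<lambda>z. ?H ((0, \<psi> x) + (z, 0))) (at (\<phi> e))"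
    by (rule frechet_derivative_cong_open[OF chartU(2)])
      (use e_in chartU(5) prod_repr[OF chart V _ x, of _ F] in auto)
  with 1 show "\<xi> b (\<lambda>h. F (h, x)) = frechet_derivative ?H (at (\<phi> e, \<psi> x)) (b, 0)"
    using smooth_at_slice(2)[OF W F xW] by (simp add: chart_partial_def)
qed

lemma \<xi>_smooth:
  assumes W: "open W" and F: "smooth_fun AA W F"
  shows "smooth_fun A {x. (x, e) \<in> W} (\<lambda>x. \<xi> b (\<lambda>h. F (x, h)))"
    and "smooth_fun A {x. (e, x) \<in> W} (\<lambda>x. \<xi> b (\<lambda>h. F (h, x)))"
proof -
  note op = chart_image_open[OF _ W, of "V \<times> V'" "map_prod \<psi> \<psi>'" for V V' \<psi> \<psi>']
  show "smooth_fun A {x. (x, e) \<in> W} (\<lambda>x. \<xi> b (\<lambda>h. F (x, h)))"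
  proof (rule smooth_funI)
    fix V \<psi> assume V: "(V, \<psi>) \<in> A"
    then have cV: "is_chart (V, \<psi>)" using charts by blast
    let ?D = "\<lambda>z. frechet_derivative (F \<circ> inv_into (V \<times> U) (map_prod \<psi> \<phi>)) (at z) (0, b)"
    let ?S = "map_prod \<psi> \<phi> ` ((V \<times> U) \<inter> W)"
    let ?T = "\<psi> ` (V \<inter> {x. (x, e) \<in> W})"
    have S: "open ?S" using op AA_charts AA_I[OF V chart] by blast
    have T: "open ?T" by (rule chart_image_open[OF cV open_slices(1)[OF W]])
    have "smooth_on ?T (\<lambda>z. ?D ((0, \<phi> e) + (z, 0)))"
    proof (rule smooth_on_affine_comp[OF _ S T])
      show "bounded_linear (\<lambda>z. (z, 0) :: 'e \<times> 'e)"
        by (rule bounded_linear_Pair[OF bounded_linear_ident bounded_linear_zero])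
      show "(0, \<phi> e) + (z, 0) \<in> ?S" if "z \<in> ?T" for z using that e_in by force
      show "smooth_on ?S ?D" by (rule smooth_on_deriv[OF smooth_funD[OF F AA_I[OF V chart]]])
    qed
    moreover have "?D ((0, \<phi> e) + (z, 0)) = ((\<lambda>x. \<xi> b (\<lambda>h. F (x, h))) \<circ> inv_into V \<psi>) z" if "z \<in> ?T" for z
      using that \<xi>_slice(1)[OF W F V] is_chartD(5)[OF cV] by auto
    ultimately show "smooth_on ?T ((\<lambda>x. \<xi> b (\<lambda>h. F (x, h))) \<circ> inv_into V \<psi>)"
      using smooth_on_cong[OF T, of "\<lambda>z. ?D ((0, \<phi> e) + (z, 0))" "(\<lambda>x. \<xi> b (\<lambda>h. F (x, h))) \<circ> inv_into V \<psi>"] by blast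
  qed
  show "smooth_fun A {x. (e, x) \<in> W} (\<lambda>x. \<xi> b (\<lambda>h. F (h, x)))"
  proof (rule smooth_funI)
    fix V \<psi> assume V: "(V, \<psi>) \<in> A"
    then have cV: "is_chart (V, \<psi>)" using charts by blast
    let ?D = "\<lambda>z. frechet_derivative (F \<circ> inv_into (U \<times> V) (map_prod \<phi> \<psi>)) (at z) (b, 0)"
    let ?S = "map_prod \<phi> \<psi> ` ((U \<times> V) \<inter> W)"
    let ?T = "\<psi> ` (V \<inter> {x. (e, x) \<in> W})"
    have S: "open ?S" using op AA_charts AA_I[OF chart V] by blast
    have T: "open ?T" by (rule chart_image_open[OF cV open_slices(2)[OF W]])
    have "smooth_on ?T (\<lambda>z. ?D ((\<phi> e, 0) + (0, z)))"
    proof (rule smooth_on_affine_comp[OF _ S T])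
      show "bounded_linear (Pair 0 :: 'e \<Rightarrow> 'e \<times> 'e)"
        by (rule bounded_linear_Pair[OF bounded_linear_zero bounded_linear_ident])
      show "(\<phi> e, 0) + (0, z) \<in> ?S" if "z \<in> ?T" for z using that e_in by force
      show "smooth_on ?S ?D" by (rule smooth_on_deriv[OF smooth_funD[OF F AA_I[OF chart V]]])
    qed
    moreover have "?D ((\<phi> e, 0) + (0, z)) = ((\<lambda>x. \<xi> b (\<lambda>h. F (h, x))) \<circ> inv_into V \<psi>) z" if "z \<in> ?T" for z
      using that \<xi>_slice(2)[OF W F V] is_chartD(5)[OF cV] by auto
    ultimately show "smooth_on ?T ((\<lambda>x. \<xi> b (\<lambda>h. F (h, x))) \<circ> inv_into V \<psi>)"
      using smooth_on_cong[OF T, of "\<lambda>z. ?D ((\<phi> e, 0) + (0, z))" "(\<lambda>x. \<xi> b (\<lambda>h. F (h, x))) \<circ> inv_into V \<psi>"] by blast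
  qed
qed

lemma \<xi>_commute:
  assumes W: "open W" and F: "smooth_fun AA W F" and ee: "(e, e) \<in> W"
  shows "\<xi> a (\<lambda>h. \<xi> b (\<lambda>k. F (k, h))) = \<xi> b (\<lambda>k. \<xi> a (\<lambda>h. F (k, h)))"
proof -
  let ?H = "F \<circ> inv_into (U \<times> U) (map_prod \<phi> \<phi>)"
  let ?D = "\<lambda>w z. frechet_derivative ?H (at z) w"
  let ?S = "map_prod \<phi> \<phi> ` ((U \<times> U) \<inter> W)"
  have S: "open ?S" using chart_image_open[OF _ W] AA_charts AA_I[OF chart chart] by blast
  have H: "smooth_on ?S ?H" by (rule smooth_funD[OF F AA_I[OF chart chart]])
  have eS: "(\<phi> e, \<phi> e) \<in> ?S" using e_in ee by force
  have d: "(?D w has_derivative frechet_derivative (?D w) (at (\<phi> e, \<phi> e))) (at (\<phi> e, \<phi> e))" for w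
    by (rule smooth_on_has_derivative[OF smooth_on_deriv[OF H] eS])
  have s1: "smooth_at A e (\<lambda>h. \<xi> b (\<lambda>k. F (k, h)))"
    using smooth_fun_imp_at[OF \<xi>_smooth(2)[OF W F] open_slices(2)[OF W]] ee by blast
  have s2: "smooth_at A e (\<lambda>k. \<xi> a (\<lambda>h. F (k, h)))"
    using smooth_fun_imp_at[OF \<xi>_smooth(1)[OF W F] open_slices(1)[OF W]] ee by blast
  have "\<xi> a (\<lambda>h. \<xi> b (\<lambda>k. F (k, h))) =
      frechet_derivative (\<lambda>z. ?D (b, 0) ((\<phi> e, 0) + (0, z))) (at (\<phi> e)) a"
  proof -
    have T: "open (\<phi> ` (U \<inter> {x. (e, x) \<in> W}))" by (rule chart_image_open[OF is_chart_U open_slices(2)[OF W]])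
    have "frechet_derivative ((\<lambda>h. \<xi> b (\<lambda>k. F (k, h))) \<circ> inv_into U \<phi>) (at (\<phi> e)) =
      frechet_derivative (\<lambda>z. ?D (b, 0) ((\<phi> e, 0) + (0, z))) (at (\<phi> e))"
      by (rule frechet_derivative_cong_open[OF T])
        (use e_in ee chartU(5) \<xi>_slice(2)[OF W F chart] in auto)
    then show ?thesis using s1 by (simp add: chart_partial_def)
  qed
  also have "\<dots> = frechet_derivative (?D (b, 0)) (at (\<phi> e, \<phi> e)) (0, a)"
    using frechet_derivative_affine[OF bounded_linear_Pair[OF bounded_linear_zero bounded_linear_ident],
        of "?D (b, 0)" _ "(\<phi> e, 0)" "\<phi> e" a] d[of "(b, 0)"] by simp
  also have "\<dots> = frechet_derivative (?D (0, a)) (at (\<phi> e, \<phi> e)) (b, 0)"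
    by (rule mixed_partials[OF S eS H])
  also have "\<dots> = frechet_derivative (\<lambda>z. ?D (0, a) ((0, \<phi> e) + (z, 0))) (at (\<phi> e)) b"
    using frechet_derivative_affine[OF bounded_linear_Pair[OF bounded_linear_ident bounded_linear_zero],
        of "?D (0, a)" _ "(0, \<phi> e)" "\<phi> e" b] d[of "(0, a)"] by simp
  also have "\<dots> = \<xi> b (\<lambda>k. \<xi> a (\<lambda>h. F (k, h)))"
  proof -
    have T: "open (\<phi> ` (U \<inter> {x. (x, e) \<in> W}))" by (rule chart_image_open[OF is_chart_U open_slices(1)[OF W]])
    have "frechet_derivative ((\<lambda>k. \<xi> a (\<lambda>h. F (k, h))) \<circ> inv_into U \<phi>) (at (\<phi> e)) =
      frechet_derivative (\<lambda>z. ?D (0, a) ((0, \<phi> e) + (z, 0))) (at (\<phi> e))"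
      by (rule frechet_derivative_cong_open[OF T])
        (use e_in ee chartU(5) \<xi>_slice(1)[OF W F chart] in auto)
    then show ?thesis using s2 by (simp add: chart_partial_def)
  qed
  finally show ?thesis .
qed

section \<open>Germs and differentials\<close>

lemma smooth_at_eventually: "smooth_at A p f \<Longrightarrow> \<forall>\<^sub>F x in nhds p. smooth_at A x f"
  unfolding eventually_nhds smooth_at_def by blast

lemma smooth_at_cong_ev:
  assumes "\<forall>\<^sub>F x in nhds p. f x = h x"
  shows "smooth_at A p f \<longleftrightarrow> smooth_at A p h"
proof -
  obtain W where "open W" "p \<in> W" "\<And>x. x \<in> W \<Longrightarrow> f x = h x"
    using assms unfolding eventually_nhds by blast
  then show ?thesis by (rule smooth_at_cong[OF charts])
qed

lemma tangent_cong_ev: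
  assumes v: "v \<in> tangent_space A p" and "\<forall>\<^sub>F x in nhds p. f x = h x"
  shows "v f = v h"
proof -
  obtain W where "open W" "p \<in> W" "\<And>x. x \<in> W \<Longrightarrow> f x = h x"
    using assms(2) unfolding eventually_nhds by blast
  then show ?thesis by (rule tangent_local[OF charts v])
qed

lemma differential_cong:
  assumes "\<And>v. v \<in> tangent_space A p \<Longrightarrow> v f = v h"
  shows "differential A p f = differential A p h"
  using assms by (auto simp: differential_def)

lemma differential_linear:
  assumes "smooth_at A p f" "smooth_at A p h"
  shows "differential A p (\<lambda>x. a * f x + b * h x) = fscale a (differential A p f) + fscale b (differential A p h)"
  using tangent_linear[OF charts _ assms] by (auto simp: differential_def fun_eq_iff)

lemma differential_mult:
  assumes "smooth_at A p f" "smooth_at A p h"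
  shows "differential A p (\<lambda>x. f x * h x) = fscale (h p) (differential A p f) + fscale (f p) (differential A p h)"
  using tangent_mult[OF charts _ assms] by (auto simp: differential_def fun_eq_iff mult.commute)

lemma pull_covec_differential:
  assumes F: "\<And>f. smooth_at A (F p) f \<Longrightarrow> smooth_at A p (f \<circ> F)" and f: "smooth_at A (F p) f"
  shows "pull_covec A F p (differential A (F p) f) = differential A p (f \<circ> F)"
  using push_vec_tangent[OF charts _ F] f
  by (auto simp: pull_covec_def differential_def fun_eq_iff push_vec_def)

text \<open>Needed to pass to the opposite group.\<close>

lemma swap_smooth:
  assumes W: "open W" and F: "smooth_fun AA W F"
  shows "smooth_fun AA (prod.swap -` W) (F \<circ> prod.swap)"
proof (rule smooth_funI)
  fix O' \<Psi> assume "(O', \<Psi>) \<in> AA"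
  then obtain V \<psi> V' \<psi>' where O': "O' = V \<times> V'" "\<Psi> = map_prod \<psi> \<psi>'" "(V, \<psi>) \<in> A" "(V', \<psi>') \<in> A"
    unfolding prod_atlas_def by blast
  let ?S = "map_prod \<psi>' \<psi> ` ((V' \<times> V) \<inter> W)"
  let ?T = "map_prod \<psi> \<psi>' ` ((V \<times> V') \<inter> prod.swap -` W)"
  let ?H = "F \<circ> inv_into (V' \<times> V) (map_prod \<psi>' \<psi>)"
  let ?H' = "F \<circ> prod.swap \<circ> inv_into (V \<times> V') (map_prod \<psi> \<psi>')"
  have oW: "open (prod.swap -` W)"
    using W by (intro open_vimage continuous_on_swap)
  have S: "open ?S" using chart_image_open[OF _ W] AA_charts AA_I[OF O'(4,3)] by blast
  have T: "open ?T" using chart_image_open[OF _ oW] AA_charts AA_I[OF O'(3,4)] by blast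
  have "smooth_on ?T (\<lambda>z. ?H (0 + prod.swap z))"
  proof (rule smooth_on_affine_comp[OF _ S T])
    show "bounded_linear (prod.swap :: 'e \<times> 'e \<Rightarrow> 'e \<times> 'e)"
      unfolding prod.swap_def by (rule bounded_linear_Pair[OF bounded_linear_snd bounded_linear_fst])
    show "0 + prod.swap z \<in> ?S" if "z \<in> ?T" for z using that by force
    show "smooth_on ?S ?H" by (rule smooth_funD[OF F AA_I[OF O'(4,3)]])
  qed
  moreover have "?H (0 + prod.swap z) = ?H' z" if z: "z \<in> ?T" for z
  proof -
    obtain x x' where "x \<in> V" "x' \<in> V'" "z = (\<psi> x, \<psi>' x')" using z by auto
    then show ?thesis
      using prod_repr[OF O'(3,4), of x x' "F \<circ> prod.swap"] prod_repr[OF O'(4,3), of x' x F] by simp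
  qed
  ultimately show "smooth_on (\<Psi> ` (O' \<inter> prod.swap -` W)) (F \<circ> prod.swap \<circ> inv_into O' \<Psi>)"
    unfolding O'(1,2) using smooth_on_cong[OF T, of "\<lambda>z. ?H (0 + prod.swap z)" ?H'] by blast
qed

end

section \<open>Translations in Lie groups\<close>

text \<open>The assumption on \<open>m\<close> is smoothness of the multiplication, stated as the pullback of smooth functions.
It is symmetric in the two factors, so the opposite group satisfies the same assumptions with the same chart at
\<open>e\<close>, and every statement on left translations is also one on right translations.\<close>

locale lie_frame = chart_frame A E U \<phi> e
  for A :: "('g::{t2_space,second_countable_topology}, 'e::{real_inner,banach}) chart set"
    and E U \<phi> e +
  fixes m :: "'g \<Rightarrow> 'g \<Rightarrow> 'g" and i :: "'g \<Rightarrow> 'g"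
  assumes grp: "group m e i"
    and m_open: "open W \<Longrightarrow> open {z. m (fst z) (snd z) \<in> W}"
    and m_smooth: "open W \<Longrightarrow> smooth_fun A W f \<Longrightarrow>
      smooth_fun (prod_atlas A A) {z. m (fst z) (snd z) \<in> W} (\<lambda>z. f (m (fst z) (snd z)))"
begin

lemma opposite: "lie_frame A E U \<phi> e (\<lambda>x y. m y x) i"
proof (intro lie_frame.intro lie_frame_axioms.intro chart_frame_axioms)
  interpret g: group m e i by (rule grp)
  show "group (\<lambda>x y. m y x) e i"
    by unfold_locales (simp_all add: g.assoc)
  fix W :: "'g set" and f assume W: "open W"
  have eq: "{z. m (snd z) (fst z) \<in> W} = prod.swap -` {z. m (fst z) (snd z) \<in> W}" by auto
  show "open {z. m (snd z) (fst z) \<in> W}"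
    unfolding eq using m_open[OF W] by (intro open_vimage continuous_on_swap)
  assume f: "smooth_fun A W f"
  from swap_smooth[OF m_open[OF W] m_smooth[OF W f]]
  show "smooth_fun AA {z. m (snd z) (fst z) \<in> W} (\<lambda>z. f (m (snd z) (fst z)))"
    unfolding eq by (simp add: o_def)
qed

lemma grp_simps [simp]:
  "m e x = x" "m x e = x" "m (i x) x = e" "m x (i x) = e"
  "m (i x) (m x z) = z" "m x (m (i x) z) = z" "m (m z x) (i x) = z" "m (m z (i x)) x = z"
proof -
  interpret g: group m e i by (rule grp)
  show "m e x = x" "m x e = x" "m (i x) x = e" "m x (i x) = e" by simp_all
  then show "m (i x) (m x z) = z" "m x (m (i x) z) = z" "m (m z x) (i x) = z" "m (m z (i x)) x = z"
    by (simp_all add: g.assoc) (metis g.assoc g.left_neutral g.left_inverse g.right_inverse)+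
qed

lemma assoc: "m (m x z) w = m x (m z w)"
proof -
  interpret g: group m e i by (rule grp)
  show ?thesis by (rule g.assoc)
qed

lemma translate_eventually:
  assumes "\<forall>\<^sub>F x in nhds (m g h). Q x"
  shows "\<forall>\<^sub>F x in nhds h. Q (m g x)"
proof -
  obtain W where W: "open W" "m g h \<in> W" "\<And>x. x \<in> W \<Longrightarrow> Q x"
    using assms unfolding eventually_nhds by blast
  have "open {x. (g, x) \<in> {z. m (fst z) (snd z) \<in> W}}" by (rule open_slices(2)[OF m_open[OF W(1)]])
  then have "open {x. m g x \<in> W}" by simp
  then show ?thesis unfolding eventually_nhds using W by (intro exI[of _ "{x. m g x \<in> W}"]) auto
qed

lemma smooth_translate:
  assumes "smooth_at A (m g h) f"
  shows "smooth_at A h (\<lambda>x. f (m g x))"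
proof -
  obtain W where W: "open W" "m g h \<in> W" "smooth_fun A W f" using assms unfolding smooth_at_def by blast
  from smooth_at_slice(1)[OF m_open[OF W(1)] m_smooth[OF W(1,3)], of g h] W(2)
  show ?thesis by simp
qed

lemma push_translate: "v \<in> tangent_space A h \<Longrightarrow> push_vec A (m g) h v \<in> tangent_space A (m g h)"
  by (rule push_vec_tangent[OF charts]) (auto simp: o_def intro: smooth_translate)

definition "left_coord g b = (\<lambda>x. y b (m (i g) x))"
definition "left_frame g b = push_vec A (m g) e (\<xi> b)"

lemma left_frame_tangent: "left_frame g b \<in> tangent_space A g"
  using push_translate[OF \<xi>_tangent, of g b] by (simp add: left_frame_def)

lemma smooth_left_coord: "smooth_at A g (left_coord g b)"
  unfolding left_coord_def by (rule smooth_translate) (simp add: smooth_coord)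

lemma left_frame_apply: "smooth_at A g f \<Longrightarrow> left_frame g b f = \<xi> b (\<lambda>h. f (m g h))"
  by (simp add: left_frame_def push_vec_def o_def)

text \<open>The expansion at \<open>e\<close> transported by the left translation by \<open>g\<close>.\<close>

lemma tangent_expand_at:
  assumes v: "v \<in> tangent_space A g" and f: "smooth_at A g f"
  shows "v f = (\<Sum>b\<in>E. v (left_coord g b) * left_frame g b f)"
proof -
  let ?w = "push_vec A (m (i g)) g v"
  have w: "?w \<in> tangent_space A e" using push_translate[OF v, of "i g"] by simp
  have w_apply: "?w h = v (\<lambda>x. h (m (i g) x))" if "smooth_at A e h" for h
    using that by (simp add: push_vec_def o_def)
  have fg: "smooth_at A e (\<lambda>x. f (m g x))" using smooth_translate[of g e f] f by simp
  have "v f = ?w (\<lambda>x. f (m g x))" by (simp add: w_apply[OF fg])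
  also have "\<dots> = (\<Sum>b\<in>E. ?w (y b) * \<xi> b (\<lambda>x. f (m g x)))" by (rule tangent_expand[OF w fg])
  also have "\<dots> = (\<Sum>b\<in>E. v (left_coord g b) * left_frame g b f)"
    by (simp add: w_apply[OF smooth_coord] left_frame_apply[OF f] left_coord_def)
  finally show ?thesis .
qed

lemma tangent_frame_at: "frame_on (tangent_space A g) E (left_frame g) (\<lambda>b v. v (left_coord g b))"
  unfolding frame_on_def linear_functional_on_def
proof (intro conjI ballI)
  fix v assume v: "v \<in> tangent_space A g"
  show "v = (\<Sum>b\<in>E. fscale (v (left_coord g b)) (left_frame g b))"
  proof
    fix f
    show "v f = (\<Sum>b\<in>E. fscale (v (left_coord g b)) (left_frame g b)) f"
    proof (cases "smooth_at A g f")
      case True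
      then show ?thesis using tangent_expand_at[OF v True] by (simp add: sum_fun_apply)
    next
      case False
      then show ?thesis
        using tangent_nonsmooth[OF charts v False] tangent_nonsmooth[OF charts left_frame_tangent False]
        by (simp add: sum_fun_apply)
    qed
  qed
qed (auto simp: finite_E left_frame_tangent)

text \<open>The left-invariant vector field with value \<open>v\<close> at \<open>g\<close>.\<close>

definition left_ext :: "'g \<Rightarrow> 'g vec \<Rightarrow> 'g \<Rightarrow> 'g vec" where
  "left_ext g v x = push_vec A (m x) e (push_vec A (m (i g)) g v)"

lemma left_ext_at: 
  assumes v: "v \<in> tangent_space A g" 
  shows "left_ext g v g = v"
proof
  fix f
  show "left_ext g v g f = v f"
  proof (cases "smooth_at A g f")
    case True
    then have "smooth_at A e (\<lambda>x. f (m g x))" using smooth_translate[of g e f] by simp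
    then show ?thesis using True by (simp add: left_ext_def push_vec_def o_def)
  next
    case False
    then show ?thesis using tangent_nonsmooth[OF charts v False] by (simp add: left_ext_def push_vec_def)
  qed
qed

text \<open>The field is a combination of the \<open>\<xi>\<^sub>b\<close> acting on the second argument of \<open>f(x h)\<close>, with constant
coefficients because of invariance.\<close>

lemma left_ext_smooth:
  assumes v: "v \<in> tangent_space A g"
  shows "smooth_vector_field A UNIV (left_ext g v)"
  unfolding smooth_vector_field_def
proof (intro conjI ballI allI impI)
  let ?w = "push_vec A (m (i g)) g v"
  have w: "?w \<in> tangent_space A e" using push_translate[OF v, of "i g"] by simp
  fix x show "left_ext g v x \<in> tangent_space A x"
    using push_translate[OF w, of x] by (simp add: left_ext_def)
next
  let ?w = "push_vec A (m (i g)) g v"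
  have w: "?w \<in> tangent_space A e" using push_translate[OF v, of "i g"] by simp
  fix V f assume "open V \<and> V \<subseteq> UNIV \<and> smooth_fun A V f"
  then have V: "open V" and f: "smooth_fun A V f" by auto
  have "smooth_fun A {x. (x, e) \<in> {z. m (fst z) (snd z) \<in> V}} (\<lambda>x. \<xi> b (\<lambda>h. f (m x h)))" for b
    using \<xi>_smooth(1)[OF m_open[OF V] m_smooth[OF V f]] by simp
  then have "smooth_fun A V (\<lambda>x. \<xi> b (\<lambda>h. f (m x h)))" for b by simp
  then have s: "smooth_fun A V (\<lambda>x. \<Sum>b\<in>E. ?w (y b) * \<xi> b (\<lambda>h. f (m x h)))"
    by (intro smooth_fun_sum[OF charts V] smooth_fun_mult[OF charts V] smooth_fun_const)
  show "smooth_fun A V (\<lambda>x. left_ext g v x f)"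
  proof (rule smooth_fun_cong_imp[OF charts V _ s])
    fix x assume "x \<in> V"
    then have sx: "smooth_at A x f" by (rule smooth_fun_imp_at[OF f V])
    then have "smooth_at A e (\<lambda>h. f (m x h))" using smooth_translate[of x e f] by simp
    from tangent_expand[OF w this] sx
    show "(\<Sum>b\<in>E. ?w (y b) * \<xi> b (\<lambda>h. f (m x h))) = left_ext g v x f"
      by (simp add: left_ext_def push_vec_def[of A "m x"] o_def)
  qed
qed

text \<open>Writing \<open>k g h = g c(k) h\<close>, with \<open>c\<close> the conjugation by the inverse of \<open>g\<close>, turns the derivative in
\<open>k\<close> along \<open>\<xi>\<^sub>b\<close> into the derivative of \<open>f(g k h)\<close> along the vector \<open>c\<^sub>*\<xi>\<^sub>b\<close>. This vector has constant
coefficients in the frame \<open>\<xi>\<close>, which reduces both claims to a function of two points near \<open>e\<close>.\<close>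

lemma two_sided_derivatives:
  assumes f: "smooth_at A g f"
  shows "smooth_at A e (\<lambda>h. \<xi> b (\<lambda>k. f (m (m k g) h)))" (is ?A)
    and "\<xi> a (\<lambda>h. \<xi> b (\<lambda>k. f (m (m k g) h))) = \<xi> b (\<lambda>k. \<xi> a (\<lambda>h. f (m (m k g) h)))" (is ?B)
proof -
  interpret opp: lie_frame A E U \<phi> e "\<lambda>x y. m y x" i by (rule opposite)
  have f': "smooth_at A e (\<lambda>x. f (m g x))" using smooth_translate[of g e f] f by simp
  obtain W' where W': "open W'" "e \<in> W'" "smooth_fun A W' (\<lambda>x. f (m g x))"
    using f' unfolding smooth_at_def by blast
  define W where "W = {z. m (fst z) (snd z) \<in> W'}"
  define F where "F = (\<lambda>z. f (m g (m (fst z) (snd z))))"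
  have W: "open W" "(e, e) \<in> W" unfolding W_def using m_open[OF W'(1)] W'(2) by auto
  have F: "smooth_fun AA W F" unfolding W_def F_def by (rule m_smooth[OF W'(1,3)])
  \<comment> \<open>conjugation, which fixes \<open>e\<close>\<close>
  define c where "c = (\<lambda>k. m (i g) (m k g))"
  have c_e: "c e = e" by (simp add: c_def)
  have fF: "f (m (m k g) h) = F (c k, h)" for k h by (simp add: F_def c_def assoc)
  have c_smooth: "smooth_at A e (q \<circ> c)" if "smooth_at A (c e) q" for q
  proof -
    have "smooth_at A g (\<lambda>x. q (m (i g) x))"
      by (rule smooth_translate) (use that c_e in simp)
    then have "smooth_at A (m e g) (\<lambda>x. q (m (i g) x))" by simp
    then have "smooth_at A e (\<lambda>x. q (m (i g) (m x g)))" by (rule opp.smooth_translate)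
    then show ?thesis by (simp add: c_def o_def)
  qed
  define w where "w = push_vec A c e (\<xi> b)"
  have w: "w \<in> tangent_space A e"
    using push_vec_tangent[OF charts \<xi>_tangent c_smooth, of b] by (simp add: w_def c_e)
  have w_apply: "w q = \<xi> b (\<lambda>k. q (c k))" if "smooth_at A e q" for q
    using that by (simp add: w_def push_vec_def c_e o_def)
  have exp: "\<xi> b (\<lambda>k. f (m (m k g) h)) = (\<Sum>d\<in>E. w (y d) * \<xi> d (\<lambda>k. F (k, h)))" if "(e, h) \<in> W" for h
  proof -
    have s: "smooth_at A e (\<lambda>k. F (k, h))" by (rule smooth_at_slice(2)[OF W(1) F that])
    show ?thesis using tangent_expand[OF w s] w_apply[OF s] by (simp add: fF)
  qed
  have ev: "\<forall>\<^sub>F h in nhds e. \<xi> b (\<lambda>k. f (m (m k g) h)) = (\<Sum>d\<in>E. w (y d) * \<xi> d (\<lambda>k. F (k, h)))"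
    unfolding eventually_nhds using open_slices(2)[OF W(1), of e] W(2) exp
    by (intro exI[of _ "{h. (e, h) \<in> W}"]) auto
  have s1: "smooth_at A e (\<lambda>h. \<xi> d (\<lambda>k. F (k, h)))" for d
    using smooth_fun_imp_at[OF \<xi>_smooth(2)[OF W(1) F] open_slices(2)[OF W(1)]] W(2) by blast
  have s2: "smooth_at A e (\<lambda>k. \<xi> d (\<lambda>h. F (k, h)))" for d
    using smooth_fun_imp_at[OF \<xi>_smooth(1)[OF W(1) F] open_slices(1)[OF W(1)]] W(2) by blast
  have s3: "smooth_at A e (\<lambda>h. w (y d) * \<xi> d (\<lambda>k. F (k, h)))" for d
    by (rule smooth_at_mult[OF charts smooth_at_const s1])
  show ?A unfolding smooth_at_cong_ev[OF ev] by (rule smooth_at_sum[OF charts s3])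
  have "\<xi> a (\<lambda>h. \<xi> b (\<lambda>k. f (m (m k g) h))) = \<xi> a (\<lambda>h. \<Sum>d\<in>E. w (y d) * \<xi> d (\<lambda>k. F (k, h)))"
    by (rule tangent_cong_ev[OF \<xi>_tangent ev])
  also have "\<dots> = (\<Sum>d\<in>E. w (y d) * \<xi> a (\<lambda>h. \<xi> d (\<lambda>k. F (k, h))))"
    by (simp add: tangent_sum[OF charts \<xi>_tangent s3] tangent_cmult[OF charts \<xi>_tangent s1])
  also have "\<dots> = (\<Sum>d\<in>E. w (y d) * \<xi> d (\<lambda>k. \<xi> a (\<lambda>h. F (k, h))))"
    by (simp add: \<xi>_commute[OF W(1) F W(2)])
  also have "\<dots> = \<xi> b (\<lambda>k. \<xi> a (\<lambda>h. F (c k, h)))"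
    using tangent_expand[OF w s2] w_apply[OF s2] by simp
  finally show ?B by (simp add: fF)
qed

end

section \<open>Brackets on Poisson-Lie groups\<close>

locale poisson_lie_frame = lie_frame A E U \<phi> e m i
  for A :: "('g::{t2_space,second_countable_topology}, 'e::{real_inner,banach}) chart set"
    and E U \<phi> e m i +
  fixes P :: "'g \<Rightarrow> 'g bivec"
  assumes biv: "bivector_field A P" and mult: "multiplicative A m P"
begin

lemma opposite_poisson: "poisson_lie_frame A E U \<phi> e (\<lambda>x y. m y x) i P"
proof (intro poisson_lie_frame.intro poisson_lie_frame_axioms.intro opposite biv)
  show "multiplicative A (\<lambda>x y. m y x) P"
    using mult unfolding multiplicative_def by (simp add: add.commute)
qed

abbreviation "br \<equiv> bivector_apply A P"
abbreviation "d \<equiv> differential A"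

lemma P_linear:
  assumes "\<alpha> \<in> cotangent_space A p" "\<beta> \<in> cotangent_space A p" "\<gamma> \<in> cotangent_space A p"
  shows "P p (fscale a \<alpha> + fscale b \<beta>) \<gamma> = a * P p \<alpha> \<gamma> + b * P p \<beta> \<gamma>"
    "P p \<gamma> (fscale a \<alpha> + fscale b \<beta>) = a * P p \<gamma> \<alpha> + b * P p \<gamma> \<beta>"
  using biv assms unfolding bivector_field_def bivector_def by blast+

lemma P_alt: "\<alpha> \<in> cotangent_space A p \<Longrightarrow> P p \<alpha> \<alpha> = 0"
  using biv unfolding bivector_field_def bivector_def by blast

lemma br_antisym: "br f h p = - br h f p"
proof -
  let ?a = "d p f" and ?b = "d p h"
  have c: "?a \<in> cotangent_space A p" "?b \<in> cotangent_space A p" by (rule differential_cotangent)+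
  have s: "fscale 1 ?a + fscale 1 ?b \<in> cotangent_space A p"
    using c subspace_cotangent_space[of A p] by (simp add: fun_vs.subspace_def)
  have "0 = P p (fscale 1 ?a + fscale 1 ?b) (fscale 1 ?a + fscale 1 ?b)" using P_alt[OF s] by simp
  also have "\<dots> = 1 * P p ?a (fscale 1 ?a + fscale 1 ?b) + 1 * P p ?b (fscale 1 ?a + fscale 1 ?b)"
    by (rule P_linear(1)[OF c s])
  also have "\<dots> = P p ?a ?b + P p ?b ?a"
    unfolding P_linear(2)[OF c c(1)] P_linear(2)[OF c c(2)] P_alt[OF c(1)] P_alt[OF c(2)] by simp
  finally show ?thesis by (simp add: bivector_apply_def)
qed

lemma br_eq: 
  assumes "\<And>v. v \<in> tangent_space A p \<Longrightarrow> v f = v f'"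
  shows "br f h p = br f' h p"
proof -
  have "d p f = d p f'" by (rule differential_cong) (rule assms)
  then show ?thesis by (simp add: bivector_apply_def)
qed

lemma br_cong_ev:
  assumes "\<forall>\<^sub>F x in nhds p. f x = f' x"
  shows "br f h p = br f' h p"
  by (rule br_eq) (rule tangent_cong_ev[OF _ assms])

lemma br_linear:
  assumes "smooth_at A p f" "smooth_at A p f'"
  shows "br (\<lambda>x. a * f x + b * f' x) h p = a * br f h p + b * br f' h p"
  unfolding bivector_apply_def differential_linear[OF assms]
  by (rule P_linear(1)) (rule differential_cotangent)+

lemma br_mult:
  assumes "smooth_at A p f" "smooth_at A p f'"
  shows "br (\<lambda>x. f x * f' x) h p = f' p * br f h p + f p * br f' h p"
  unfolding bivector_apply_def differential_mult[OF assms]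
  by (rule P_linear(1)) (rule differential_cotangent)+

lemma br_zero: "br (\<lambda>x. 0) h p = 0"
  using br_linear[of p "\<lambda>x. 0" "\<lambda>x. 0" 0 0 h, OF smooth_at_const smooth_at_const] by simp

lemma br_const: "br (\<lambda>x. c) h p = 0"
proof -
  have "br (\<lambda>x. c) h p = br (\<lambda>x. 0) h p" by (rule br_eq) (simp only: tangent_const[OF charts])
  then show ?thesis by (simp only: br_zero)
qed

lemma br_add: "smooth_at A p f \<Longrightarrow> smooth_at A p f' \<Longrightarrow> br (\<lambda>x. f x + f' x) h p = br f h p + br f' h p"
  using br_linear[of p f f' 1 1] by simp

lemma br_cmult: "smooth_at A p f \<Longrightarrow> br (\<lambda>x. c * f x) h p = c * br f h p"
  using br_linear[of p f f c 0] by simp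

lemma br_sum:
  "(\<And>j. j \<in> J \<Longrightarrow> smooth_at A p (f j)) \<Longrightarrow> br (\<lambda>x. \<Sum>j\<in>J. f j x) h p = (\<Sum>j\<in>J. br (f j) h p)"
  by (induction J rule: infinite_finite_induct) (auto simp: br_zero br_add smooth_at_sum[OF charts])

lemma br_smooth:
  assumes "smooth_at A p f" "smooth_at A p h"
  shows "smooth_at A p (br f h)"
proof -
  obtain W where W: "open W" "p \<in> W" "smooth_fun A W f" "smooth_fun A W h"
    by (rule smooth_at_common[OF assms])
  then have "smooth_fun A W (br f h)" using biv unfolding bivector_field_def by blast
  then show ?thesis by (rule smooth_fun_imp_at[OF _ W(1,2)])
qed

text \<open>\<open>F\<close> and its linear approximation in the translated coordinates have the same differential at \<open>g\<close>.\<close>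

lemma br_expand:
  assumes F: "smooth_at A g F"
  shows "br F h g = (\<Sum>b\<in>E. left_frame g b F * br (left_coord g b) h g)"
    and "br h F g = (\<Sum>b\<in>E. left_frame g b F * br h (left_coord g b) g)"
proof -
  have s: "smooth_at A g (\<lambda>x. left_frame g b F * left_coord g b x)" for b
    by (rule smooth_at_mult[OF charts smooth_at_const smooth_left_coord])
  have "br F h g = br (\<lambda>x. \<Sum>b\<in>E. left_frame g b F * left_coord g b x) h g"
  proof (rule br_eq)
    fix v assume v: "v \<in> tangent_space A g"
    show "v F = v (\<lambda>x. \<Sum>b\<in>E. left_frame g b F * left_coord g b x)"
      unfolding tangent_sum[OF charts v s] tangent_cmult[OF charts v smooth_left_coord] tangent_expand_at[OF v F]
      by (simp only: mult.commute)
  qed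
  also have "\<dots> = (\<Sum>b\<in>E. left_frame g b F * br (left_coord g b) h g)"
    by (simp add: br_sum[OF s] br_cmult[OF smooth_left_coord])
  finally show 1: "br F h g = (\<Sum>b\<in>E. left_frame g b F * br (left_coord g b) h g)" .
  show "br h F g = (\<Sum>b\<in>E. left_frame g b F * br h (left_coord g b) g)"
    unfolding br_antisym[of h] 1 by (simp add: sum_negf)
qed

lemma br_multiplicative:
  assumes f: "smooth_at A (m g h) f" "smooth_at A (m g h) f'"
  shows "br f f' (m g h) = br (\<lambda>x. f (m g x)) (\<lambda>x. f' (m g x)) h + br (\<lambda>x. f (m x h)) (\<lambda>x. f' (m x h)) g"
proof -
  interpret opp: lie_frame A E U \<phi> e "\<lambda>x y. m y x" i by (rule opposite)
  have l: "pull_covec A (\<lambda>x. m g x) h (d (m g h) q) = d h (\<lambda>x. q (m g x))" if "smooth_at A (m g h) q" for q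
    using pull_covec_differential[of "\<lambda>x. m g x" h q] smooth_translate that by (simp add: o_def)
  have r: "pull_covec A (\<lambda>x. m x h) g (d (m g h) q) = d g (\<lambda>x. q (m x h))" if "smooth_at A (m g h) q" for q
    using pull_covec_differential[of "\<lambda>x. m x h" g q] opp.smooth_translate that by (simp add: o_def)
  have "P (m g h) (d (m g h) f) (d (m g h) f') =
      push_bivec A (\<lambda>x. m g x) h (P h) (d (m g h) f) (d (m g h) f') +
      push_bivec A (\<lambda>x. m x h) g (P g) (d (m g h) f) (d (m g h) f')"
    using mult differential_cotangent unfolding multiplicative_def by blast
  then show ?thesis by (simp add: bivector_apply_def push_bivec_def l f r)
qed

text \<open>At \<open>g = h = e\<close> multiplicativity reads \<open>P(e) = P(e) + P(e)\<close>.\<close>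

lemma br_e: "smooth_at A e f \<Longrightarrow> smooth_at A e h \<Longrightarrow> br f h e = 0"
  using br_multiplicative[of e e f h] by simp

section \<open>The dual Lie algebra and its modular vector\<close>

text \<open>By Hadamard's lemma \<open>f\<close> is, up to a constant, a sum of products of functions vanishing at \<open>e\<close>, as
\<open>d\<^sub>e f = 0\<close>. Since brackets vanish at \<open>e\<close> as well, the Leibniz rule makes \<open>{f, h}\<close> vanish to
second order there.\<close>

lemma tangent_br_zero:
  assumes f: "smooth_at A e f" and h: "smooth_at A e h" and v: "v \<in> tangent_space A e"
    and z: "\<And>b. \<xi> b f = 0"
  shows "v (br f h) = 0"
proof -
  obtain G W where G: "\<forall>b. smooth_at A e (G b)" "\<forall>b. G b e = \<xi> b f" and W: "open W" "e \<in> W"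
    and eq: "\<forall>x\<in>W. f x = f e + (\<Sum>b\<in>E. y b x * G b x)"
    using hadamard_at[OF f] by metis
  let ?R = "\<lambda>x. \<Sum>b\<in>E. G b x * br (y b) h x + y b x * br (G b) h x"
  have ev1: "\<forall>\<^sub>F x in nhds e. \<forall>b\<in>E. smooth_at A x (G b)"
    using G(1) finite_E by (auto intro!: eventually_ball_finite smooth_at_eventually)
  have ev2: "\<forall>\<^sub>F x in nhds e. \<forall>b\<in>E. smooth_at A x (y b)"
    using finite_E by (auto intro!: eventually_ball_finite smooth_at_eventually smooth_coord)
  have "\<forall>\<^sub>F x in nhds e. f x = f e + (\<Sum>b\<in>E. y b x * G b x)"
    using W eq unfolding eventually_nhds by blast
  then have ev3: "\<forall>\<^sub>F x in nhds e. \<forall>\<^sub>F x' in nhds x. f x' = f e + (\<Sum>b\<in>E. y b x' * G b x')"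
    by (simp add: eventually_eventually)
  have ev: "\<forall>\<^sub>F x in nhds e. br f h x = ?R x"
    using ev1 ev2 ev3
  proof eventually_elim
    case (elim x)
    have s: "smooth_at A x (\<lambda>x. y b x * G b x)" if "b \<in> E" for b
      using elim that by (intro smooth_at_mult[OF charts]) auto
    have "br f h x = br (\<lambda>x. f e + (\<Sum>b\<in>E. y b x * G b x)) h x" by (rule br_cong_ev[OF elim(3)])
    also have "\<dots> = br (\<lambda>x. f e) h x + br (\<lambda>x. \<Sum>b\<in>E. y b x * G b x) h x"
      by (rule br_add[OF smooth_at_const smooth_at_sum[OF charts s]])
    also have "\<dots> = (\<Sum>b\<in>E. br (\<lambda>x. y b x * G b x) h x)" by (simp add: br_const br_sum[OF s])
    also have "\<dots> = ?R x" using elim by (intro sum.cong br_mult) auto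
    finally show ?case .
  qed
  have sb: "smooth_at A e (br (y b) h)" "smooth_at A e (br (G b) h)" for b
    using br_smooth[OF smooth_coord h] br_smooth[OF _ h] G(1) by auto
  have s1: "smooth_at A e (\<lambda>x. G b x * br (y b) h x)" "smooth_at A e (\<lambda>x. y b x * br (G b) h x)" for b
    using G(1) sb by (auto intro!: smooth_at_mult[OF charts] smooth_coord)
  have "v (br f h) = v ?R" by (rule tangent_cong_ev[OF v ev])
  also have "\<dots> = (\<Sum>b\<in>E. v (\<lambda>x. G b x * br (y b) h x) + v (\<lambda>x. y b x * br (G b) h x))"
    by (simp add: tangent_sum[OF charts v smooth_at_add[OF charts s1]] tangent_add[OF charts v s1])
  also have "\<dots> = 0"
    using G z h by (simp add: tangent_mult[OF charts v] sb smooth_coord coord_e br_e)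
  finally show ?thesis .
qed

lemma br_linear_ev:
  assumes "smooth_at A p f" "smooth_at A p f'"
  shows "\<forall>\<^sub>F x in nhds p. br (\<lambda>x. a * f x + b * f' x) h x = a * br f h x + b * br f' h x"
  using smooth_at_eventually[OF assms(1)] smooth_at_eventually[OF assms(2)]
  by eventually_elim (rule br_linear)

lemma tangent_br_antisym:
  assumes "smooth_at A p f" "smooth_at A p h" and v: "v \<in> tangent_space A p"
  shows "v (br f h) = - v (br h f)"
proof -
  have "br f h = (\<lambda>x. (-1) * br h f x)" using br_antisym[of f h] by auto
  then show ?thesis using tangent_cmult[OF charts v br_smooth[OF assms(2,1)], of "-1"] by simp
qed

lemma tangent_br_linear:
  assumes "smooth_at A p f" "smooth_at A p f'" "smooth_at A p h" and v: "v \<in> tangent_space A p"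
  shows "v (br (\<lambda>x. a * f x + b * f' x) h) = a * v (br f h) + b * v (br f' h)"
    and "v (br h (\<lambda>x. a * f x + b * f' x)) = a * v (br h f) + b * v (br h f')"
proof -
  show 1: "v (br (\<lambda>x. a * f x + b * f' x) h) = a * v (br f h) + b * v (br f' h)"
    using tangent_cong_ev[OF v br_linear_ev[OF assms(1,2)]]
      tangent_linear[OF charts v br_smooth[OF assms(1,3)] br_smooth[OF assms(2,3)]] by simp
  have "smooth_at A p (\<lambda>x. a * f x + b * f' x)"
    using assms by (intro smooth_at_add[OF charts] smooth_at_mult[OF charts] smooth_at_const) auto
  from tangent_br_antisym[OF assms(3) this v]
  show "v (br h (\<lambda>x. a * f x + b * f' x)) = a * v (br h f) + b * v (br h f')"
    using 1 tangent_br_antisym[OF assms(3,1) v] tangent_br_antisym[OF assms(3,2) v] by simp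
qed

text \<open>Hence the value used in the definition of the intrinsic derivative does not depend on the functions that
represent the two covectors.\<close>

lemma tangent_br_cong:
  assumes s: "smooth_at A e f" "smooth_at A e f'" "smooth_at A e h" "smooth_at A e h'"
    and v: "v \<in> tangent_space A e" and eq: "d e f = d e f'" "d e h = d e h'"
  shows "v (br f h) = v (br f' h')"
proof -
  have dv: "w q = w q'" if "d e q = d e q'" "w \<in> tangent_space A e" for q q' w
    using fun_cong[OF that(1), of w] that(2) by (simp add: differential_def)
  have diff: "smooth_at A e (\<lambda>x. 1 * q x + (-1) * q' x)" if "smooth_at A e q" "smooth_at A e q'" for q q'
    using that by (intro smooth_at_add[OF charts] smooth_at_mult[OF charts] smooth_at_const) auto
  have z: "\<xi> b (\<lambda>x. 1 * q x + (-1) * q' x) = 0"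
    if "smooth_at A e q" "smooth_at A e q'" "d e q = d e q'" for q q' b
    using tangent_linear[OF charts \<xi>_tangent that(1,2), of b 1 "-1"] dv[OF that(3) \<xi>_tangent, of b] by simp
  have 1: "v (br f h) = v (br f' h)"
    using tangent_br_zero[OF diff[OF s(1,2)] s(3) v z[OF s(1,2) eq(1)]] tangent_br_linear(1)[OF s(1,2,3) v, of 1 "-1"] by simp
  have "v (br h f') = v (br h' f')"
    using tangent_br_zero[OF diff[OF s(3,4)] s(2) v z[OF s(3,4) eq(2)]] tangent_br_linear(1)[OF s(3,4,2) v, of 1 "-1"] by simp
  then show ?thesis using 1 tangent_br_antisym[OF s(2,3) v] tangent_br_antisym[OF s(2,4) v] by simp
qed

lemma intrinsic_derivative_eq:
  assumes s: "smooth_at A e f" "smooth_at A e h" and v: "v \<in> tangent_space A e"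
  shows "intrinsic_derivative A e P v (d e f) (d e h) = v (br f h)"
  unfolding intrinsic_derivative_def
proof (rule the_equality)
  show "\<forall>f' h'. smooth_at A e f' \<and> smooth_at A e h' \<and> d e f' = d e f \<and> d e h' = d e h \<longrightarrow> v (br f h) = v (br f' h')"
    by (intro allI impI, elim conjE, rule tangent_br_cong[OF s(1) _ s(2) _ v]) simp_all
qed (use s in blast)

lemma covector_is_differential:
  assumes \<alpha>: "\<alpha> \<in> cotangent_space A e"
  shows "smooth_at A e (\<lambda>x. \<Sum>b\<in>E. \<alpha> (\<xi> b) * y b x)" "\<alpha> = d e (\<lambda>x. \<Sum>b\<in>E. \<alpha> (\<xi> b) * y b x)"
proof -
  have s: "smooth_at A e (\<lambda>x. \<alpha> (\<xi> b) * y b x)" for b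
    by (intro smooth_at_mult[OF charts] smooth_at_const smooth_coord)
  show "smooth_at A e (\<lambda>x. \<Sum>b\<in>E. \<alpha> (\<xi> b) * y b x)" by (rule smooth_at_sum[OF charts s])
  have lin: "linear_functional_on (tangent_space A e) \<alpha>"
    using \<alpha> unfolding cotangent_space_def linear_functional_on_def by blast
  show "\<alpha> = d e (\<lambda>x. \<Sum>b\<in>E. \<alpha> (\<xi> b) * y b x)"
  proof
    fix v
    show "\<alpha> v = d e (\<lambda>x. \<Sum>b\<in>E. \<alpha> (\<xi> b) * y b x) v"
    proof (cases "v \<in> tangent_space A e")
      case True
      have "\<alpha> v = \<alpha> (\<Sum>b\<in>E. fscale (v (y b)) (\<xi> b))" using frame_onD(4)[OF tangent_frame True] by simp
      also have "\<dots> = (\<Sum>b\<in>E. v (y b) * \<alpha> (\<xi> b))"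
        by (rule linear_functional_on_sum[OF subspace_tangent_space lin \<xi>_tangent])
      also have "\<dots> = d e (\<lambda>x. \<Sum>b\<in>E. \<alpha> (\<xi> b) * y b x) v"
        unfolding differential_def if_P[OF True] tangent_sum[OF charts True s]
          tangent_cmult[OF charts True smooth_coord] by (simp only: mult.commute)
      finally show ?thesis .
    next
      case False
      then show ?thesis using \<alpha> by (simp add: cotangent_space_def differential_def)
    qed
  qed
qed

lemma cotangent_frame: "frame_on (cotangent_space A e) E (\<lambda>b. d e (y b)) (\<lambda>b \<alpha>. \<alpha> (\<xi> b))"
  unfolding frame_on_def linear_functional_on_def
proof (intro conjI ballI)
  fix \<alpha> assume \<alpha>: "\<alpha> \<in> cotangent_space A e"
  have s: "smooth_at A e (\<lambda>x. \<alpha> (\<xi> b) * y b x)" for b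
    by (intro smooth_at_mult[OF charts] smooth_at_const smooth_coord)
  have "d e (\<lambda>x. \<Sum>b\<in>E. \<alpha> (\<xi> b) * y b x) = (\<Sum>b\<in>E. fscale (\<alpha> (\<xi> b)) (d e (y b)))"
  proof
    fix v
    show "d e (\<lambda>x. \<Sum>b\<in>E. \<alpha> (\<xi> b) * y b x) v = (\<Sum>b\<in>E. fscale (\<alpha> (\<xi> b)) (d e (y b))) v"
      by (cases "v \<in> tangent_space A e")
        (simp_all add: differential_def sum_fun_apply tangent_sum[OF charts _ s, of v]
          tangent_cmult[OF charts _ smooth_coord, of v])
  qed
  then show "\<alpha> = (\<Sum>b\<in>E. fscale (\<alpha> (\<xi> b)) (d e (y b)))"
    using covector_is_differential(2)[OF \<alpha>] by simp
qed (auto simp: finite_E differential_cotangent)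

lemma dual_bracket_eq:
  assumes "smooth_at A e f" "smooth_at A e h"
  shows "dual_bracket A e P (d e f) (d e h) = d e (br f h)"
  unfolding dual_bracket_def differential_def[of A e "br f h"] using intrinsic_derivative_eq[OF assms] by auto

lemma dual_bracket_linear:
  assumes f: "smooth_at A e f"
  shows "linear_endo_on (cotangent_space A e) (dual_bracket A e P (d e f))"
  unfolding linear_endo_on_def
proof (intro conjI ballI allI)
  show "dual_bracket A e P (d e f) ` cotangent_space A e \<subseteq> cotangent_space A e"
  proof
    fix \<gamma> assume "\<gamma> \<in> dual_bracket A e P (d e f) ` cotangent_space A e"
    then obtain \<alpha> where \<alpha>: "\<alpha> \<in> cotangent_space A e" "\<gamma> = dual_bracket A e P (d e f) \<alpha>" by blast
    obtain h where "smooth_at A e h" "\<alpha> = d e h" using covector_is_differential[OF \<alpha>(1)] by blast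
    then show "\<gamma> \<in> cotangent_space A e" using \<alpha>(2) dual_bracket_eq[OF f] differential_cotangent by simp
  qed
  fix \<alpha> \<beta> and a b :: real assume \<alpha>: "\<alpha> \<in> cotangent_space A e" and \<beta>: "\<beta> \<in> cotangent_space A e"
  obtain h where h: "smooth_at A e h" "\<alpha> = d e h" using covector_is_differential[OF \<alpha>] by blast
  obtain q where q: "smooth_at A e q" "\<beta> = d e q" using covector_is_differential[OF \<beta>] by blast
  have s: "smooth_at A e (\<lambda>x. a * h x + b * q x)"
    using h q by (intro smooth_at_add[OF charts] smooth_at_mult[OF charts] smooth_at_const) auto
  show "dual_bracket A e P (d e f) (fscale a \<alpha> + fscale b \<beta>) =
      fscale a (dual_bracket A e P (d e f) \<alpha>) + fscale b (dual_bracket A e P (d e f) \<beta>)"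
    unfolding h(2) q(2) differential_linear[OF h(1) q(1), symmetric] dual_bracket_eq[OF f s]
      dual_bracket_eq[OF f h(1)] dual_bracket_eq[OF f q(1)]
    by (auto simp: fun_eq_iff differential_def tangent_br_linear(2)[OF h(1) q(1) f])
qed

lemma dual_modular_character_eq:
  assumes f: "smooth_at A e f"
  shows "dual_modular_character A e P (d e f) = (\<Sum>b\<in>E. \<xi> b (br f (y b)))"
  unfolding dual_modular_character_def
    trace_on_frame[OF subspace_cotangent_space cotangent_frame dual_bracket_linear[OF f]]
    dual_bracket_eq[OF f smooth_coord]
  by (simp add: differential_def \<xi>_tangent)

text \<open>The map \<open>f \<mapsto> tr ad(d\<^sub>e f)\<close> satisfies the Leibniz rule because brackets vanish at \<open>e\<close>, so it is
itself a tangent vector, and it pairs with every covector as the modular character does.\<close>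

lemma modular_vector:
  defines "M \<equiv> (\<lambda>f. if smooth_at A e f then (\<Sum>b\<in>E. \<xi> b (br f (y b))) else 0)"
  shows "M \<in> tangent_space A e" and "dual_modular_vector A e P = M"
proof -
  show M: "M \<in> tangent_space A e"
    unfolding tangent_space_def mem_Collect_eq
  proof (intro conjI allI impI)
    fix f h a b assume f: "smooth_at A e f \<and> smooth_at A e h"
    have *: "smooth_at A e (\<lambda>x. a * f x + b * h x)"
      using f by (intro smooth_at_add[OF charts] smooth_at_mult[OF charts] smooth_at_const) auto
    show "M (\<lambda>x. a * f x + b * h x) = a * M f + b * M h"
      using f * by (simp add: M_def tangent_br_linear(1)[OF _ _ smooth_coord \<xi>_tangent] sum.distrib sum_distrib_left)
  next
    fix f h assume f: "smooth_at A e f \<and> smooth_at A e h"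
    then have f1: "smooth_at A e f" and h1: "smooth_at A e h" by auto
    have *: "smooth_at A e (\<lambda>x. f x * h x)"
      using f by (intro smooth_at_mult[OF charts]) auto
    have "\<xi> b (br (\<lambda>x. f x * h x) (y b)) = \<xi> b (br f (y b)) * h e + f e * \<xi> b (br h (y b))" for b
    proof -
      have ev: "\<forall>\<^sub>F x in nhds e. br (\<lambda>x. f x * h x) (y b) x = h x * br f (y b) x + f x * br h (y b) x"
        using smooth_at_eventually[OF f1] smooth_at_eventually[OF h1] by eventually_elim (rule br_mult)
      note s = br_smooth[OF f1 smooth_coord[of b]] br_smooth[OF h1 smooth_coord[of b]]
      have "\<xi> b (br (\<lambda>x. f x * h x) (y b)) = \<xi> b (\<lambda>x. h x * br f (y b) x + f x * br h (y b) x)"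
        by (rule tangent_cong_ev[OF \<xi>_tangent ev])
      also have "\<dots> = \<xi> b (\<lambda>x. h x * br f (y b) x) + \<xi> b (\<lambda>x. f x * br h (y b) x)"
        by (rule tangent_add[OF charts \<xi>_tangent smooth_at_mult[OF charts h1 s(1)] smooth_at_mult[OF charts f1 s(2)]])
      also have "\<dots> = \<xi> b (br f (y b)) * h e + f e * \<xi> b (br h (y b))"
        by (simp add: tangent_mult[OF charts \<xi>_tangent h1 s(1)] tangent_mult[OF charts \<xi>_tangent f1 s(2)]
            br_e f1 h1 smooth_coord)
      finally show ?thesis .
    qed
    then show "M (\<lambda>x. f x * h x) = M f * h e + f e * M h"
      using f * by (simp add: M_def sum.distrib sum_distrib_left sum_distrib_right)
  qed (simp add: M_def)
  show "dual_modular_vector A e P = M"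
    unfolding dual_modular_vector_def
  proof (rule the_equality)
    have "\<alpha> M = dual_modular_character A e P \<alpha>" if \<alpha>: "\<alpha> \<in> cotangent_space A e" for \<alpha>
    proof -
      obtain h where h: "smooth_at A e h" "\<alpha> = d e h" using covector_is_differential[OF \<alpha>] by blast
      show ?thesis unfolding h(2) dual_modular_character_eq[OF h(1)] using M h(1)
        by (simp add: differential_def M_def)
    qed
    then show "M \<in> tangent_space A e \<and> (\<forall>\<alpha>\<in>cotangent_space A e. \<alpha> M = dual_modular_character A e P \<alpha>)"
      using M by blast
    fix w assume w: "w \<in> tangent_space A e \<and> (\<forall>\<alpha>\<in>cotangent_space A e. \<alpha> w = dual_modular_character A e P \<alpha>)"
    show "w = M"
    proof
      fix f
      show "w f = M f"
      proof (cases "smooth_at A e f")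
        case True
        have "d e f w = dual_modular_character A e P (d e f)" using w differential_cotangent by blast
        then have "d e f w = M f" using True by (simp only: dual_modular_character_eq[OF True] M_def if_True)
        then show ?thesis using w by (simp add: differential_def)
      next
        case False
        then show ?thesis using w tangent_nonsmooth[OF charts _ False] by (simp add: M_def)
      qed
    qed
  qed
qed

section \<open>The linearization of the Hamiltonian vector field\<close>

text \<open>Test the Lie derivative on the left-invariant extensions of vectors \<open>v\<^sub>j\<close> with
\<open>\<Phi>(v\<^sub>1, \<dots>, v\<^sub>n) \<noteq> 0\<close>. As \<open>X(g) = 0\<close>, the term differentiating \<open>\<Phi>\<close> vanishes and
\<open>[X, Y\<^sub>j](g) = - D v\<^sub>j\<close>. The sum is the trace of \<open>D\<close>, taken here in the left-translated frame.\<close>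

lemma linearization_trace_zero:
  assumes H: "smooth_fun A UNIV H" and X: "hamiltonian_vf A P H g = 0"
    and \<Phi>: "volume_form A \<Phi>" "preserves_form A (hamiltonian_vf A P H) \<Phi>"
  shows "(\<Sum>a\<in>E. \<xi> a (\<lambda>h. br H (\<lambda>x. y a (m (i g) x)) (m g h))) = 0"
proof -
  let ?T = "tangent_space A g"
  let ?n = "card E"
  have sH: "smooth_at A x H" for x by (rule smooth_fun_imp_at[OF H]) auto
  have ham: "hamiltonian_vf A P H x f = (if smooth_at A x f then br H f x else 0)" for x f
    by (simp add: hamiltonian_vf_def sharp_def bivector_apply_def)
  have brg: "br H f g = 0" if "smooth_at A g f" for f
    using ham[of g f] X that by simp
  define D :: "'g vec \<Rightarrow> 'g vec" where "D = (\<lambda>v f. if smooth_at A g f then v (br H f) else 0)"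
  have D_tangent: "D v \<in> ?T" if v: "v \<in> ?T" for v
    unfolding tangent_space_def mem_Collect_eq
  proof (intro conjI allI impI)
    fix f h a b assume f: "smooth_at A g f \<and> smooth_at A g h"
    have *: "smooth_at A g (\<lambda>x. a * f x + b * h x)"
      using f by (intro smooth_at_add[OF charts] smooth_at_mult[OF charts] smooth_at_const) auto
    show "D v (\<lambda>x. a * f x + b * h x) = a * D v f + b * D v h"
      using f * tangent_br_linear(2)[OF _ _ sH v] by (simp add: D_def)
  next
    fix f h assume "smooth_at A g f \<and> smooth_at A g h"
    then have f1: "smooth_at A g f" and h1: "smooth_at A g h" by auto
    have *: "smooth_at A g (\<lambda>x. f x * h x)" by (rule smooth_at_mult[OF charts f1 h1])
    have ev: "\<forall>\<^sub>F x in nhds g. br H (\<lambda>x. f x * h x) x = h x * br H f x + f x * br H h x"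
      using smooth_at_eventually[OF f1] smooth_at_eventually[OF h1]
    proof eventually_elim
      case (elim x)
      show ?case
        unfolding br_antisym[of H] br_mult[OF elim] by simp
    qed
    note s = br_smooth[OF sH f1] br_smooth[OF sH h1]
    have "v (br H (\<lambda>x. f x * h x)) = v (\<lambda>x. h x * br H f x + f x * br H h x)"
      by (rule tangent_cong_ev[OF v ev])
    also have "\<dots> = v (\<lambda>x. h x * br H f x) + v (\<lambda>x. f x * br H h x)"
      by (rule tangent_add[OF charts v smooth_at_mult[OF charts h1 s(1)] smooth_at_mult[OF charts f1 s(2)]])
    also have "\<dots> = h g * v (br H f) + f g * v (br H h)"
      by (simp add: tangent_mult[OF charts v h1 s(1)] tangent_mult[OF charts v f1 s(2)] brg f1 h1)
    finally show "D v (\<lambda>x. f x * h x) = D v f * h g + f g * D v h"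
      using f1 h1 * by (simp add: D_def)
  qed (simp add: D_def)
  have D: "linear_endo_on ?T D"
    unfolding linear_endo_on_def using D_tangent by (auto simp: D_def fun_eq_iff)
  have dim: "dim (UNIV :: 'e set) = ?n" by (rule card_orthonormal_basis[OF E])
  have alt: "alternating_form ?T ?n (\<Phi> g)"
    using \<Phi>(1) unfolding volume_form_def dim by (simp add: Let_def)
  obtain vs where vs: "length vs = ?n" "set vs \<subseteq> ?T" "\<Phi> g vs \<noteq> 0"
    using \<Phi>(1) unfolding volume_form_def dim Let_def by blast
  define Ys where "Ys = map (left_ext g) vs"
  have Ys: "length Ys = ?n" "\<forall>Y\<in>set Ys. smooth_vector_field A UNIV Y"
    using vs(1,2) left_ext_smooth by (auto simp: Ys_def)
  have Ys_g: "map (\<lambda>Y. Y g) Ys = vs"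
    using vs(2) left_ext_at by (auto simp: Ys_def intro!: map_idI)
  have lie: "lie_bracket A (hamiltonian_vf A P H) (Ys ! j) g = fscale (-1) (D (vs ! j))" if j: "j < ?n" for j
  proof
    fix f
    have v: "vs ! j \<in> ?T" using vs j by (metis nth_mem subsetD)
    have Yg: "(Ys ! j) g = vs ! j" using j vs(1) left_ext_at[OF v] by (simp add: Ys_def)
    show "lie_bracket A (hamiltonian_vf A P H) (Ys ! j) g f = fscale (-1) (D (vs ! j)) f"
    proof (cases "smooth_at A g f")
      case True
      have "\<forall>\<^sub>F x in nhds g. hamiltonian_vf A P H x f = br H f x"
        using smooth_at_eventually[OF True] by eventually_elim (simp add: ham)
      from tangent_cong_ev[OF v this] show ?thesis
        using True X by (simp add: lie_bracket_def Yg D_def)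
    qed (simp add: lie_bracket_def D_def)
  qed
  have lin: "linear_functional_on ?T (\<lambda>v. \<Phi> g (vs[j := v]))" if "j < ?n" for j
    by (rule alternating_form_linear[OF alt vs(1,2) that])
  have "lie_derivative A (hamiltonian_vf A P H) \<Phi> Ys g = 0"
    using \<Phi>(2) Ys unfolding preserves_form_def dim by blast
  then have "(\<Sum>j<?n. \<Phi> g (vs[j := fscale (-1) (D (vs ! j))])) = 0"
    using X Ys(1) by (simp add: lie_derivative_def Ys_g lie)
  moreover have "\<Phi> g (vs[j := fscale (-1) (D (vs ! j))]) = - \<Phi> g (vs[j := D (vs ! j)])" if j: "j < ?n" for j
  proof -
    have v: "D (vs ! j) \<in> ?T" using vs j D_tangent by (metis nth_mem subsetD)
    have "\<Phi> g (vs[j := fscale (-1) (D (vs ! j)) + fscale 0 (D (vs ! j))]) =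
        (-1) * \<Phi> g (vs[j := D (vs ! j)]) + 0 * \<Phi> g (vs[j := D (vs ! j)])"
      using lin[OF j] v unfolding linear_functional_on_def by blast
    then show ?thesis by simp
  qed
  ultimately have "(\<Sum>j<?n. \<Phi> g (vs[j := D (vs ! j)])) = 0"
    by (simp add: sum_negf)
  then have "trace_on ?T D * \<Phi> g vs = 0"
    using alternating_form_trace[OF subspace_tangent_space tangent_frame_at refl alt vs D] by simp
  then have "trace_on ?T D = 0" using vs(3) by simp
  then have "(\<Sum>a\<in>E. D (left_frame g a) (left_coord g a)) = 0"
    using trace_on_frame[OF subspace_tangent_space tangent_frame_at D] by simp
  moreover have "D (left_frame g a) (left_coord g a) = \<xi> a (\<lambda>h. br H (\<lambda>x. y a (m (i g) x)) (m g h))" for a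
    using smooth_left_coord left_frame_apply[OF br_smooth[OF sH smooth_left_coord]] by (simp add: D_def left_coord_def[symmetric])
  ultimately show ?thesis by simp
qed

text \<open>The left side is the \<open>a\<close>-th diagonal entry of the linearization in the left-translated frame. The first term
on the right is the part of \<open>{H, l\<^sub>a}\<close> contributed by \<open>P\<close> near \<open>e\<close>. The second comes from moving the
fixed bivector \<open>P(g)\<close> by right translations; expanding it in the right-translated frame is what
produces the two-sided derivative of \<open>H\<close>.\<close>

lemma linearization_split:
  assumes H: "smooth_fun A UNIV H" and X: "hamiltonian_vf A P H g = 0"
  shows "\<xi> a (\<lambda>h. br H (\<lambda>x. y a (m (i g) x)) (m g h)) =
    \<xi> a (br (\<lambda>x. H (m g x)) (y a)) +
    (\<Sum>b\<in>E. \<xi> a (\<lambda>h. \<xi> b (\<lambda>k. H (m (m k g) h))) * br (\<lambda>x. y b (m x (i g))) (\<lambda>x. y a (m (i g) x)) g)"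
proof -
  interpret opp: poisson_lie_frame A E U \<phi> e "\<lambda>x y. m y x" i P by (rule opposite_poisson)
  have sH: "smooth_at A x H" for x by (rule smooth_fun_imp_at[OF H]) auto
  have brg: "br H f g = 0" if "smooth_at A g f" for f
    using fun_cong[OF X, of f] that by (simp add: hamiltonian_vf_def sharp_def bivector_apply_def)
  let ?z = "left_coord g a"
  define u where "u = opp.left_coord g"
  define Q where "Q = (\<lambda>b c. br (u b) (u c) g)"
  define F where "F = (\<lambda>b h. \<xi> b (\<lambda>k. H (m (m k g) h)))"
  define C where "C = (\<lambda>c h. \<xi> c (\<lambda>k. ?z (m (m k g) h)))"
  have sz: "smooth_at A g ?z" by (rule smooth_left_coord)
  have su: "smooth_at A g (u b)" for b unfolding u_def by (rule opp.smooth_left_coord)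
  have sF: "smooth_at A e (F b)" for b unfolding F_def by (rule two_sided_derivatives(1)[OF sH])
  have sC: "smooth_at A e (C b)" for b unfolding C_def by (rule two_sided_derivatives(1)[OF sz])
  have Fe: "F b e = opp.left_frame g b H" and Ce: "C b e = opp.left_frame g b ?z" for b
    unfolding F_def C_def using opp.left_frame_apply[OF sH] opp.left_frame_apply[OF sz] by simp_all
  have ev0: "\<forall>\<^sub>F h in nhds e. smooth_at A (m g h) ?z"
    by (rule translate_eventually) (use smooth_at_eventually[OF sz] in simp)
  \<comment> \<open>multiplicativity, with the bracket at \<open>g\<close> expanded in the right-translated frame on both sides\<close>
  have ev: "\<forall>\<^sub>F h in nhds e. br H ?z (m g h) =
      br (\<lambda>x. H (m g x)) (y a) h + (\<Sum>b\<in>E. \<Sum>c\<in>E. F b h * (C c h * Q b c))"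
    using ev0
  proof eventually_elim
    case (elim h)
    let ?H = "\<lambda>x. H (m x h)" and ?Z = "\<lambda>x. ?z (m x h)"
    have s: "smooth_at A g ?H" "smooth_at A g ?Z"
      using opp.smooth_translate[of g h H] opp.smooth_translate[of g h ?z] sH elim by auto
    have "br ?H ?Z g = (\<Sum>b\<in>E. opp.left_frame g b ?H * (\<Sum>c\<in>E. opp.left_frame g c ?Z * br (opp.left_coord g b) (opp.left_coord g c) g))"
      unfolding opp.br_expand(1)[OF s(1), of ?Z] opp.br_expand(2)[OF s(2)] ..
    also have "\<dots> = (\<Sum>b\<in>E. \<Sum>c\<in>E. F b h * (C c h * Q b c))"
      by (simp add: opp.left_frame_apply[OF s(1)] opp.left_frame_apply[OF s(2)] F_def C_def Q_def u_def sum_distrib_left)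
    moreover have "(\<lambda>x. ?z (m g x)) = y a" by (simp add: left_coord_def)
    ultimately show ?case using br_multiplicative[OF sH elim] by simp
  qed
  have s1: "smooth_at A e (\<lambda>h. F b h * (C c h * Q b c))" "smooth_at A e (\<lambda>h. C c h * Q b c)" for b c
    by (intro smooth_at_mult[OF charts] sF sC smooth_at_const)+
  have s2: "smooth_at A e (br (\<lambda>x. H (m g x)) (y a))"
    by (intro br_smooth smooth_coord smooth_translate sH)
  have "\<xi> a (\<lambda>h. br H ?z (m g h)) = \<xi> a (\<lambda>h. br (\<lambda>x. H (m g x)) (y a) h + (\<Sum>b\<in>E. \<Sum>c\<in>E. F b h * (C c h * Q b c)))"
    by (rule tangent_cong_ev[OF \<xi>_tangent ev])
  also have "\<dots> = \<xi> a (br (\<lambda>x. H (m g x)) (y a)) + \<xi> a (\<lambda>h. \<Sum>b\<in>E. \<Sum>c\<in>E. F b h * (C c h * Q b c))"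
    by (rule tangent_add[OF charts \<xi>_tangent s2]) (intro smooth_at_sum[OF charts] s1)
  also have "\<xi> a (\<lambda>h. \<Sum>b\<in>E. \<Sum>c\<in>E. F b h * (C c h * Q b c)) =
      (\<Sum>b\<in>E. \<Sum>c\<in>E. \<xi> a (\<lambda>h. F b h * (C c h * Q b c)))"
    by (simp add: tangent_sum[OF charts \<xi>_tangent] smooth_at_sum[OF charts s1(1)] s1)
  also have "\<dots> = (\<Sum>b\<in>E. \<Sum>c\<in>E. \<xi> a (F b) * (C c e * Q b c) + F b e * (\<xi> a (C c) * Q b c))"
  proof (intro sum.cong refl)
    fix b c
    have "\<xi> a (\<lambda>h. C c h * Q b c) = \<xi> a (C c) * Q b c"
      using tangent_mult[OF charts \<xi>_tangent sC smooth_at_const, of a c "Q b c"]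
      by (simp add: tangent_const[OF charts \<xi>_tangent])
    then show "\<xi> a (\<lambda>h. F b h * (C c h * Q b c)) = \<xi> a (F b) * (C c e * Q b c) + F b e * (\<xi> a (C c) * Q b c)"
      using tangent_mult[OF charts \<xi>_tangent sF s1(2), of a b c b] by simp
  qed
  also have "\<dots> = (\<Sum>b\<in>E. \<xi> a (F b) * (\<Sum>c\<in>E. C c e * Q b c)) + (\<Sum>c\<in>E. \<xi> a (C c) * (\<Sum>b\<in>E. F b e * Q b c))"
  proof -
    have "(\<Sum>b\<in>E. \<Sum>c\<in>E. F b e * (\<xi> a (C c) * Q b c)) = (\<Sum>c\<in>E. \<xi> a (C c) * (\<Sum>b\<in>E. F b e * Q b c))"
      by (subst sum.swap) (simp add: sum_distrib_left mult_ac)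
    then show ?thesis by (simp add: sum.distrib sum_distrib_left)
  qed
  \<comment> \<open>the inner sum is \<open>{H, u\<^sub>c}(g)\<close>, the Hamiltonian vector field at its zero \<open>g\<close>\<close>
  also have "(\<Sum>c\<in>E. \<xi> a (C c) * (\<Sum>b\<in>E. F b e * Q b c)) = 0"
    using opp.br_expand(1)[OF sH, of "u c" for c] brg[OF su]
    by (simp add: Fe Q_def u_def)
  also have "(\<Sum>b\<in>E. \<xi> a (F b) * (\<Sum>c\<in>E. C c e * Q b c)) = (\<Sum>b\<in>E. \<xi> a (F b) * br (u b) ?z g)"
    unfolding Ce Q_def u_def opp.br_expand(2)[OF sz] ..
  finally show ?thesis by (simp add: F_def u_def opp.left_coord_def left_coord_def)
qed

lemma modular_vector_left:
  assumes H: "smooth_fun A UNIV H"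
  shows "left_invariant_vf A m e (dual_modular_vector A e P) g H = (\<Sum>a\<in>E. \<xi> a (br (\<lambda>x. H (m g x)) (y a)))"
proof -
  have sH: "smooth_at A x H" for x by (rule smooth_fun_imp_at[OF H]) auto
  then show ?thesis
    using smooth_translate[of g e H]
    by (simp add: left_invariant_vf_def push_vec_def modular_vector(2) o_def)
qed

text \<open>Add the vanishing traces of the group and of its opposite: the two double sums have the same second
derivatives of \<open>H\<close> paired with \<open>P(g)\<close> in opposite order.\<close>

theorem modular_sum_zero:
  assumes H: "smooth_fun A UNIV H" and X: "hamiltonian_vf A P H g = 0"
    and \<Phi>: "volume_form A \<Phi>" "preserves_form A (hamiltonian_vf A P H) \<Phi>"
  shows "left_invariant_vf A m e (dual_modular_vector A e P) g H +
    right_invariant_vf A m e (dual_modular_vector A e P) g H = 0"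
proof -
  interpret opp: poisson_lie_frame A E U \<phi> e "\<lambda>x y. m y x" i P by (rule opposite_poisson)
  have sH: "smooth_at A x H" for x by (rule smooth_fun_imp_at[OF H]) auto
  define l where "l = (\<lambda>a x. y a (m (i g) x))"
  define r where "r = (\<lambda>a x. y a (m x (i g)))"
  let ?K = "\<lambda>a b. \<xi> a (\<lambda>h. \<xi> b (\<lambda>k. H (m (m k g) h)))"
  let ?K' = "\<lambda>a b. \<xi> a (\<lambda>h. \<xi> b (\<lambda>k. H (m h (m g k))))"
  have L: "(\<Sum>a\<in>E. \<xi> a (br (\<lambda>x. H (m g x)) (y a))) + (\<Sum>a\<in>E. \<Sum>b\<in>E. ?K a b * br (r b) (l a) g) = 0"
    using linearization_trace_zero[OF H X \<Phi>] by (simp add: linearization_split[OF H X] sum.distrib l_def r_def)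
  have R: "(\<Sum>a\<in>E. \<xi> a (br (\<lambda>x. H (m x g)) (y a))) + (\<Sum>a\<in>E. \<Sum>b\<in>E. ?K' a b * br (l b) (r a) g) = 0"
    using opp.linearization_trace_zero[OF H X \<Phi>] by (simp add: opp.linearization_split[OF H X] sum.distrib l_def r_def)
  have "(\<Sum>a\<in>E. \<Sum>b\<in>E. ?K' a b * br (l b) (r a) g) = (\<Sum>a\<in>E. \<Sum>b\<in>E. ?K' b a * br (l a) (r b) g)"
    by (rule sum.swap)
  also have "\<dots> = (\<Sum>a\<in>E. \<Sum>b\<in>E. - (?K a b * br (r b) (l a) g))"
  proof (intro sum.cong refl)
    fix a b
    \<comment> \<open>left-invariant and right-invariant derivatives commute\<close>
    have "?K' b a = ?K a b" using two_sided_derivatives(2)[OF sH, of a b g] by (simp add: assoc)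
    then show "?K' b a * br (l a) (r b) g = - (?K a b * br (r b) (l a) g)"
      using br_antisym[of "l a" "r b" g] by simp
  qed
  finally have "(\<Sum>a\<in>E. \<Sum>b\<in>E. ?K' a b * br (l b) (r a) g) = - (\<Sum>a\<in>E. \<Sum>b\<in>E. ?K a b * br (r b) (l a) g)"
    by (simp add: sum_negf)
  then have "(\<Sum>a\<in>E. \<xi> a (br (\<lambda>x. H (m g x)) (y a))) + (\<Sum>a\<in>E. \<xi> a (br (\<lambda>x. H (m x g)) (y a))) = 0"
    using L R by simp
  moreover have "right_invariant_vf A m e (dual_modular_vector A e P) g H =
      left_invariant_vf A (\<lambda>x y. m y x) e (dual_modular_vector A e P) g H"
    by (simp add: right_invariant_vf_def left_invariant_vf_def)
  ultimately show ?thesis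
    by (simp add: modular_vector_left[OF H] opp.modular_vector_left[OF H])
qed

end

section \<open>The modular vector fields at a singular point\<close>

theorem mainTheorem3:
  fixes A :: "('g::{t2_space,second_countable_topology}, 'e::{real_inner,banach}) chart set"
    and m :: "'g \<Rightarrow> 'g \<Rightarrow> 'g" and e :: 'g and i :: "'g \<Rightarrow> 'g"
    and P :: "'g \<Rightarrow> 'g bivec" and H :: "'g \<Rightarrow> real" and g :: 'g
  assumes "poisson_lie_group A m e i P"
    and "connected (UNIV :: 'g set)"
    and "smooth_fun A UNIV H"
    and "hamiltonian_vf A P H g = 0"
    and "\<exists>\<Phi>. volume_form A \<Phi> \<and> preserves_form A (hamiltonian_vf A P H) \<Phi>"
  shows "left_invariant_vf A m e (dual_modular_vector A e P) g H
       + right_invariant_vf A m e (dual_modular_vector A e P) g H = 0"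
proof -
  have lie: "smooth_atlas A" "group m e i" "smooth_map (prod_atlas A A) A (\<lambda>(x, y). m x y)"
    and P: "bivector_field A P" "multiplicative A m P"
    using assms(1) unfolding poisson_lie_group_def lie_group_def poisson_structure_def by auto
  have charts: "\<forall>c\<in>A. is_chart c" and cover: "\<Union> (fst ` A) = UNIV"
    using lie(1) unfolding smooth_atlas_def by - (elim conjE, assumption)+
  obtain B :: "'e set" where "finite B" "span B = UNIV"
    using lie(1) unfolding smooth_atlas_def by fast
  then obtain E :: "'e set" where E: "orthonormal_basis E"
    using orthonormal_basis_exists by blast
  obtain U \<phi> where U: "(U, \<phi>) \<in> A" "e \<in> U" using cover by (metis UNIV_I UN_E prod.collapse)
  interpret chart_frame A E U \<phi> e
    by unfold_locales (use lie E U in auto)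
  have mc: "continuous_on UNIV (\<lambda>(x, y). m x y)" using lie(3) by (simp add: smooth_map_def)
  have vim: "(\<lambda>(x, y). m x y) -` W = {z. m (fst z) (snd z) \<in> W}" for W by auto
  have "poisson_lie_frame A E U \<phi> e m i P"
  proof (intro poisson_lie_frame.intro lie_frame.intro lie_frame_axioms.intro
      poisson_lie_frame_axioms.intro chart_frame_axioms lie P)
    fix W :: "'g set" and f assume W: "open W"
    show "open {z. m (fst z) (snd z) \<in> W}" using open_vimage[OF W mc] by (simp only: vim)
    assume "smooth_fun A W f"
    from smooth_fun_comp_map[OF AA_charts charts cover E lie(3) W this]
    show "smooth_fun AA {z. m (fst z) (snd z) \<in> W} (\<lambda>z. f (m (fst z) (snd z)))"
      by (simp only: vim) (simp add: o_def case_prod_unfold)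
  qed
  then interpret poisson_lie_frame A E U \<phi> e m i P .
  show ?thesis using modular_sum_zero assms(3-5) by blast
qed

end
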